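(* Let $r\ge1$, $m_1,\dots,m_r\in\mathbb N$, $m=\sum_i m_i$, and let $\gamma\in S_m$ have cycles $(1,\dots,m_1)\cdots(m_1+\cdots+m_{r-1}+1,\dots,m)$. Let $\pi,\tau\in\mathcal P(m)$ be such that $\tau\vee\gamma=1_m$ and $$k_\tau\big(x_{i^\pi(1),i^\pi(\gamma(1))},\dots,x_{i^\pi(m),i^\pi(\gamma(m))}\big)\ne0 ,$$ where $x_{i,j}$ are the (unnormalized) entries of a complex Wigner matrix. Then: (1) $\tau\le\overline\pi$. (2) Any block of $\tau$ has even size and it contains the same number of edges in each orientation of the graph $T^\pi$. (3) If $D\in\tau$ is a block such that $e_D^\pi$ is a loop of $T^\pi$, then $D$ has size $2$. (4) There exists $\sigma\in\mathcal P_2(m)$ with $\sigma\le\tau$ such that if $\{u,v\}$ is a block of $\sigma$ then $e_u^\pi$ and $e_v^\pi$ connect the same pair of vertices of $T^\pi$ with opposite orientation. (5) $\#(\pi)-m/2+r-2\le0$. Moreover, equality holds in (5) if and only if there exists $\sigma\in\mathcal P_2(m)$ as in (4) such that all of the following hold: ($L_1$) $\sigma\in NC_2(m_1,\dots,m_r)\cup NC_2^{nc}(m_1,\dots,m_r)$. ($L_2$) For each block $W$ of $\sigma\vee\gamma$, $\pi|_W=\gamma|_W\sigma|_W$ (the right side viewed as the partition of $W$ into cycles). ($L_3$) The graph $T^\pi$ is a quotient graph along edges, all of them non-loops, of the graph $T^{\gamma\sigma}$. ($L_4$) The graph $\overline{T^{\gamma\sigma}(\sigma,\tau)^{\overline{\pi_\tau}}}$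 is a tree.
   Context: **Wigner matrices.** $k_n$ is the classical joint cumulant, and for $\tau\in\mathcal P(m)$, $k_\tau(y_1,\dots,y_m)=\prod_{B\in\tau}k_{|B|}((y_i)_{i\in B})$. A complex random variable $x$ is $R$-diagonal if all its joint classical cumulants in $x,\overline x$ vanish except $\beta_{2n}:=k_{2n}(x,\overline x,\dots,x,\overline x)$ ($n$ copies of each, $n\ge1$). A complex Wigner matrix is a self-adjoint random matrix $X_N=\frac1{\sqrt N}(x_{i,j})_{i,j\le N}$ with $x_{i,j}=\overline{x_{j,i}}$, $E(x_{i,j})=0$, $\{x_{i,j}\}_{i<j}\cup\{x_{i,i}\}_i$ independent, the $x_{i,j}$ ($i<j$) identically distributed $R$-diagonal with cumulant sequence $(\beta_n)_n$ (not depending on $N$), and the $x_{i,i}$ identically distributed $N(0,\beta_2)$. Here $N\geq\#(\pi)$ is arbitrary. **Partitions.** $\mathcal P(m)$, $\mathcal P_2(m)$: partitions and pairings of $[m]$; pairings are identified with permutations and permutations with the partitions into their cycles where needed; $\#$ is the number of blocks or cycles, $\vee$ the join, $\le$ refinement, products are composed right to left. $\pi|_W$ is the restriction to $W$. For a partition $\pi$, $i^\pi:[m]\to\mathbb N$ is constant on blocks with value $k$ on the $k$-th block, blocks being ordered by their minimal elements. **Non-crossing pairings.** $NC_2(m_1,\dots,m_r)$ is the set of $\sigma\in S_m$ with all cycles of size 2, $\sigma\vee\gamma=1_m$ and $\#(\sigma)+\#(\gamma)+\#(\sigma^{-1}\gamma)=m+2$. $NC_2^{nc}(m_1,\dots,m_r)$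 is the set of $\sigma$ with all cycles of size 2, $\sigma\vee\gamma\neq1_m$ and $\#(\sigma)+\#(\gamma)+\#(\sigma^{-1}\gamma)=m+2\#(\sigma\vee\gamma)$. **Graphs.** $T$ is the oriented graph with vertex set $[m]$ and edges $e_j=(\gamma(j),j)$ (from $\gamma(j)$ to $j$), $j\in[m]$. For a partition $\pi$ of $[m]$, $T^\pi$ is the oriented multigraph with vertices the blocks of $\pi$ and edges $e_j^\pi$ from $[\gamma(j)]_\pi$ to $[j]_\pi$, where $[j]_\pi$ is the block containing $j$; two edges connect the same pair of vertices if their unordered pairs of endpoints agree. $\overline\pi\in\mathcal P(m)$: $i,j$ are in the same block iff $e_i^\pi,e_j^\pi$ connect the same pair of vertices. A set $D$ contained in a block of $\overline\pi$, whose edges join vertices $p,q$, contains the same number of edges in each orientation if the number of $j\in D$ with $e_j^\pi=(p,q)$ equals the number with $e_j^\pi=(q,p)$; $e_u^\pi,e_v^\pi$ have opposite orientation if $e_u^\pi=(p,q)$, $e_v^\pi=(q,p)$. If $\tau\le\overline\pi$ and $D\in\tau$, $e_D^\pi$ is (any of) the edges $e_j^\pi$, $j\in D$. $\overline{\pi_\tau}$ is the partition obtained from $\tau$ by merging blocks $D_1,D_2$ of $\tau$ whenever they lie in the same block of $\overline\pi$, except when the $e_{D_i}^\pi$ are loops of $T^\pi$ (those blocks of $\tau$ are left unmerged). The elementarization $\overline G$ of a (multi)graph $G$ is the unoriented graph with the same vertices obtained by replacing all edges connecting the same pair of vertices by one edge. *Quotient along edges ($L_3$):* this means that there are a partition $\rho$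 of the edge set of $\overline{T^{\gamma\sigma}}$ in which every loop is a singleton block, and for each edge $\bar e$ a labelling $(x_{\bar e},y_{\bar e})$ of its two endpoints, such that $\pi$, viewed as a partition of the vertices (cycles) of $T^{\gamma\sigma}$, is the smallest partition that, for each block $B$ of $\rho$ with at least two edges, puts all $x_{\bar e}$ ($\bar e\in B$) in one block and all $y_{\bar e}$ ($\bar e\in B$) in one block. *The graph in ($L_4$):* for a pairing $\sigma\le\tau$, $T^{\gamma\sigma}(\sigma,\tau)$ is the bipartite multigraph with white vertices the connected components of $T^{\gamma\sigma}$, black vertices the blocks of $\tau$, and one edge for each block $B=\{u,v\}$ of $\sigma$, joining the block of $\tau$ containing $B$ with the connected component containing $e_u^{\gamma\sigma}$ and $e_v^{\gamma\sigma}$ (these two edges connect the same pair of vertices). $T^{\gamma\sigma}(\sigma,\tau)^{\overline{\pi_\tau}}$ is obtained by merging black vertices lying in the same block of $\overline{\pi_\tau}$, and the overline denotes its elementarization. *)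

theory Defs
  imports
    "HOL-Probability.Probability"
    "HOL-Combinatorics.Cycles"
    "HOL-Combinatorics.Orbits"
    "Graph_Theory.Digraph_Component"
begin

section \<open>Partitions and permutations\<close>

definition block_of :: "'a set set \<Rightarrow> 'a \<Rightarrow> 'a set" where
  "block_of P j = (THE B. B \<in> P \<and> j \<in> B)"

definition partition_join :: "'a set \<Rightarrow> 'a set set \<Rightarrow> 'a set set \<Rightarrow> 'a set set" where
  "partition_join A P Q = A // (\<Union>B \<in> P \<union> Q. B \<times> B)\<^sup>+"

definition partition_restrict :: "'a set set \<Rightarrow> 'a set \<Rightarrow> 'a set set" where
  "partition_restrict P W = (\<inter>) W ` P - {{}}"

definition perm_cycles :: "'a set \<Rightarrow> ('a \<Rightarrow> 'a) \<Rightarrow> 'a set set" where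
  "perm_cycles A s = orbit s ` A"

definition pairings :: "nat \<Rightarrow> nat set set set" where
  "pairings m = {\<sigma>. partition_on {1..m} \<sigma> \<and> (\<forall>B\<in>\<sigma>. card B = 2)}"

definition pairing_perm :: "nat set set \<Rightarrow> nat \<Rightarrow> nat" where
  "pairing_perm \<sigma> j = (if j \<in> \<Union>\<sigma> then THE k. k \<noteq> j \<and> {j, k} \<in> \<sigma> else j)"

primrec interval_perm_from :: "nat \<Rightarrow> nat list \<Rightarrow> nat \<Rightarrow> nat" where
  "interval_perm_from s [] = id"
| "interval_perm_from s (k # ms) = cycle_of_list [s + 1..<s + k + 1] \<circ> interval_perm_from (s + k) ms"

definition interval_perm :: "nat list \<Rightarrow> nat \<Rightarrow> nat" where
  "interval_perm ms = interval_perm_from 0 ms"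

definition index_of_block :: "nat set set \<Rightarrow> nat \<Rightarrow> nat" where
  "index_of_block \<pi> j = card {B \<in> \<pi>. Min B \<le> Min (block_of \<pi> j)}"

definition NC2 :: "nat list \<Rightarrow> (nat \<Rightarrow> nat) set" where
  "NC2 ms = (let m = sum_list ms; A = {1..m}; \<gamma> = interval_perm ms in
     {s. s permutes A \<and> (\<forall>C \<in> perm_cycles A s. card C = 2) \<and>
         partition_join A (perm_cycles A s) (perm_cycles A \<gamma>) = {A} \<and>
         card (perm_cycles A s) + card (perm_cycles A \<gamma>) + card (perm_cycles A (inv s \<circ> \<gamma>)) = m + 2})"

definition NC2_nc :: "nat list \<Rightarrow> (nat \<Rightarrow> nat) set" where
  "NC2_nc ms = (let m = sum_list ms; A = {1..m}; \<gamma> = interval_perm ms in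
     {s. s permutes A \<and> (\<forall>C \<in> perm_cycles A s. card C = 2) \<and>
         partition_join A (perm_cycles A s) (perm_cycles A \<gamma>) \<noteq> {A} \<and>
         card (perm_cycles A s) + card (perm_cycles A \<gamma>) + card (perm_cycles A (inv s \<circ> \<gamma>))
           = m + 2 * card (partition_join A (perm_cycles A s) (perm_cycles A \<gamma>))})"


section \<open>Cumulants and Wigner matrices\<close>

text \<open>The joint cumulant of the finite family \<open>(y i)\<close>, \<open>i \<in> I\<close>, by Moebius inversion on the lattice
  of partitions of \<open>I\<close>. It is symmetric in its arguments, so no order on \<open>I\<close> is needed.\<close>
definition cumulant :: "'a measure \<Rightarrow> 'i set \<Rightarrow> ('i \<Rightarrow> 'a \<Rightarrow> complex) \<Rightarrow> complex" where
  "cumulant M I y = (\<Sum>\<rho> | partition_on I \<rho>.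
     (- 1) ^ (card \<rho> - 1) * fact (card \<rho> - 1) * (\<Prod>C\<in>\<rho>. integral\<^sup>L M (\<lambda>\<omega>. \<Prod>i\<in>C. y i \<omega>)))"

definition partition_cumulant ::
    "'a measure \<Rightarrow> 'i set set \<Rightarrow> ('i \<Rightarrow> 'a \<Rightarrow> complex) \<Rightarrow> complex" where
  "partition_cumulant M \<tau> y = (\<Prod>B\<in>\<tau>. cumulant M B y)"

definition conj_word :: "('a \<Rightarrow> complex) \<Rightarrow> (nat \<Rightarrow> bool) \<Rightarrow> nat \<Rightarrow> 'a \<Rightarrow> complex" where
  "conj_word x \<epsilon> i = (if \<epsilon> i then x else (\<lambda>\<omega>. cnj (x \<omega>)))"

text \<open>Classical cumulants are symmetric, so the cumulants that may be nonzero, those of the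
  alternating words, are exactly the cumulants of words with as many \<open>x\<close> as conjugates of \<open>x\<close>.
  All moments are required to exist because the Bochner integral of a non-integrable function
  is \<open>0\<close>.\<close>
definition R_diagonal :: "'a measure \<Rightarrow> ('a \<Rightarrow> complex) \<Rightarrow> bool" where
  "R_diagonal M x \<longleftrightarrow>
     x \<in> borel_measurable M \<and> (\<forall>k::nat. integrable M (\<lambda>\<omega>. norm (x \<omega>) ^ k)) \<and>
     (\<forall>n\<ge>1. \<forall>\<epsilon>. card {i \<in> {1..n}. \<epsilon> i} \<noteq> card {i \<in> {1..n}. \<not> \<epsilon> i} \<longrightarrow>
        cumulant M {1..n} (conj_word x \<epsilon>) = 0)"

text \<open>Only the even-indexed terms of the cumulant sequence are meaningful. They are real, since
  conjugation permutes the arguments of the cumulant.\<close>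
definition has_cumulant_sequence ::
    "'a measure \<Rightarrow> ('a \<Rightarrow> complex) \<Rightarrow> (nat \<Rightarrow> real) \<Rightarrow> bool" where
  "has_cumulant_sequence M x \<beta> \<longleftrightarrow>
     (\<forall>n\<ge>1. cumulant M {1..2 * n} (conj_word x odd) = complex_of_real (\<beta> (2 * n)))"

text \<open>\<open>N(0, v)\<close> with variance \<open>v\<close>; for \<open>v = 0\<close> it is the point mass at \<open>0\<close>.\<close>
definition centered_normal :: "'a measure \<Rightarrow> ('a \<Rightarrow> real) \<Rightarrow> real \<Rightarrow> bool" where
  "centered_normal M Y v \<longleftrightarrow> 0 \<le> v \<and> Y \<in> borel_measurable M \<and>
     (if v = 0 then AE \<omega> in M. Y \<omega> = 0
      else distributed M lborel Y (\<lambda>t. ennreal (normal_density 0 (sqrt v) t)))"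

text \<open>The unnormalized entries \<open>x i j\<close>, \<open>i, j \<in> {1..N}\<close>, of a complex Wigner matrix.\<close>
definition wigner_entries ::
    "'a measure \<Rightarrow> nat \<Rightarrow> (nat \<Rightarrow> real) \<Rightarrow> (nat \<Rightarrow> nat \<Rightarrow> 'a \<Rightarrow> complex) \<Rightarrow> bool" where
  "wigner_entries M N \<beta> x \<longleftrightarrow>
     (\<forall>i\<in>{1..N}. \<forall>j\<in>{1..N}. x i j \<in> borel_measurable M \<and>
        (\<forall>\<omega>\<in>space M. x i j \<omega> = cnj (x j i \<omega>)) \<and> integral\<^sup>L M (x i j) = 0) \<and>
     prob_space.indep_vars M (\<lambda>_. borel) (\<lambda>(i, j). x i j) {(i, j). 1 \<le> i \<and> i \<le> j \<and> j \<le> N} \<and>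
     (\<forall>i j k l. 1 \<le> i \<and> i < j \<and> j \<le> N \<and> 1 \<le> k \<and> k < l \<and> l \<le> N \<longrightarrow>
        distr M borel (x i j) = distr M borel (x k l)) \<and>
     (\<forall>i j. 1 \<le> i \<and> i < j \<and> j \<le> N \<longrightarrow>
        R_diagonal M (x i j) \<and> has_cumulant_sequence M (x i j) \<beta>) \<and>
     (\<forall>i\<in>{1..N}. centered_normal M (\<lambda>\<omega>. Re (x i i \<omega>)) (\<beta> 2))"


section \<open>Graphs\<close>

definition T_graph :: "nat list \<Rightarrow> (nat, nat) pre_digraph" where
  "T_graph ms = \<lparr> verts = {1..sum_list ms}, arcs = {1..sum_list ms},
                  tail = interval_perm ms, head = id \<rparr>"

definition identify_verts :: "('v \<Rightarrow> 'w) \<Rightarrow> ('v, 'e) pre_digraph \<Rightarrow> ('w, 'e) pre_digraph" where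
  "identify_verts f G = \<lparr> verts = f ` verts G, arcs = arcs G, tail = f \<circ> tail G, head = f \<circ> head G \<rparr>"

definition T_quot :: "nat list \<Rightarrow> nat set set \<Rightarrow> (nat set, nat) pre_digraph" where
  "T_quot ms \<pi> = identify_verts (block_of \<pi>) (T_graph ms)"

definition endpoints :: "('v, 'e) pre_digraph \<Rightarrow> 'e \<Rightarrow> 'v set" where
  "endpoints G e = {tail G e, head G e}"

definition is_loop :: "('v, 'e) pre_digraph \<Rightarrow> 'e \<Rightarrow> bool" where
  "is_loop G e \<longleftrightarrow> tail G e = head G e"

definition opposite_orientation :: "('v, 'e) pre_digraph \<Rightarrow> 'e \<Rightarrow> 'e \<Rightarrow> bool" where
  "opposite_orientation G e f \<longleftrightarrow> tail G e = head G f \<and> head G e = tail G f"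

text \<open>The partition written \<open>\<pi>\<close> with an overline, for \<open>G = T_quot ms \<pi>\<close>.\<close>
definition parallel_classes :: "('v, 'e) pre_digraph \<Rightarrow> 'e set set" where
  "parallel_classes G = (\<lambda>e. {f \<in> arcs G. endpoints G f = endpoints G e}) ` arcs G"

definition balanced_edges :: "('v, 'e) pre_digraph \<Rightarrow> 'e set \<Rightarrow> bool" where
  "balanced_edges G D \<longleftrightarrow>
     (\<forall>p q. card {e \<in> D. arc_to_ends G e = (p, q)} = card {e \<in> D. arc_to_ends G e = (q, p)})"

text \<open>The partition written \<open>\<pi>\<^sub>\<tau>\<close> with an overline. It is used only when \<open>\<tau>\<close> refines
  \<open>parallel_classes (T_quot ms \<pi>)\<close>; then all edges in a block of \<open>\<tau>\<close> are loops as soon as one is.\<close>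
definition merge_nonloops :: "('v, 'e) pre_digraph \<Rightarrow> 'e set set \<Rightarrow> 'e set set" where
  "merge_nonloops G \<tau> =
     (\<lambda>D. \<Union>{D' \<in> \<tau>. D' = D \<or>
        ((\<exists>B \<in> parallel_classes G. D \<subseteq> B \<and> D' \<subseteq> B) \<and>
         \<not> (\<exists>e\<in>D. is_loop G e) \<and> \<not> (\<exists>e\<in>D'. is_loop G e))}) ` \<tau>"

text \<open>Vertex sets of the connected components, orientations being ignored.\<close>
definition components_of :: "('v, 'e) pre_digraph \<Rightarrow> 'v set set" where
  "components_of G = pre_digraph.sccs_verts (with_proj (mk_symmetric G))"

text \<open>Simple unoriented graphs; an edge is its set of endpoints, a singleton if it is a loop.\<close>
record 'v ugraph =
  uverts :: "'v set"
  uedges :: "'v set set"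

definition elementarization :: "('v, 'e) pre_digraph \<Rightarrow> 'v ugraph" where
  "elementarization G = \<lparr> uverts = verts G, uedges = endpoints G ` arcs G \<rparr>"

definition ugraph_connected :: "'v ugraph \<Rightarrow> bool" where
  "ugraph_connected H \<longleftrightarrow> uverts H \<noteq> {} \<and>
     (\<forall>u \<in> uverts H. \<forall>v \<in> uverts H. (u, v) \<in> {(a, b). {a, b} \<in> uedges H}\<^sup>*)"

text \<open>A loop is a cycle of length 1; length 2 is excluded as it would traverse one edge twice.\<close>
definition ugraph_cycle :: "'v ugraph \<Rightarrow> 'v list \<Rightarrow> bool" where
  "ugraph_cycle H vs \<longleftrightarrow> distinct vs \<and> (length vs = 1 \<or> 3 \<le> length vs) \<and>
     (\<forall>i < length vs. {vs ! i, vs ! (Suc i mod length vs)} \<in> uedges H)"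

definition ugraph_tree :: "'v ugraph \<Rightarrow> bool" where
  "ugraph_tree H \<longleftrightarrow> ugraph_connected H \<and> (\<nexists>vs. ugraph_cycle H vs)"

text \<open>The partition of the set \<open>V\<close> of blocks (of a finer partition) induced by \<open>\<pi>\<close>.\<close>
definition partition_of_blocks :: "'a set set \<Rightarrow> 'a set set \<Rightarrow> 'a set set set" where
  "partition_of_blocks V \<pi> = (\<lambda>P. {C \<in> V. C \<subseteq> P}) ` \<pi>"

definition glues_edges ::
    "'v set set set \<Rightarrow> ('v set \<Rightarrow> 'v) \<Rightarrow> ('v set \<Rightarrow> 'v) \<Rightarrow> 'v set set \<Rightarrow> bool" where
  "glues_edges \<rho> x y Q \<longleftrightarrow>
     (\<forall>B\<in>\<rho>. 2 \<le> card B \<longrightarrow> (\<exists>C\<in>Q. x ` B \<subseteq> C) \<and> (\<exists>C\<in>Q. y ` B \<subseteq> C))"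

text \<open>For \<open>\<kappa>\<close> the partition into cycles of \<open>\<gamma>\<sigma>\<close>: the graph \<open>T_quot ms \<pi>\<close> is a quotient of
  \<open>T_quot ms \<kappa>\<close> along edges, all of them non-loops.\<close>
definition quotient_along_nonloops :: "nat list \<Rightarrow> nat set set \<Rightarrow> nat set set \<Rightarrow> bool" where
  "quotient_along_nonloops ms \<kappa> \<pi> \<longleftrightarrow> refines {1..sum_list ms} \<kappa> \<pi> \<and>
     (let V = verts (T_quot ms \<kappa>); E = uedges (elementarization (T_quot ms \<kappa>)) in
      \<exists>\<rho> x y. partition_on E \<rho> \<and> (\<forall>e\<in>E. card e = 1 \<longrightarrow> {e} \<in> \<rho>) \<and>
        (\<forall>e\<in>E. e = {x e, y e}) \<and>
        partition_on V (partition_of_blocks V \<pi>) \<and> glues_edges \<rho> x y (partition_of_blocks V \<pi>) \<and>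
        (\<forall>Q. partition_on V Q \<and> glues_edges \<rho> x y Q \<longrightarrow> refines V (partition_of_blocks V \<pi>) Q))"

text \<open>The graph with the components of \<open>T_quot ms \<kappa>\<close> (white, \<open>Inl\<close>), the blocks of \<open>\<tau>\<close> (black,
  \<open>Inr\<close>), and one edge for each block of \<open>\<sigma>\<close>. It is unoriented: all edges are directed from black
  to white only in order to use the type of oriented multigraphs. Both elements of a block of
  \<open>\<sigma>\<close> give edges with the same endpoints, so its minimum may serve as a representative.\<close>
definition bipartite_graph ::
    "nat list \<Rightarrow> nat set set \<Rightarrow> nat set set \<Rightarrow> nat set set \<Rightarrow> (nat set set + nat set, nat set) pre_digraph" where
  "bipartite_graph ms \<kappa> \<sigma> \<tau> =
     \<lparr> verts = Inl ` components_of (T_quot ms \<kappa>) \<union> Inr ` \<tau>,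
       arcs = \<sigma>,
       tail = (\<lambda>B. Inr (block_of \<tau> (Min B))),
       head = (\<lambda>B. Inl (THE K. K \<in> components_of (T_quot ms \<kappa>) \<and> head (T_quot ms \<kappa>) (Min B) \<in> K)) \<rparr>"

definition merge_black ::
    "'b set set \<Rightarrow> ('w + 'b set, 'e) pre_digraph \<Rightarrow> ('w + 'b set, 'e) pre_digraph" where
  "merge_black P G = identify_verts (map_sum id (\<lambda>D. THE B. B \<in> P \<and> D \<subseteq> B)) G"


section \<open>The conditions on the pairing\<close>

definition opposite_pairing :: "nat list \<Rightarrow> nat set set \<Rightarrow> nat set set \<Rightarrow> nat set set \<Rightarrow> bool" where
  "opposite_pairing ms \<pi> \<tau> \<sigma> \<longleftrightarrow>
     \<sigma> \<in> pairings (sum_list ms) \<and> refines {1..sum_list ms} \<sigma> \<tau> \<and>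
     (\<forall>u v. u \<noteq> v \<and> {u, v} \<in> \<sigma> \<longrightarrow>
        endpoints (T_quot ms \<pi>) u = endpoints (T_quot ms \<pi>) v \<and>
        opposite_orientation (T_quot ms \<pi>) u v)"

definition gamma_sigma :: "nat list \<Rightarrow> nat set set \<Rightarrow> nat set set" where
  "gamma_sigma ms \<sigma> = perm_cycles {1..sum_list ms} (interval_perm ms \<circ> pairing_perm \<sigma>)"

definition cond_L1 :: "nat list \<Rightarrow> nat set set \<Rightarrow> bool" where
  "cond_L1 ms \<sigma> \<longleftrightarrow> pairing_perm \<sigma> \<in> NC2 ms \<union> NC2_nc ms"

definition cond_L2 :: "nat list \<Rightarrow> nat set set \<Rightarrow> nat set set \<Rightarrow> bool" where
  "cond_L2 ms \<pi> \<sigma> \<longleftrightarrow>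
     (\<forall>W \<in> partition_join {1..sum_list ms} \<sigma> (perm_cycles {1..sum_list ms} (interval_perm ms)).
        partition_restrict \<pi> W =
        perm_cycles W (perm_restrict (interval_perm ms) W \<circ> perm_restrict (pairing_perm \<sigma>) W))"

definition cond_L3 :: "nat list \<Rightarrow> nat set set \<Rightarrow> nat set set \<Rightarrow> bool" where
  "cond_L3 ms \<pi> \<sigma> \<longleftrightarrow> quotient_along_nonloops ms (gamma_sigma ms \<sigma>) \<pi>"

definition cond_L4 :: "nat list \<Rightarrow> nat set set \<Rightarrow> nat set set \<Rightarrow> nat set set \<Rightarrow> bool" where
  "cond_L4 ms \<pi> \<tau> \<sigma> \<longleftrightarrow>
     ugraph_tree (elementarization
       (merge_black (merge_nonloops (T_quot ms \<pi>) \<tau>) (bipartite_graph ms (gamma_sigma ms \<sigma>) \<sigma> \<tau>)))"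

end

theory Submission
  imports Defs
begin

text \<open>
  A nonzero cumulant of independent entries forces the edges in a block of \<open>\<tau>\<close> to be parallel;
  \<open>R\<close>-diagonality balances their orientations, and a Gaussian has no cumulant of order other than
  two. Pairing opposite edges inside the blocks gives \<open>\<sigma>\<close> with \<open>\<gamma>\<sigma> \<le> \<pi>\<close>. Put
  \<open>c = #(\<sigma> \<or> \<gamma>)\<close>. Then \<open>#(\<pi>) \<le> m/2 - r + 2\<close> is the sum of three inequalities:
  the genus inequality \<open>#(\<gamma>\<sigma>) + r \<le> m/2 + 2 c\<close>; the inequality
  \<open>\<Sum>\<^sub>W #(\<pi>|W) \<le> #(\<gamma>\<sigma>)\<close> over the blocks \<open>W\<close> of \<open>\<sigma> \<or> \<gamma>\<close>; and
  \<open>#(\<pi>) + 2 (c - 1) \<le> \<Sum>\<^sub>W #(\<pi>|W)\<close>, which holds because \<open>\<tau>\<close> connects the blocks \<open>W\<close>, so that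
  they can be added one at a time, each sharing a non-loop edge, hence two vertices, with its
  predecessors. Equality in the first is \<open>L\<^sub>1\<close> and in the second \<open>L\<^sub>2\<close>; given these, equality in
  the third means that exactly two vertices are shared at each step, which amounts to \<open>L\<^sub>3\<close> and
  \<open>L\<^sub>4\<close>.
\<close>

section \<open>Partitions\<close>

text \<open>Passing from \<tau> to a pairing \<sigma> makes a genus argument possible but may
  disconnect the picture, since only \<tau> is known to connect the cycles of \<gamma>. The genus
  inequality then allows 2 c, and reconnecting must give back 2 (c - 1). That each reconnection
  costs two vertices rests on the Gaussian diagonal: a loop block of \<tau> has size two, so it is a
  block of \<sigma> and stays in one component; a block of \<tau> joining two components therefore
  consists of non-loops. The components can be added in many orders, so the third inequality is put
  as nonnegativity of a defect that does not decrease when any set of components is enlarged along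
  shared edges. A cycle in the graph of L4 would make the defect positive. The converse is a count:
  L3 says that \<pi> arises from the cycles of \<gamma>\<sigma> by at most 2 N identifications of
  vertices, and a forest has room only for N \<le> c - 1. The criterion for equality holds for each
  \<sigma> as in (4) separately, so the choice of \<sigma> does not affect it.\<close>

lemma partition_on_block_ex1:
  assumes "partition_on A P" "j \<in> A"
  shows "\<exists>!B. B \<in> P \<and> j \<in> B"
proof -
  obtain B where "B \<in> P" "j \<in> B" using assms by (auto simp: partition_on_def)
  moreover have "C = D" if "C \<in> P" "D \<in> P" "j \<in> C" "j \<in> D" for C D
    using assms(1) that disjointD[of P C D] by (auto simp: partition_on_def)
  ultimately show ?thesis by blast
qed

lemma block_of:
  assumes "partition_on A P" "j \<in> A"
  shows "block_of P j \<in> P" "j \<in> block_of P j"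
  using theI'[OF partition_on_block_ex1[OF assms]] unfolding block_of_def by auto

lemma block_of_eqI:
  assumes "partition_on A P" "B \<in> P" "j \<in> B"
  shows "block_of P j = B"
proof -
  have "j \<in> A" using assms by (auto simp: partition_on_def)
  then show ?thesis
    using partition_on_block_ex1[OF assms(1)] block_of[OF assms(1)] assms(2,3) by blast
qed

lemma partition_on_subset: "partition_on A P \<Longrightarrow> B \<in> P \<Longrightarrow> B \<subseteq> A"
  by (auto simp: partition_on_def)

lemma partition_on_ex_elem: "partition_on A P \<Longrightarrow> B \<in> P \<Longrightarrow> \<exists>j\<in>A. j \<in> B"
  unfolding partition_on_def by (metis Union_iff ex_in_conv)

lemma partition_eq_image_block_of:
  assumes P: "partition_on A P"
  shows "P = block_of P ` A"
proof (intro equalityI subsetI)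
  fix B assume B: "B \<in> P"
  then obtain j where j: "j \<in> A" "j \<in> B" using partition_on_ex_elem[OF P] by blast
  then have "B = block_of P j" using block_of_eqI[OF P B] by simp
  then show "B \<in> block_of P ` A" using j(1) by (rule image_eqI)
qed (use block_of(1)[OF P] in auto)

lemma card_image_block_of: "partition_on A P \<Longrightarrow> card (block_of P ` A) = card P"
  by (metis partition_eq_image_block_of)

lemma partition_on_fibers: "partition_on A ((\<lambda>i. {j \<in> A. f j = f i}) ` A)"
  by (auto simp: partition_on_def disjoint_def)

lemma card_fibers: "finite A \<Longrightarrow> card ((\<lambda>i. {j \<in> A. f j = f i}) ` A) = card (f ` A)"
proof -
  have "(\<lambda>i. {j \<in> A. f j = f i}) ` A = (\<lambda>v. {j \<in> A. f j = v}) ` (f ` A)" by auto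
  moreover have "inj_on (\<lambda>v. {j \<in> A. f j = v}) (f ` A)" by (auto simp: inj_on_def)
  ultimately show ?thesis by (metis card_image)
qed

text \<open>On \<open>A\<close>, \<open>f\<close> factors through \<open>g\<close>; \<open>h\<close>
  is the factor, obtained by choosing a point in each fibre. Numbers of blocks or cycles are
  compared by writing a partition as the image of \<open>block_of\<close> or
  \<open>orbit\<close>.\<close>

lemma card_image_le_factor:
  assumes "finite A" and "\<And>i j. i \<in> A \<Longrightarrow> j \<in> A \<Longrightarrow> g i = g j \<Longrightarrow> f i = f j"
  shows "card (f ` A) \<le> card (g ` A)"
proof -
  define h where "h v = f (SOME i. i \<in> A \<and> g i = v)" for v
  have "h (g i) = f i" if "i \<in> A" for i
  proof -
    have "(SOME j. j \<in> A \<and> g j = g i) \<in> A \<and> g (SOME j. j \<in> A \<and> g j = g i) = g i"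
      by (rule someI[of "\<lambda>j. j \<in> A \<and> g j = g i" i]) (use that in auto)
    then show ?thesis unfolding h_def by (intro assms(2)) (use that in auto)
  qed
  then have "f ` A = h ` g ` A" by (simp add: image_image)
  then show ?thesis using assms(1) by (simp add: card_image_le)
qed

lemma refinesI_block_of:
  assumes "partition_on A P" "partition_on A Q"
    and "\<And>i j. i \<in> A \<Longrightarrow> j \<in> A \<Longrightarrow> block_of P i = block_of P j \<Longrightarrow> block_of Q i = block_of Q j"
  shows "refines A P Q"
  unfolding refines_def
proof (intro conjI ballI assms(1,2))
  fix X assume X: "X \<in> P"
  then obtain i where i: "i \<in> X" "i \<in> A" using partition_on_ex_elem[OF assms(1)] by blast
  have "X \<subseteq> block_of Q i"
  proof
    fix j assume j: "j \<in> X"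
    then have "j \<in> A" using X partition_on_subset[OF assms(1)] by blast
    moreover have "block_of P i = block_of P j" using block_of_eqI[OF assms(1) X] i j by simp
    ultimately have "block_of Q i = block_of Q j" using assms(3) i by blast
    then show "j \<in> block_of Q i" using block_of(2)[OF assms(2) \<open>j \<in> A\<close>] by simp
  qed
  then show "\<exists>Y\<in>Q. X \<subseteq> Y" using block_of(1)[OF assms(2) i(2)] by blast
qed

lemma refines_block_of:
  assumes "refines A P Q" "i \<in> A" "j \<in> A" "block_of P i = block_of P j"
  shows "block_of Q i = block_of Q j"
proof -
  have P: "partition_on A P" and Q: "partition_on A Q" using assms(1) by (auto simp: refines_def)
  obtain Y where "Y \<in> Q" "block_of P i \<subseteq> Y"
    using assms(1) block_of(1)[OF P assms(2)] by (auto simp: refines_def)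
  then show ?thesis
    using block_of(2)[OF P assms(2)] block_of(2)[OF P assms(3)] assms(4) block_of_eqI[OF Q]
    by (metis subsetD)
qed

lemma refines_block_subset:
  assumes "refines A P Q" "i \<in> A"
  shows "block_of P i \<subseteq> block_of Q i"
proof -
  have P: "partition_on A P" and Q: "partition_on A Q" using assms(1) by (auto simp: refines_def)
  obtain Y where "Y \<in> Q" "block_of P i \<subseteq> Y"
    using assms(1) block_of(1)[OF P assms(2)] by (auto simp: refines_def)
  then show ?thesis using block_of_eqI[OF Q] block_of(2)[OF P assms(2)] by blast
qed

lemma refines_card_le:
  assumes "finite A" "refines A P Q"
  shows "card Q \<le> card P"
proof -
  have P: "partition_on A P" and Q: "partition_on A Q" using assms(2) by (auto simp: refines_def)
  have "card (block_of Q ` A) \<le> card (block_of P ` A)"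
    using refines_block_of[OF assms(2)] by (intro card_image_le_factor assms(1))
  then show ?thesis
    using card_image_block_of[OF P] card_image_block_of[OF Q] by simp
qed

section \<open>Joins, and the cost of merging labels\<close>

context
  fixes A :: "'a set" and P Q :: "'a set set"
  assumes P: "partition_on A P" and Q: "partition_on A Q"
begin

private abbreviation "R \<equiv> \<Union>B \<in> P \<union> Q. B \<times> B"

private lemma equiv_join_rel: "equiv A (R\<^sup>+)"
proof (rule equivI)
  have "R \<subseteq> A \<times> A" using P Q by (auto simp: partition_on_def)
  then show "R\<^sup>+ \<subseteq> A \<times> A" by (rule trancl_subset_Sigma)
  have "(i, i) \<in> R" if "i \<in> A" for i using block_of[OF P that] by blast
  then show "refl_on A (R\<^sup>+)" unfolding refl_on_def by blast
  have "sym R" by (auto simp: sym_def)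
  then show "sym (R\<^sup>+)" by (rule sym_trancl)
qed simp

lemma partition_on_join: "partition_on A (partition_join A P Q)"
  unfolding partition_join_def by (rule partition_on_quotient[OF equiv_join_rel])

private lemma refines_join:
  assumes P': "P' \<in> {P, Q}"
  shows "refines A P' (partition_join A P Q)"
  unfolding refines_def
proof (intro conjI ballI partition_on_join)
  show part: "partition_on A P'" using P' P Q by blast
  fix X assume X: "X \<in> P'"
  then obtain i where i: "i \<in> X" "i \<in> A" using partition_on_ex_elem[OF part] by blast
  then have "X \<subseteq> R\<^sup>+ `` {i}" using X P' by blast
  then show "\<exists>Y\<in>partition_join A P Q. X \<subseteq> Y"
    using i unfolding partition_join_def quotient_def by blast
qed

lemmas refines_join1 = refines_join[of P, simplified] and refines_join2 = refines_join[of Q, simplified]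

text \<open>The universal property of the join, phrased for labels instead of coarser partitions;
  the connectivity arguments below choose a suitable label \<open>f\<close>.\<close>

lemma join_block_constant:
  assumes "\<And>B i j. B \<in> P \<union> Q \<Longrightarrow> i \<in> B \<Longrightarrow> j \<in> B \<Longrightarrow> f i = f j"
    and "W \<in> partition_join A P Q" "i \<in> W" "j \<in> W"
  shows "f i = f j"
proof -
  obtain k where W: "W = R\<^sup>+ `` {k}" using assms(2) by (auto simp: partition_join_def quotient_def)
  have *: "f k = f j" if "(k, j) \<in> R\<^sup>+" for j
    using that by induction (use assms(1) in auto)
  have "f k = f i" "f k = f j" by (rule *, use assms(3,4) W in blast)+
  then show ?thesis by simp
qed

lemma card_image_le_join:
  assumes "finite A" "\<And>B i j. B \<in> P \<union> Q \<Longrightarrow> i \<in> B \<Longrightarrow> j \<in> B \<Longrightarrow> f i = f j"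
  shows "card (f ` A) \<le> card (partition_join A P Q)"
proof -
  note J = partition_on_join
  have "card (f ` A) \<le> card (block_of (partition_join A P Q) ` A)"
  proof (rule card_image_le_factor[OF assms(1)])
    fix i j assume ij: "i \<in> A" "j \<in> A" "block_of (partition_join A P Q) i = block_of (partition_join A P Q) j"
    then have "j \<in> block_of (partition_join A P Q) i" using block_of[OF J] by simp
    then show "f i = f j"
      using join_block_constant[of f] assms(2) block_of[OF J ij(1)] by metis
  qed
  then show ?thesis using card_image_block_of[OF J] by simp
qed

end

text \<open>Renaming the value \<open>u\<close> to \<open>v\<close> can remove only \<open>u\<close>
  from the image.\<close>

lemma card_image_relabel:
  assumes "finite A"
  shows "card (f ` A) \<le> Suc (card ((\<lambda>x. if f x = u then v else f x) ` A))"
proof -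
  let ?g = "\<lambda>x. if f x = u then v else f x"
  have "card (f ` A) \<le> card (insert u (?g ` A))"
    using assms by (intro card_mono) auto
  also have "\<dots> \<le> Suc (card (?g ` A))" using assms by (simp add: card_insert_if)
  finally show ?thesis .
qed

text \<open>\<open>f\<close> labels the components of the graph with edge set \<open>R\<close>:
  starting from distinct labels, each pair costs at most one label.\<close>

lemma exists_merging_labels:
  fixes A :: "'a set"
  assumes "finite A" "finite R"
  shows "\<exists>f :: 'a \<Rightarrow> 'a. (\<forall>(a, b)\<in>R. f a = f b) \<and> card A \<le> card (f ` A) + card R"
  using assms(2)
proof induction
  case empty
  show ?case by (intro exI[of _ id]) auto
next
  case (insert p R)
  then obtain f :: "'a \<Rightarrow> 'a" where f: "\<forall>(a, b)\<in>R. f a = f b" "card A \<le> card (f ` A) + card R" by blast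
  obtain a b where p: "p = (a, b)" by (cases p)
  define g where "g x = (if f x = f b then f a else f x)" for x
  have "card (f ` A) \<le> Suc (card (g ` A))"
    unfolding g_def by (rule card_image_relabel[OF assms(1)])
  then show ?case using f insert.hyps p by (intro exI[of _ g]) (auto simp: g_def)
qed

section \<open>Cycles of permutations\<close>

lemma permutation_if_permutes: "finite A \<Longrightarrow> p permutes A \<Longrightarrow> permutation p"
  unfolding permutation_permutes by blast

lemma self_in_orbit: "finite A \<Longrightarrow> p permutes A \<Longrightarrow> i \<in> orbit p i"
  using permutation_if_permutes permutation_self_in_orbit by metis

lemma orbit_eqD: "finite A \<Longrightarrow> p permutes A \<Longrightarrow> j \<in> orbit p i \<Longrightarrow> orbit p j = orbit p i"
  using permutation_if_permutes cyclic_on_orbit' orbit_cyclic_eq3 by metis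

lemma orbit_partition:
  assumes "finite A" "p permutes A"
  shows "partition_on A (perm_cycles A p)"
proof -
  have perm: "permutation p" using assms permutation_if_permutes by blast
  have "\<Union>(orbit p ` A) = A"
    using permutes_orbit_subset[OF assms(2)] permutation_self_in_orbit[OF perm] by blast
  moreover have "orbit p i = orbit p j" if "k \<in> orbit p i" "k \<in> orbit p j" for i j k
    using that orbit_cyclic_eq3[OF cyclic_on_orbit'[OF perm]] by metis
  ultimately show ?thesis
    using orbit_nonempty[of p] unfolding partition_on_def perm_cycles_def disjoint_def by blast
qed

lemma block_of_perm_cycles:
  assumes "finite A" "p permutes A" "i \<in> A"
  shows "block_of (perm_cycles A p) i = orbit p i"
proof (rule block_of_eqI[OF orbit_partition[OF assms(1,2)]])
  show "orbit p i \<in> perm_cycles A p" using assms by (auto simp: perm_cycles_def)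
  show "i \<in> orbit p i"
    by (rule self_in_orbit[OF assms(1,2)])
qed

lemma orbit_apply_eq:
  assumes "finite A" "p permutes A"
  shows "orbit p (p i) = orbit p i"
  using assms permutation_if_permutes permutation_orbit_step by metis

lemma orbit_invariant:
  assumes "\<And>i. f (p i) = f i" "j \<in> orbit p i"
  shows "f j = f i"
  using assms(2) by induction (simp_all add: assms(1))

lemma perm_cycles_invariant_card:
  assumes "finite A" "p permutes A" "\<And>i. f (p i) = f i"
  shows "card (f ` A) \<le> card (perm_cycles A p)"
  unfolding perm_cycles_def
proof (rule card_image_le_factor[OF assms(1)])
  fix i j assume ij: "i \<in> A" "j \<in> A" "orbit p i = orbit p j"
  have "j \<in> orbit p j" by (rule self_in_orbit[OF assms(1,2)])
  then show "f i = f j" using orbit_invariant[of f p j i, OF assms(3)] ij(3) by simp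
qed

text \<open>An invariant \<open>f\<close> descends to a map \<open>g\<close> on cycles, and the
  cycles of \<open>a\<close> and \<open>b\<close> show that \<open>g\<close> is not
  injective.\<close>

lemma perm_cycles_invariant_card_less:
  assumes "finite A" "p permutes A" "\<And>i. f (p i) = f i"
    and "a \<in> A" "b \<in> A" "orbit p a \<noteq> orbit p b" "f a = f b"
  shows "card (f ` A) < card (perm_cycles A p)"
proof -
  define g where "g C = f (SOME i. i \<in> C)" for C
  have fo: "f j = f i" if "j \<in> orbit p i" for i j by (rule orbit_invariant[of f p j i, OF assms(3) that])
  have g: "g (orbit p i) = f i" for i
    unfolding g_def by (rule fo, rule someI[of _ "p i"], rule orbit.base)
  have im: "g ` perm_cycles A p = f ` A" unfolding perm_cycles_def image_image g ..
  have "\<not> inj_on g (perm_cycles A p)"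
    using assms(4-7) g unfolding perm_cycles_def inj_on_def by (metis image_eqI)
  then have "card (g ` perm_cycles A p) \<noteq> card (perm_cycles A p)"
    using assms(1) unfolding perm_cycles_def by (metis eq_card_imp_inj_on finite_imageI)
  moreover have "card (g ` perm_cycles A p) \<le> card (perm_cycles A p)"
    using assms(1) by (simp add: card_image_le perm_cycles_def)
  ultimately show ?thesis using im by simp
qed

text \<open>The new permutation sends \<open>a\<close> to \<open>p b\<close> and then runs along the
  \<open>p\<close>-cycle of \<open>b\<close>, which avoids \<open>a\<close>, until it arrives at
  \<open>b\<close>.\<close>

lemma orbit_transpose_merge:
  assumes "finite A" "p permutes A" "b \<in> A" "a \<notin> orbit p b"
  shows "b \<in> orbit (p \<circ> Transposition.transpose a b) a"
proof -
  let ?q = "p \<circ> Transposition.transpose a b"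
  have b: "b \<in> orbit p b" by (rule self_in_orbit[OF assms(1,2)])
  have "j \<in> orbit ?q a \<or> b \<in> orbit ?q a" if "j \<in> orbit p b" for j
    using that
  proof induction
    case base
    have "?q a = p b" by simp
    then show ?case using orbit.base[of ?q a] by metis
  next
    case (step j)
    show ?case
    proof (cases "j = b")
      case False
      have "j \<noteq> a" using step.hyps assms(4) by blast
      with False have "?q j = p j" by simp
      then show ?thesis using step.IH orbit.step[of j ?q a] by metis
    qed (use step.IH in blast)
  qed
  then show ?thesis using b by blast
qed

text \<open>Since \<open>a\<close> and \<open>b\<close> share a cycle of the new permutation, its
  cycle labels do not notice the transposition and are invariant under \<open>p\<close>. Two
  different cycles of \<open>p\<close> thus carry one label.\<close>

lemma card_cycles_transpose_merge:
  assumes "finite A" "p permutes A" "a \<in> A" "b \<in> A" "orbit p a \<noteq> orbit p b"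
  shows "card (perm_cycles A (p \<circ> Transposition.transpose a b)) < card (perm_cycles A p)"
proof -
  let ?q = "p \<circ> Transposition.transpose a b"
  have q: "?q permutes A" using assms by (intro permutes_compose permutes_swap_id)
  have "a \<notin> orbit p b"
    using assms(5) orbit_eqD[OF assms(1,2)] by metis
  then have "b \<in> orbit ?q a" by (rule orbit_transpose_merge[OF assms(1,2,4)])
  then have eq: "orbit ?q a = orbit ?q b"
    using orbit_eqD[OF assms(1) q] by metis
  have t: "orbit ?q (Transposition.transpose a b i) = orbit ?q i" for i
    by (cases "i = a \<or> i = b") (use eq in \<open>auto simp: Transposition.transpose_def\<close>)
  have inv: "orbit ?q (p i) = orbit ?q i" for i
  proof -
    have "orbit ?q (?q (Transposition.transpose a b i)) = orbit ?q (Transposition.transpose a b i)"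
      by (rule orbit_apply_eq[OF assms(1) q])
    then show ?thesis using t by simp
  qed
  show ?thesis
    using perm_cycles_invariant_card_less[of A p "orbit ?q", OF assms(1,2) inv assms(3-5) eq]
    by (simp add: perm_cycles_def)
qed

text \<open>Identifying the labels of the new cycles of \<open>a\<close> and \<open>b\<close> makes
  them invariant under \<open>p\<close>, at the cost of at most one label.\<close>

lemma card_cycles_transpose_le:
  assumes "finite A" "p permutes A" "a \<in> A" "b \<in> A"
  shows "card (perm_cycles A (p \<circ> Transposition.transpose a b)) \<le> Suc (card (perm_cycles A p))"
proof -
  let ?q = "p \<circ> Transposition.transpose a b"
  have q: "?q permutes A" using assms by (intro permutes_compose permutes_swap_id)
  define g where "g x = (if orbit ?q x = orbit ?q b then orbit ?q a else orbit ?q x)" for x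
  have oq: "orbit ?q (?q i) = orbit ?q i" for i by (rule orbit_apply_eq[OF assms(1) q])
  have gq: "g (?q i) = g i" for i unfolding g_def oq ..
  have gt: "g (Transposition.transpose a b i) = g i" for i
    by (cases "i = a \<or> i = b") (auto simp: Transposition.transpose_def g_def)
  have "g (p i) = g i" for i using gq[of "Transposition.transpose a b i"] gt[of i] by simp
  then have le: "card (g ` A) \<le> card (perm_cycles A p)"
    using perm_cycles_invariant_card[OF assms(1,2)] by blast
  have "card (orbit ?q ` A) \<le> Suc (card (g ` A))"
    unfolding g_def by (rule card_image_relabel[OF assms(1)])
  then show ?thesis using le unfolding perm_cycles_def by linarith
qed

section \<open>Pairings as permutations and the genus inequality\<close>

lemma pairing_perm_eq:
  assumes "disjoint \<sigma>" "\<forall>B\<in>\<sigma>. card B = 2" "{a, b} \<in> \<sigma>" "a \<noteq> b"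
  shows "pairing_perm \<sigma> a = b"
proof -
  have "(THE k. k \<noteq> a \<and> {a, k} \<in> \<sigma>) = b"
  proof (rule the_equality)
    fix k assume k: "k \<noteq> a \<and> {a, k} \<in> \<sigma>"
    have "{a, k} \<inter> {a, b} \<noteq> {}" by simp
    then have "{a, k} = {a, b}" using disjointD[OF assms(1)] assms(3) k by metis
    then show "k = b" using k by (auto simp: doubleton_eq_iff)
  qed (use assms in auto)
  then show ?thesis using assms(3) by (auto simp: pairing_perm_def)
qed

lemma pairing_perm_not_in: "a \<notin> \<Union>\<sigma> \<Longrightarrow> pairing_perm \<sigma> a = a"
  by (simp add: pairing_perm_def)

text \<open>Partial pairings are allowed, with \<open>pairing_perm\<close> fixing all uncovered
  points, so that a pairing can be built up one transposition at a time.\<close>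

lemma pairing_perm_insert:
  assumes "disjoint (insert {a, b} \<sigma>)" "{a, b} \<notin> \<sigma>" "\<forall>B\<in>\<sigma>. card B = 2" "a \<noteq> b"
  shows "pairing_perm (insert {a, b} \<sigma>) = pairing_perm \<sigma> \<circ> Transposition.transpose a b"
proof
  fix i
  have d: "disjoint \<sigma>" using assms(1) by (simp add: pairwise_insert)
  have ab: "a \<notin> \<Union>\<sigma>" "b \<notin> \<Union>\<sigma>" using assms(1,2) by (auto simp: pairwise_insert disjnt_def)
  have c: "\<forall>B\<in>insert {a, b} \<sigma>. card B = 2" using assms(3,4) by auto
  show "pairing_perm (insert {a, b} \<sigma>) i = (pairing_perm \<sigma> \<circ> Transposition.transpose a b) i"
  proof (cases "i \<in> \<Union>\<sigma>")
    case True
    then obtain B where B: "B \<in> \<sigma>" "i \<in> B" by blast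
    then have "card B = 2" using assms(3) by blast
    then obtain k where k: "B = {i, k}" "i \<noteq> k" using B(2) by (auto simp: card_2_iff)
    have "i \<noteq> a" "i \<noteq> b" using ab True by auto
    moreover have "pairing_perm (insert {a, b} \<sigma>) i = k"
      using pairing_perm_eq[OF assms(1) c, of i k] B k by auto
    moreover have "pairing_perm \<sigma> i = k"
      using pairing_perm_eq[OF d assms(3), of i k] B k by auto
    ultimately show ?thesis by simp
  next
    case False
    consider "i = a" | "i = b" | "i \<noteq> a" "i \<noteq> b" by blast
    then show ?thesis
    proof cases
      case 1
      then show ?thesis
        using pairing_perm_eq[OF assms(1) c, of a b] assms(4) ab by (simp add: pairing_perm_not_in)
    next
      case 2
      then show ?thesis
        using pairing_perm_eq[OF assms(1) c, of b a] assms(4) ab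
        by (simp add: pairing_perm_not_in insert_commute)
    next
      case 3
      then show ?thesis using False by (simp add: pairing_perm_not_in)
    qed
  qed
qed

text \<open>Multiplying by a transposition within one class of \<open>f\<close> creates at most one cycle; otherwise it
  joins two cycles, and two classes of \<open>f\<close> are merged.\<close>

lemma genus_labels:
  fixes A :: "nat set"
  assumes "finite A" "\<gamma> permutes A" "finite \<sigma>" "disjoint \<sigma>" "\<forall>B\<in>\<sigma>. card B = 2" "\<Union>\<sigma> \<subseteq> A"
  shows "pairing_perm \<sigma> permutes A \<and> (\<exists>f :: nat \<Rightarrow> nat. (\<forall>i. f (\<gamma> i) = f i) \<and> (\<forall>B\<in>\<sigma>. \<forall>i\<in>B. \<forall>j\<in>B. f i = f j) \<and>
    card (perm_cycles A (\<gamma> \<circ> pairing_perm \<sigma>)) + card (perm_cycles A \<gamma>) \<le> card \<sigma> + 2 * card (f ` A))"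
  using assms(3-)
proof induction
  case empty
  have e: "pairing_perm {} = id" by (auto simp: pairing_perm_def)
  \<comment> \<open>The initial labels are the cycles of \<gamma>, coded as numbers by
    \<open>h\<close>; the inequality then starts as an equality.\<close>
  obtain h :: "nat set \<Rightarrow> nat" where h: "inj_on h (perm_cycles A \<gamma>)"
    using finite_imp_inj_to_nat_seg[of "perm_cycles A \<gamma>"] assms(1) unfolding perm_cycles_def by blast
  have im: "(\<lambda>i. h (orbit \<gamma> i)) ` A = h ` perm_cycles A \<gamma>" by (auto simp: perm_cycles_def)
  show ?case
    unfolding e
  proof (intro conjI exI[of _ "\<lambda>i. h (orbit \<gamma> i)"] allI permutes_id)
    show "h (orbit \<gamma> (\<gamma> i)) = h (orbit \<gamma> i)" for i by (simp add: orbit_apply_eq[OF assms(1,2)])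
  qed (simp_all add: im card_image[OF h])
next
  case (insert B \<sigma>)
  then obtain a b where B: "B = {a, b}" "a \<noteq> b" by (metis card_2_iff insertI1)
  have ab: "a \<in> A" "b \<in> A" using insert.prems B by auto
  have "disjoint \<sigma>" "\<forall>B\<in>\<sigma>. card B = 2" "\<Union>\<sigma> \<subseteq> A" using insert.prems by (auto simp: pairwise_insert)
  from insert.IH[OF this] obtain f :: "nat \<Rightarrow> nat" where s: "pairing_perm \<sigma> permutes A"
    and f: "\<And>i. f (\<gamma> i) = f i" "\<And>B i j. B\<in>\<sigma> \<Longrightarrow> i\<in>B \<Longrightarrow> j\<in>B \<Longrightarrow> f i = f j"
    and le: "card (perm_cycles A (\<gamma> \<circ> pairing_perm \<sigma>)) + card (perm_cycles A \<gamma>) \<le> card \<sigma> + 2 * card (f ` A)"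
    by metis
  let ?p = "\<gamma> \<circ> pairing_perm \<sigma>"
  have p: "?p permutes A" using s assms(2) by (simp add: permutes_compose)
  have ins: "pairing_perm (insert B \<sigma>) = pairing_perm \<sigma> \<circ> Transposition.transpose a b"
    unfolding B(1) using insert B by (intro pairing_perm_insert) auto
  then have ins': "\<gamma> \<circ> pairing_perm (insert B \<sigma>) = ?p \<circ> Transposition.transpose a b" by (simp add: o_assoc)
  have fs: "f (pairing_perm \<sigma> i) = f i" for i
  proof (cases "i \<in> \<Union>\<sigma>")
    case True
    then obtain B' where B': "B' \<in> \<sigma>" "i \<in> B'" by blast
    then have "card B' = 2" using insert.prems by auto
    then obtain k where k: "B' = {i, k}" "i \<noteq> k" using B'(2) by (auto simp: card_2_iff)
    then have "pairing_perm \<sigma> i = k"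
      using pairing_perm_eq[of \<sigma> i k] B' insert.prems by (auto simp: pairwise_insert)
    then show ?thesis using f(2) B' k by blast
  qed (simp add: pairing_perm_not_in)
  have perm: "pairing_perm (insert B \<sigma>) permutes A"
    unfolding ins using s ab by (intro permutes_compose permutes_swap_id)
  show ?case
  proof (intro conjI perm)
    show "\<exists>f :: nat \<Rightarrow> nat. (\<forall>i. f (\<gamma> i) = f i) \<and> (\<forall>B\<in>insert B \<sigma>. \<forall>i\<in>B. \<forall>j\<in>B. f i = f j) \<and>
      card (perm_cycles A (\<gamma> \<circ> pairing_perm (insert B \<sigma>))) + card (perm_cycles A \<gamma>)
        \<le> card (insert B \<sigma>) + 2 * card (f ` A)"
    proof (cases "f a = f b")
      case True
      have "card (perm_cycles A (?p \<circ> Transposition.transpose a b)) \<le> Suc (card (perm_cycles A ?p))"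
        by (rule card_cycles_transpose_le[OF assms(1) p ab])
      then have "card (perm_cycles A (\<gamma> \<circ> pairing_perm (insert B \<sigma>))) + card (perm_cycles A \<gamma>)
          \<le> card (insert B \<sigma>) + 2 * card (f ` A)"
        using le insert.hyps unfolding ins' by simp
      moreover have "f i = f j" if "B' \<in> insert B \<sigma>" "i \<in> B'" "j \<in> B'" for B' i j
        using that f(2)[of B' i j] B(1) True by auto
      ultimately show ?thesis using f(1) by blast
    next
      case False
      define g where "g x = (if f x = f b then f a else f x)" for x
      have c: "card (f ` A) \<le> Suc (card (g ` A))"
        unfolding g_def by (rule card_image_relabel[OF assms(1)])
      have "orbit ?p a \<noteq> orbit ?p b"
      proof
        assume eq: "orbit ?p a = orbit ?p b"
        have "b \<in> orbit ?p b"
          by (rule self_in_orbit[OF assms(1) p])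
        then have "f b = f a" using orbit_invariant[of f ?p b a] f(1) fs eq by simp
        with False show False by simp
      qed
      then have "card (perm_cycles A (?p \<circ> Transposition.transpose a b)) < card (perm_cycles A ?p)"
        by (rule card_cycles_transpose_merge[OF assms(1) p ab])
      then have "card (perm_cycles A (\<gamma> \<circ> pairing_perm (insert B \<sigma>))) + card (perm_cycles A \<gamma>)
          \<le> card (insert B \<sigma>) + 2 * card (g ` A)"
        using le c insert.hyps unfolding ins' by simp
      moreover have "g (\<gamma> i) = g i" for i by (simp add: g_def f(1))
      moreover have "g i = g j" if "B' \<in> insert B \<sigma>" "i \<in> B'" "j \<in> B'" for B' i j
        using that f(2)[of B' i j] B(1) by (auto simp: g_def)
      ultimately show ?thesis by blast
    qed
  qed
qed

lemma card_2_elem: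
  assumes "card B = 2" "i \<in> B"
  obtains k where "B = {i, k}" "i \<noteq> k"
proof -
  obtain x y where "B = {x, y}" "x \<noteq> y" using assms(1) by (auto simp: card_2_iff)
  then show ?thesis using that[of x] that[of y] assms(2) by (auto simp: insert_commute)
qed

context
  fixes A :: "nat set" and \<sigma> :: "nat set set"
  assumes fin: "finite A" and part: "partition_on A \<sigma>" and two: "\<forall>B\<in>\<sigma>. card B = 2"
begin

lemma pairing_perm_block:
  assumes "i \<in> A"
  shows "{i, pairing_perm \<sigma> i} \<in> \<sigma>" "pairing_perm \<sigma> i \<noteq> i"
    "pairing_perm \<sigma> i \<in> A" "pairing_perm \<sigma> (pairing_perm \<sigma> i) = i"
    "block_of \<sigma> i = {i, pairing_perm \<sigma> i}"
proof -
  have d: "disjoint \<sigma>" using part by (rule partition_onD2)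
  have B: "block_of \<sigma> i \<in> \<sigma>" "i \<in> block_of \<sigma> i" using block_of[OF part assms] by auto
  then have "card (block_of \<sigma> i) = 2" using two by blast
  then obtain k where k: "block_of \<sigma> i = {i, k}" "i \<noteq> k" using B(2) by (rule card_2_elem)
  have ik: "{i, k} \<in> \<sigma>" and ki: "{k, i} \<in> \<sigma>" using B(1) k by (simp_all add: insert_commute)
  have p: "pairing_perm \<sigma> i = k" by (rule pairing_perm_eq[OF d two ik k(2)])
  have q: "pairing_perm \<sigma> k = i" by (rule pairing_perm_eq[OF d two ki]) (use k in simp)
  show "{i, pairing_perm \<sigma> i} \<in> \<sigma>" "pairing_perm \<sigma> i \<noteq> i"
    "pairing_perm \<sigma> (pairing_perm \<sigma> i) = i" "block_of \<sigma> i = {i, pairing_perm \<sigma> i}"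
    using p q k ik by auto
  show "pairing_perm \<sigma> i \<in> A" using partition_on_subset[OF part ik] p by simp
qed

lemma pairing_perm_involution: "pairing_perm \<sigma> (pairing_perm \<sigma> i) = i"
proof (cases "i \<in> A")
  case False
  then have "i \<notin> \<Union>\<sigma>" using part by (auto simp: partition_on_def)
  then show ?thesis by (simp add: pairing_perm_not_in)
qed (rule pairing_perm_block)

lemma pairing_perm_permutes: "pairing_perm \<sigma> permutes A"
proof (rule bij_imp_permutes)
  show "bij_betw (pairing_perm \<sigma>) A A"
    by (rule bij_betw_byWitness[of _ "pairing_perm \<sigma>"]) (auto simp: pairing_perm_block(3,4))
  show "pairing_perm \<sigma> x = x" if "x \<notin> A" for x
    using that part by (intro pairing_perm_not_in) (auto simp: partition_on_def)
qed

lemma orbit_pairing_perm: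
  assumes "i \<in> A"
  shows "orbit (pairing_perm \<sigma>) i = block_of \<sigma> i"
proof -
  let ?s = "pairing_perm \<sigma>"
  have "j = i \<or> j = ?s i" if "j \<in> orbit ?s i" for j
    using that by induction (auto simp: pairing_perm_involution)
  moreover have "?s i \<in> orbit ?s i" by (rule orbit.base)
  moreover have "i \<in> orbit ?s i" by (rule self_in_orbit[OF fin pairing_perm_permutes])
  ultimately show ?thesis unfolding pairing_perm_block(5)[OF assms] by auto
qed

lemma perm_cycles_pairing_perm: "perm_cycles A (pairing_perm \<sigma>) = \<sigma>"
proof -
  have "perm_cycles A (pairing_perm \<sigma>) = block_of \<sigma> ` A"
    unfolding perm_cycles_def by (rule image_cong) (simp_all add: orbit_pairing_perm)
  then show ?thesis using partition_eq_image_block_of[OF part] by simp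
qed

lemma card_pairing: "card A = 2 * card \<sigma>"
proof -
  have "card A = (\<Sum>B\<in>\<sigma>. card B)"
    using two fin part by (intro product_partition) (auto intro: card_ge_0_finite)
  then show ?thesis using two by simp
qed

lemma genus_inequality:
  assumes "\<gamma> permutes A"
  shows "card (perm_cycles A (\<gamma> \<circ> pairing_perm \<sigma>)) + card (perm_cycles A \<gamma>)
    \<le> card \<sigma> + 2 * card (partition_join A \<sigma> (perm_cycles A \<gamma>))"
proof -
  have "finite \<sigma>" using finite_elements[OF fin part] .
  moreover have "\<Union>\<sigma> \<subseteq> A" using part by (auto simp: partition_on_def)
  ultimately obtain f :: "nat \<Rightarrow> nat" where f: "\<And>i. f (\<gamma> i) = f i" "\<And>B i j. B \<in> \<sigma> \<Longrightarrow> i \<in> B \<Longrightarrow> j \<in> B \<Longrightarrow> f i = f j"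
    and le: "card (perm_cycles A (\<gamma> \<circ> pairing_perm \<sigma>)) + card (perm_cycles A \<gamma>) \<le> card \<sigma> + 2 * card (f ` A)"
    using genus_labels[OF fin assms _ partition_onD2[OF part] two] by metis
  have "card (f ` A) \<le> card (partition_join A \<sigma> (perm_cycles A \<gamma>))"
  proof (rule card_image_le_join[OF part orbit_partition[OF fin assms] fin])
    fix B i j assume "B \<in> \<sigma> \<union> perm_cycles A \<gamma>" "i \<in> B" "j \<in> B"
    then show "f i = f j"
      using f(2) orbit_invariant[of f \<gamma>, OF f(1)] unfolding perm_cycles_def by (metis UnE imageE)
  qed
  then show ?thesis using le by linarith
qed

text \<open>The non-crossing condition counts cycles of \<open>inv s \<circ> \<gamma>\<close>, the
  graph has the cycles of \<open>\<gamma> \<circ> s\<close> as vertices. As \<open>s\<close> is an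
  involution, the two products are conjugate by \<open>s\<close>, which carries cycles to
  cycles.\<close>

lemma card_cycles_inv_pairing_comp:
  assumes "\<gamma> permutes A"
  shows "card (perm_cycles A (inv (pairing_perm \<sigma>) \<circ> \<gamma>)) = card (perm_cycles A (\<gamma> \<circ> pairing_perm \<sigma>))"
proof -
  let ?s = "pairing_perm \<sigma>"
  have inv: "inv ?s = ?s" by (rule inv_unique_comp) (auto simp: pairing_perm_involution)
  have "?s ` orbit (\<gamma> \<circ> ?s) i = orbit (?s \<circ> \<gamma>) (?s i)" for i
    by (rule orbit_inverse)
      (auto simp: pairing_perm_involution intro: self_in_orbit[OF fin permutes_compose[OF pairing_perm_permutes assms]])
  moreover have "perm_cycles A (?s \<circ> \<gamma>) = (\<lambda>i. orbit (?s \<circ> \<gamma>) (?s i)) ` A"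
    unfolding perm_cycles_def
    using permutes_image[OF pairing_perm_permutes] by (metis image_image)
  ultimately have "perm_cycles A (?s \<circ> \<gamma>) = (`) ?s ` perm_cycles A (\<gamma> \<circ> ?s)"
    unfolding perm_cycles_def by (simp add: image_image)
  moreover have "inj ((`) ?s)"
    using permutes_inj[OF pairing_perm_permutes] by (simp add: inj_image_eq_iff inj_def)
  ultimately show ?thesis unfolding inv by (metis card_image inj_on_subset subset_UNIV)
qed

end

section \<open>The cycles of \<gamma>\<close>

lemma orbit_cycle_of_list:
  assumes "distinct cs" "x \<in> set cs"
  shows "orbit (cycle_of_list cs) x = set cs"
proof -
  let ?c = "cycle_of_list cs"
  have perm: "?c permutes set cs" by (rule cycle_permutes)
  have ne: "cs \<noteq> []" using assms(2) by auto
  have "y \<in> orbit ?c (hd cs)" if "y \<in> set cs" for y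
  proof -
    obtain n where n: "n < length cs" "y = cs ! n" using \<open>y \<in> set cs\<close> by (auto simp: in_set_conv_nth)
    have "hd (map (?c ^^ n) cs) = hd (rotate n cs)"
      using cyclic_rotation[OF assms(1)] by simp
    then have "(?c ^^ n) (hd cs) = y"
      using ne n by (simp add: hd_map hd_rotate_conv_nth)
    moreover have "hd cs \<in> orbit ?c (hd cs)" by (rule self_in_orbit[OF _ perm]) simp
    ultimately show ?thesis using funpow_in_orbit by metis
  qed
  then have "orbit ?c (hd cs) = set cs"
    using permutes_orbit_subset[OF perm, of "hd cs"] ne by auto
  then show ?thesis using orbit_eqD[OF _ perm, of x "hd cs"] assms(2) by simp
qed

text \<open>The first interval and the union of the others are disjoint and stable, so the cycles of
  the composite are those of the two factors. An empty interval would contribute no cycle, hence the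
  positivity of the lengths.\<close>

lemma interval_perm_from:
  assumes "\<forall>k\<in>set ms. k \<ge> 1"
  shows "interval_perm_from s ms permutes {s + 1..s + sum_list ms} \<and>
    card (perm_cycles {s + 1..s + sum_list ms} (interval_perm_from s ms)) = length ms"
  using assms
proof (induction ms arbitrary: s)
  case Nil
  show ?case by (simp add: perm_cycles_def permutes_empty flip: id_def)
next
  case (Cons k ms)
  let ?c = "cycle_of_list [s + 1..<s + k + 1]" and ?g = "interval_perm_from (s + k) ms"
  let ?C = "{s + 1..s + k}" and ?B = "{s + k + 1..s + k + sum_list ms}"
  let ?A = "{s + 1..s + sum_list (k # ms)}" and ?f = "interval_perm_from s (k # ms)"
  have k: "k \<ge> 1" using Cons.prems by simp
  have IH: "?g permutes ?B" "card (perm_cycles ?B ?g) = length ms"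
    using Cons.IH[of "s + k"] Cons.prems by auto
  have set: "set [s + 1..<s + k + 1] = ?C" by auto
  have c: "?c permutes ?C" using cycle_permutes[of "[s + 1..<s + k + 1]"] unfolding set .
  have A: "?A = ?C \<union> ?B" using k by auto
  have f: "?f = ?c \<circ> ?g" by simp
  have fA: "?f permutes ?A"
    unfolding A f using c IH(1) by (intro permutes_compose) (auto intro: permutes_subset)
  have "orbit ?f x = ?C" if "x \<in> ?C" for x
  proof -
    have "orbit ?c x = orbit ?f x"
    proof (rule orbit_cong0[OF that])
      show "?c \<in> ?C \<rightarrow> ?C" using permutes_in_image[OF c] by blast
      show "?c y = ?f y" if "y \<in> ?C" for y
      proof -
        have "y \<notin> ?B" using that by auto
        then show ?thesis using permutes_not_in[OF IH(1)] unfolding f by simp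
      qed
    qed
    then show ?thesis using orbit_cycle_of_list[of "[s + 1..<s + k + 1]" x] that set by (metis distinct_upt)
  qed
  then have 1: "orbit ?f ` ?C = {?C}" using k by force
  have "orbit ?g x = orbit ?f x" if "x \<in> ?B" for x
  proof (rule orbit_cong0[OF that])
    show "?g \<in> ?B \<rightarrow> ?B" using permutes_in_image[OF IH(1)] by blast
    show "?g y = ?f y" if "y \<in> ?B" for y
    proof -
      have "?g y \<in> ?B" using permutes_in_image[OF IH(1)] that by blast
      then have "?g y \<notin> ?C" by auto
      then show ?thesis using permutes_not_in[OF c] unfolding f by simp
    qed
  qed
  then have 2: "orbit ?f ` ?B = perm_cycles ?B ?g" unfolding perm_cycles_def by (metis image_cong)
  have "?C \<notin> perm_cycles ?B ?g"
  proof
    assume "?C \<in> perm_cycles ?B ?g"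
    then have "?C \<subseteq> ?B" using partition_on_subset[OF orbit_partition[OF _ IH(1)]] by blast
    then show False using k by auto
  qed
  moreover have "perm_cycles ?A ?f = insert ?C (perm_cycles ?B ?g)"
    unfolding perm_cycles_def A image_Un 1 using 2 unfolding perm_cycles_def by blast
  moreover have "finite (perm_cycles ?B ?g)" by (simp add: perm_cycles_def)
  ultimately have "card (perm_cycles ?A ?f) = Suc (length ms)" using IH(2) by simp
  then have "card (perm_cycles ?A ?f) = length (k # ms)" by (simp only: length_Cons)
  then show ?case using fA by blast
qed

lemma interval_perm_permutes:
  "\<forall>k\<in>set ms. k \<ge> 1 \<Longrightarrow> interval_perm ms permutes {1..sum_list ms}"
  using interval_perm_from[of ms 0] by (simp add: interval_perm_def)

lemma card_cycles_interval_perm: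
  "\<forall>k\<in>set ms. k \<ge> 1 \<Longrightarrow> card (perm_cycles {1..sum_list ms} (interval_perm ms)) = length ms"
  using interval_perm_from[of ms 0] by (simp add: interval_perm_def)

section \<open>Cumulants\<close>

text \<open>A proper subset \<open>B\<close> containing \<open>i\<close> together with a partition
  of \<open>B\<close> is the same as a partition of \<open>I\<close> with a marked block avoiding
  \<open>i\<close>, the marked block being \<open>I - B\<close>.\<close>

lemma sum_partitions_choose_block:
  fixes g :: "'i set set \<Rightarrow> 'i set \<Rightarrow> complex"
  assumes fin: "finite I" and i: "i \<in> I"
  shows "(\<Sum>B | i \<in> B \<and> B \<subset> I. \<Sum>\<rho> | partition_on B \<rho>. g (insert (I - B) \<rho>) (I - B))
    = (\<Sum>\<rho> | partition_on I \<rho>. \<Sum>C\<in>{C\<in>\<rho>. i \<notin> C}. g \<rho> C)"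
proof -
  have fin1: "finite {B. i \<in> B \<and> B \<subset> I}" by (rule finite_subset[of _ "Pow I"]) (use fin in auto)
  have fin2: "finite {\<rho>. partition_on B \<rho>}" if "B \<subset> I" for B
    using that fin by (intro finitely_many_partition_on) (auto intro: finite_subset)
  have fin3: "finite {C \<in> \<rho>. i \<notin> C}" if "partition_on I \<rho>" for \<rho>
    using finite_elements[OF fin that] by simp
  have "(\<Sum>B | i \<in> B \<and> B \<subset> I. \<Sum>\<rho> | partition_on B \<rho>. g (insert (I - B) \<rho>) (I - B))
    = (\<Sum>(B, \<rho>)\<in>Sigma {B. i \<in> B \<and> B \<subset> I} (\<lambda>B. {\<rho>. partition_on B \<rho>}). g (insert (I - B) \<rho>) (I - B))"
    using fin1 fin2 by (subst sum.Sigma) auto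
  also have "\<dots> = (\<Sum>(\<rho>, C)\<in>Sigma {\<rho>. partition_on I \<rho>} (\<lambda>\<rho>. {C\<in>\<rho>. i \<notin> C}). g \<rho> C)"
  proof (rule sum.reindex_bij_witness[where i = "\<lambda>(\<rho>, C). (I - C, \<rho> - {C})"
        and j = "\<lambda>(B, \<rho>). (insert (I - B) \<rho>, I - B)"], goal_cases)
    case (1 a)
    then obtain B \<rho> where a: "a = (B, \<rho>)" "i \<in> B" "B \<subset> I" "partition_on B \<rho>" by auto
    have "I - B \<notin> \<rho>" using a by (auto simp: partition_on_def)
    then show ?case using a by auto
  next
    case (2 a)
    then obtain B \<rho> where a: "a = (B, \<rho>)" "i \<in> B" "B \<subset> I" "partition_on B \<rho>" by auto
    have "disjnt (I - B) (\<Union>\<rho>)" using partition_onD1[OF a(4)] by (auto simp: disjnt_def)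
    moreover have "I - (I - B) = B" using a(3) by auto
    ultimately have "partition_on I (insert (I - B) \<rho>)"
      using a by (subst partition_on_insert) auto
    then show ?case using a by auto
  next
    case (3 b)
    then obtain \<rho> C where b: "b = (\<rho>, C)" "partition_on I \<rho>" "C \<in> \<rho>" "i \<notin> C" by auto
    have "C \<subseteq> I" using b by (auto simp: partition_on_def)
    then have "I - (I - C) = C" by auto
    then show ?case using b by (auto simp: insert_absorb)
  next
    case (4 b)
    then obtain \<rho> C where b: "b = (\<rho>, C)" "partition_on I \<rho>" "C \<in> \<rho>" "i \<notin> C" by auto
    have C: "C \<subseteq> I" "C \<noteq> {}" using b by (auto simp: partition_on_def)
    have "disjoint (insert C (\<rho> - {C}))" using b by (simp add: partition_on_def insert_absorb)
    then have "disjnt C (\<Union>(\<rho> - {C}))" by (auto simp: pairwise_insert disjnt_def)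
    moreover have "insert C (\<rho> - {C}) = \<rho>" using b(3) by blast
    ultimately have "partition_on (I - C) (\<rho> - {C})"
      using partition_on_insert[of C "\<rho> - {C}" I] b(2) by simp
    then show ?case using b C i by auto
  qed auto
  also have "\<dots> = (\<Sum>\<rho> | partition_on I \<rho>. \<Sum>C\<in>{C\<in>\<rho>. i \<notin> C}. g \<rho> C)"
    using fin3 finitely_many_partition_on[OF fin] by (subst sum.Sigma) auto
  finally show ?thesis .
qed

definition joint_moment :: "'a measure \<Rightarrow> 'i set \<Rightarrow> ('i \<Rightarrow> 'a \<Rightarrow> complex) \<Rightarrow> complex" where
  "joint_moment M I y = integral\<^sup>L M (\<lambda>\<omega>. \<Prod>i\<in>I. y i \<omega>)"

lemma cumulant_eq_joint_moment:
  "cumulant M I y = (\<Sum>\<rho> | partition_on I \<rho>.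
     (- 1) ^ (card \<rho> - 1) * fact (card \<rho> - 1) * (\<Prod>C\<in>\<rho>. joint_moment M C y))"
  by (simp add: cumulant_def joint_moment_def)

lemma (in prob_space) joint_moment_empty [simp]: "joint_moment M {} y = 1"
  by (simp add: joint_moment_def prob_space)

text \<open>A partition \<open>\<rho>\<close> of \<open>I\<close> arises from a proper subset \<open>B\<close> in \<open>#(\<rho>) - 1\<close> ways, one for each of its
  blocks \<open>I - B\<close> not containing \<open>i\<close>; so everything but the term of \<open>{I}\<close> cancels.\<close>

lemma (in prob_space) joint_moment_recursion:
  assumes fin: "finite I" and i: "i \<in> I"
  shows "joint_moment M I y = (\<Sum>B | i \<in> B \<and> B \<subseteq> I. cumulant M B y * joint_moment M (I - B) y)"
proof -
  let ?m = "\<lambda>\<rho>. \<Prod>C\<in>\<rho>. joint_moment M C y"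
  let ?c = "\<lambda>k. (- 1) ^ (k - 1) * fact (k - 1) :: complex"
  have split: "{B. i \<in> B \<and> B \<subseteq> I} = insert I {B. i \<in> B \<and> B \<subset> I}" using i by auto
  have fin1: "finite {B. i \<in> B \<and> B \<subset> I}" by (rule finite_subset[of _ "Pow I"]) (use fin in auto)
  \<comment> \<open>Adding the block \<open>I - B\<close> raises the number of blocks by one; hence
    the coefficient of the enlarged partition is taken at one block less.\<close>
  have summand: "cumulant M B y * joint_moment M (I - B) y
      = (\<Sum>\<rho> | partition_on B \<rho>. ?c (card (insert (I - B) \<rho>) - 1) * ?m (insert (I - B) \<rho>))"
    if "B \<subset> I" for B
    unfolding cumulant_eq_joint_moment sum_distrib_right
  proof (rule sum.cong[OF refl])
    fix \<rho> assume "\<rho> \<in> {\<rho>. partition_on B \<rho>}"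
    then have \<rho>: "partition_on B \<rho>" by simp
    then have "finite \<rho>" using finite_elements finite_subset[OF _ fin] that by blast
    moreover have "I - B \<notin> \<rho>" using \<rho> that by (auto simp: partition_on_def)
    ultimately show "?c (card \<rho>) * ?m \<rho> * joint_moment M (I - B) y
      = ?c (card (insert (I - B) \<rho>) - 1) * ?m (insert (I - B) \<rho>)"
      by (simp add: mult_ac)
  qed
  have "(\<Sum>B | i \<in> B \<and> B \<subset> I. cumulant M B y * joint_moment M (I - B) y)
    = (\<Sum>\<rho> | partition_on I \<rho>. \<Sum>C\<in>{C\<in>\<rho>. i \<notin> C}. ?c (card \<rho> - 1) * ?m \<rho>)"
    using sum_partitions_choose_block[OF fin i, of "\<lambda>\<rho> _. ?c (card \<rho> - 1) * ?m \<rho>"]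
    by (simp add: summand)
  also have "\<dots> = (\<Sum>\<rho> | partition_on I \<rho>. of_nat (card \<rho> - 1) * ?c (card \<rho> - 1) * ?m \<rho>)"
  proof (rule sum.cong[OF refl])
    fix \<rho> assume "\<rho> \<in> {\<rho>. partition_on I \<rho>}"
    then have \<rho>: "partition_on I \<rho>" by simp
    then obtain B where B: "B \<in> \<rho>" "i \<in> B" using i by (auto simp: partition_on_def)
    have "{C\<in>\<rho>. i \<notin> C} = \<rho> - {B}" using B \<rho> by (auto simp: partition_on_def disjoint_def)
    then have "card {C\<in>\<rho>. i \<notin> C} = card \<rho> - 1" using B(1) by simp
    then show "(\<Sum>C\<in>{C\<in>\<rho>. i \<notin> C}. ?c (card \<rho> - 1) * ?m \<rho>)
        = of_nat (card \<rho> - 1) * ?c (card \<rho> - 1) * ?m \<rho>"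
      by simp
  qed
  finally have "(\<Sum>B | i \<in> B \<and> B \<subseteq> I. cumulant M B y * joint_moment M (I - B) y)
    = cumulant M I y + (\<Sum>\<rho> | partition_on I \<rho>. of_nat (card \<rho> - 1) * ?c (card \<rho> - 1) * ?m \<rho>)"
    unfolding split using fin1 by simp
  also have "\<dots> = (\<Sum>\<rho> | partition_on I \<rho>. (?c (card \<rho>) + of_nat (card \<rho> - 1) * ?c (card \<rho> - 1)) * ?m \<rho>)"
    unfolding cumulant_eq_joint_moment by (simp add: sum.distrib distrib_right)
  also have "\<dots> = (\<Sum>\<rho> | partition_on I \<rho>. if \<rho> = {I} then joint_moment M I y else 0)"
  proof (rule sum.cong[OF refl])
    fix \<rho> assume "\<rho> \<in> {\<rho>. partition_on I \<rho>}"
    then have \<rho>: "partition_on I \<rho>" by simp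
    have "finite \<rho>" using finite_elements[OF fin \<rho>] .
    moreover have "\<rho> \<noteq> {}" using \<rho> i by (auto simp: partition_on_def)
    ultimately obtain k where k: "card \<rho> = Suc k" by (metis card_gt_0_iff gr0_implies_Suc)
    show "(?c (card \<rho>) + of_nat (card \<rho> - 1) * ?c (card \<rho> - 1)) * ?m \<rho>
        = (if \<rho> = {I} then joint_moment M I y else 0)"
    proof (cases k)
      case 0
      then obtain C where "\<rho> = {C}" using k by (auto simp: card_1_singleton_iff)
      then have "\<rho> = {I}" using \<rho> by (auto simp: partition_on_def)
      then show ?thesis by simp
    next
      case (Suc l)
      then have "\<rho> \<noteq> {I}" using k by auto
      \<comment> \<open>For k + 1 blocks with k \<ge> 1 this is (-1)^k k! + k (-1)^(k - 1) (k - 1)!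
        = 0.\<close>
      moreover have "?c (card \<rho>) + of_nat (card \<rho> - 1) * ?c (card \<rho> - 1) = 0"
        using k Suc by (simp add: algebra_simps)
      ultimately show ?thesis by simp
    qed
  qed
  also have "\<dots> = joint_moment M I y"
    using i finitely_many_partition_on[OF fin] partition_on_space[of I]
    by (auto simp: sum.delta')
  finally show ?thesis by simp
qed

text \<open>Only the term \<open>B = J\<close> of the moment recursion involves the full set, so the
  recursion determines the cumulants by induction. Vanishing is proved below by guessing \<kappa>;
  the distinguished element may depend on \<open>J\<close>.\<close>

lemma (in prob_space) cumulant_eqI:
  assumes fin: "finite I" and ne: "I \<noteq> {}"
    and rec: "\<And>J. J \<subseteq> I \<Longrightarrow> J \<noteq> {} \<Longrightarrow>
      \<exists>i\<in>J. joint_moment M J y = (\<Sum>B | i \<in> B \<and> B \<subseteq> J. \<kappa> B * joint_moment M (J - B) y)"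
  shows "cumulant M I y = \<kappa> I"
proof -
  have "J \<noteq> {} \<longrightarrow> J \<subseteq> I \<longrightarrow> cumulant M J y = \<kappa> J" if "finite J" for J
    using that
  proof (induction J rule: finite_psubset_induct)
    case (psubset J)
    show ?case
    proof (intro impI)
      assume J: "J \<noteq> {}" "J \<subseteq> I"
      then obtain i where i: "i \<in> J"
        "joint_moment M J y = (\<Sum>B | i \<in> B \<and> B \<subseteq> J. \<kappa> B * joint_moment M (J - B) y)"
        using rec by blast
      have fin1: "finite {B. i \<in> B \<and> B \<subset> J}" by (rule finite_subset[of _ "Pow J"]) (use psubset.hyps in auto)
      have split: "{B. i \<in> B \<and> B \<subseteq> J} = insert J {B. i \<in> B \<and> B \<subset> J}" using i by auto
      have "(\<Sum>B | i \<in> B \<and> B \<subset> J. \<kappa> B * joint_moment M (J - B) y)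
          = (\<Sum>B | i \<in> B \<and> B \<subset> J. cumulant M B y * joint_moment M (J - B) y)"
      proof (rule sum.cong[OF refl])
        fix B assume "B \<in> {B. i \<in> B \<and> B \<subset> J}"
        then have "B \<subset> J" "B \<noteq> {}" "B \<subseteq> I" using J(2) by auto
        then have "cumulant M B y = \<kappa> B" using psubset.IH by blast
        then show "\<kappa> B * joint_moment M (J - B) y = cumulant M B y * joint_moment M (J - B) y" by simp
      qed
      moreover have "\<kappa> J + (\<Sum>B | i \<in> B \<and> B \<subset> J. \<kappa> B * joint_moment M (J - B) y)
          = cumulant M J y + (\<Sum>B | i \<in> B \<and> B \<subset> J. cumulant M B y * joint_moment M (J - B) y)"
        using i joint_moment_recursion[OF psubset.hyps i(1), of y] fin1 unfolding split by simp
      ultimately show "cumulant M J y = \<kappa> J" by simp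
    qed
  qed
  then show ?thesis using fin ne by blast
qed

text \<open>The guess keeps the cumulants of sets on one side of \<open>D\<close> and puts 0 for
  mixed sets. The guessed recursion for \<open>J\<close> is then the true recursion for the part of
  \<open>J\<close> on the side of \<open>i\<close>, multiplied by the moment of the rest.\<close>

lemma (in prob_space) cumulant_factor_eq_0:
  assumes fin: "finite I" and D: "D \<subseteq> I" "D \<noteq> {}" "D \<noteq> I"
    and fac: "\<And>J. J \<subseteq> I \<Longrightarrow> joint_moment M J y = joint_moment M (J \<inter> D) y * joint_moment M (J - D) y"
  shows "cumulant M I y = 0"
proof -
  define \<kappa> where "\<kappa> B = (if B \<subseteq> D \<or> B \<inter> D = {} then cumulant M B y else 0)" for B
  have "cumulant M I y = \<kappa> I"
  proof (rule cumulant_eqI[OF fin])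
    fix J assume J: "J \<subseteq> I" "J \<noteq> {}"
    then obtain i where i: "i \<in> J" by blast
    \<comment> \<open>\<open>E\<close> is the side containing \<open>i\<close>; the factorization
      hypothesis is symmetric under exchanging \<open>D\<close> and its complement.\<close>
    define E where "E = (if i \<in> D then D else I - D)"
    have E: "i \<in> E" using i J by (auto simp: E_def)
    have facE: "joint_moment M K y = joint_moment M (K \<inter> E) y * joint_moment M (K - E) y" if "K \<subseteq> I" for K
    proof -
      have "K \<inter> (I - D) = K - D" "K - (I - D) = K \<inter> D" using that by auto
      then show ?thesis using fac[OF that] by (simp add: E_def mult.commute)
    qed
    have finJ: "finite J" using J fin finite_subset by blast
    have kE: "\<kappa> B = (if B \<subseteq> E then cumulant M B y else 0)" if "i \<in> B" "B \<subseteq> J" for B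
    proof -
      have "B \<subseteq> D \<or> B \<inter> D = {} \<longleftrightarrow> B \<subseteq> E" using that J i by (auto simp: E_def)
      then show ?thesis by (simp add: \<kappa>_def)
    qed
    have "(\<Sum>B | i \<in> B \<and> B \<subseteq> J. \<kappa> B * joint_moment M (J - B) y)
      = (\<Sum>B | i \<in> B \<and> B \<subseteq> J. if B \<subseteq> E then cumulant M B y * joint_moment M (J - B) y else 0)"
      by (rule sum.cong) (simp_all add: kE)
    also have "\<dots> = (\<Sum>B\<in>{B \<in> {B. i \<in> B \<and> B \<subseteq> J}. B \<subseteq> E}. cumulant M B y * joint_moment M (J - B) y)"
      by (rule sum.inter_filter[symmetric], rule finite_subset[of _ "Pow J"]) (use finJ in auto)
    also have "\<dots> = (\<Sum>B | i \<in> B \<and> B \<subseteq> J \<inter> E.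
        cumulant M B y * joint_moment M (J \<inter> E - B) y * joint_moment M (J - E) y)"
    proof (rule sum.cong)
      fix B assume "B \<in> {B. i \<in> B \<and> B \<subseteq> J \<inter> E}"
      then have B: "B \<subseteq> J \<inter> E" by simp
      have "(J - B) \<inter> E = J \<inter> E - B" "(J - B) - E = J - E" using B by auto
      then show "cumulant M B y * joint_moment M (J - B) y
          = cumulant M B y * joint_moment M (J \<inter> E - B) y * joint_moment M (J - E) y"
        using facE[of "J - B"] J by auto
    qed auto
    also have "\<dots> = joint_moment M (J \<inter> E) y * joint_moment M (J - E) y"
      using joint_moment_recursion[of "J \<inter> E" i y] finJ i E by (simp add: sum_distrib_right)
    also have "\<dots> = joint_moment M J y" using facE[OF J(1)] by simp
    finally show "\<exists>i\<in>J. joint_moment M J y = (\<Sum>B | i \<in> B \<and> B \<subseteq> J. \<kappa> B * joint_moment M (J - B) y)"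
      using i by (intro bexI[of _ i]) auto
  qed (use D in auto)
  moreover have "\<not> (I \<subseteq> D \<or> I \<inter> D = {})" using D by auto
  ultimately show ?thesis by (simp add: \<kappa>_def)
qed

text \<open>The guess is \<open>v\<close> on pairs and 0 elsewhere. In the recursion
  \<open>i\<close> can be paired with each of the other \<open>card J - 1\<close> elements, which is
  the recursion assumed for \<mu>.\<close>

lemma (in prob_space) cumulant_gaussian_eq_0:
  fixes I :: "'b set"
  assumes fin: "finite I" and ne: "I \<noteq> {}"
    and mom: "\<And>J. J \<subseteq> I \<Longrightarrow> joint_moment M J y = \<mu> (card J)"
    and rec: "\<mu> 0 = 1" "\<mu> 1 = 0" "\<And>n. \<mu> (n + 2) = of_nat (n + 1) * v * \<mu> n"
    and "card I \<noteq> 2"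
  shows "cumulant M I y = 0"
proof -
  define \<kappa> :: "'b set \<Rightarrow> complex" where "\<kappa> B = (if card B = 2 then v else 0)" for B
  have "cumulant M I y = \<kappa> I"
  proof (rule cumulant_eqI[OF fin ne])
    fix J assume J: "J \<subseteq> I" "J \<noteq> {}"
    then obtain i where i: "i \<in> J" by blast
    have finJ: "finite J" using J fin finite_subset by blast
    have "(\<Sum>B | i \<in> B \<and> B \<subseteq> J. \<kappa> B * joint_moment M (J - B) y)
      = (\<Sum>B | i \<in> B \<and> B \<subseteq> J. if card B = 2 then v * joint_moment M (J - B) y else 0)"
      by (rule sum.cong) (simp_all add: \<kappa>_def)
    also have "\<dots> = (\<Sum>B\<in>{B \<in> {B. i \<in> B \<and> B \<subseteq> J}. card B = 2}. v * joint_moment M (J - B) y)"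
      by (rule sum.inter_filter[symmetric], rule finite_subset[of _ "Pow J"]) (use finJ in auto)
    also have "{B \<in> {B. i \<in> B \<and> B \<subseteq> J}. card B = 2} = (\<lambda>k. {i, k}) ` (J - {i})"
      using i by (auto simp: card_2_iff insert_commute image_iff)
    also have "(\<Sum>B\<in>(\<lambda>k. {i, k}) ` (J - {i}). v * joint_moment M (J - B) y)
      = (\<Sum>k\<in>J - {i}. v * joint_moment M (J - {i, k}) y)"
      by (subst sum.reindex) (auto simp: inj_on_def doubleton_eq_iff)
    also have "\<dots> = (\<Sum>k\<in>J - {i}. v * \<mu> (card J - 2))"
    proof (rule sum.cong[OF refl])
      fix k assume "k \<in> J - {i}"
      then have "card (J - {i, k}) = card J - 2" using i finJ by (subst card_Diff_subset) auto
      moreover have "J - {i, k} \<subseteq> I" using J by auto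
      ultimately show "v * joint_moment M (J - {i, k}) y = v * \<mu> (card J - 2)" using mom by simp
    qed
    also have "\<dots> = of_nat (card J - 1) * v * \<mu> (card J - 2)" using i finJ by simp
    also have "\<dots> = \<mu> (card J)"
    proof -
      have "card J \<noteq> 0" using i finJ by auto
      then consider "card J = 1" | n where "card J = n + 2"
        by (metis One_nat_def Suc_1 add.commute add_Suc_right not0_implies_Suc plus_1_eq_Suc)
      then show ?thesis by cases (use rec in auto)
    qed
    finally show "\<exists>i\<in>J. joint_moment M J y = (\<Sum>B | i \<in> B \<and> B \<subseteq> J. \<kappa> B * joint_moment M (J - B) y)"
      using i mom[OF J(1)] by (intro bexI[of _ i]) auto
  qed
  then show ?thesis using assms(7) by (simp add: \<kappa>_def)
qed

lemma cumulant_cong: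
  assumes "\<And>i \<omega>. i \<in> I \<Longrightarrow> \<omega> \<in> space M \<Longrightarrow> y i \<omega> = z i \<omega>"
  shows "cumulant M I y = cumulant M I z"
  unfolding cumulant_def
proof (intro sum.cong refl arg_cong2[of _ _ _ _ "(*)"] prod.cong Bochner_Integration.integral_cong)
  fix \<rho> C \<omega> i assume "\<rho> \<in> {\<rho>. partition_on I \<rho>}" "C \<in> \<rho>" "\<omega> \<in> space M" "i \<in> C"
  then show "y i \<omega> = z i \<omega>" by (intro assms) (auto simp: partition_on_def)
qed

text \<open>Needed because \<open>R_diagonal\<close> speaks of words indexed by
  \<open>{1..n}\<close>, whereas a block of \<tau> is an arbitrary finite set.\<close>

lemma cumulant_reindex:
  assumes "bij_betw h J I"
  shows "cumulant M I y = cumulant M J (\<lambda>j. y (h j))"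
proof -
  have inj: "inj_on h J" and I: "I = h ` J" using assms by (auto simp: bij_betw_def)
  have part_sub: "C \<subseteq> J" if "partition_on J \<rho>" "C \<in> \<rho>" for \<rho> C using that by (auto simp: partition_on_def)
  let ?g = "inv_into J h"
  have injg: "inj_on ?g I" unfolding I by (rule inj_on_inv_into) simp
  have gI: "?g ` I = J" unfolding I using inj by (simp add: inv_into_image_cancel)
  have hg: "h ` ?g ` C = C" if "C \<subseteq> I" for C
    using that unfolding I by (simp add: image_inv_into_cancel)
  have gh: "?g ` h ` C = C" if "C \<subseteq> J" for C
    using that inj by (simp add: inv_into_image_cancel)
  have 1: "partition_on I ((`) h ` \<rho>)" if "partition_on J \<rho>" for \<rho>
  proof -
    have "{} \<notin> (`) h ` \<rho>" using partition_onD3[OF that] by auto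
    then show ?thesis using partition_on_inj_image[OF that inj] unfolding I by simp
  qed
  have 2: "partition_on J ((`) ?g ` \<rho>)" if "partition_on I \<rho>" for \<rho>
  proof -
    have "{} \<notin> (`) ?g ` \<rho>" using partition_onD3[OF that] by auto
    then show ?thesis using partition_on_inj_image[OF that injg] unfolding gI by simp
  qed
  show ?thesis
    unfolding cumulant_def
  proof (rule sum.reindex_bij_witness[where i = "(`) ((`) h)" and j = "(`) ((`) ?g)"], goal_cases)
    case (1 \<rho>)
    then have "h ` ?g ` C = C" if "C \<in> \<rho>" for C
      using that by (intro hg) (auto simp: partition_on_def)
    then show ?case by (simp add: image_image)
  next
    case (2 \<rho>)
    then show ?case using \<open>\<And>\<rho>. partition_on I \<rho> \<Longrightarrow> partition_on J ((`) ?g ` \<rho>)\<close> by simp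
  next
    case (3 \<rho>)
    then have "?g ` h ` C = C" if "C \<in> \<rho>" for C
      using that by (intro gh) (auto simp: partition_on_def)
    then show ?case by (simp add: image_image)
  next
    case (4 \<rho>)
    then show ?case using \<open>\<And>\<rho>. partition_on J \<rho> \<Longrightarrow> partition_on I ((`) h ` \<rho>)\<close> by simp
  next
    case (5 \<rho>)
    then have sub: "C \<subseteq> I" if "C \<in> \<rho>" for C using that by (auto simp: partition_on_def)
    have inj': "inj_on ((`) ?g) \<rho>"
      by (rule inj_onI) (metis hg sub)
    have "(\<Prod>C\<in>(`) ?g ` \<rho>. \<integral>\<omega>. (\<Prod>i\<in>C. y (h i) \<omega>) \<partial>M) = (\<Prod>C\<in>\<rho>. \<integral>\<omega>. (\<Prod>i\<in>?g ` C. y (h i) \<omega>) \<partial>M)"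
      by (subst prod.reindex[OF inj']) simp
    also have "\<dots> = (\<Prod>C\<in>\<rho>. \<integral>\<omega>. (\<Prod>i\<in>C. y i \<omega>) \<partial>M)"
    proof (intro prod.cong refl Bochner_Integration.integral_cong)
      fix C \<omega> assume "C \<in> \<rho>"
      then have "inj_on ?g C" using injg sub inj_on_subset by blast
      then have "(\<Prod>i\<in>?g ` C. y (h i) \<omega>) = (\<Prod>i\<in>C. y (h (?g i)) \<omega>)" by (simp add: prod.reindex)
      also have "\<dots> = (\<Prod>i\<in>C. y i \<omega>)"
        using sub[OF \<open>C \<in> \<rho>\<close>] unfolding I by (intro prod.cong refl) (auto simp: f_inv_into_f)
      finally show "(\<Prod>i\<in>?g ` C. y (h i) \<omega>) = (\<Prod>i\<in>C. y i \<omega>)" .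
    qed
    finally show ?case by (simp add: card_image[OF inj'])
  qed
qed

section \<open>Cumulants of Wigner entries\<close>

text \<open>The recursion is read off from the explicit even moments and the vanishing of the odd
  ones. For \<open>v = 0\<close> there is no density; there all positive moments vanish and the
  factor \<open>v\<close> makes the right side 0.\<close>

lemma (in prob_space) centered_normal_moments:
  assumes "centered_normal M Y v"
  shows "integrable M (\<lambda>\<omega>. \<bar>Y \<omega>\<bar> ^ k)"
    and "expectation (\<lambda>\<omega>. Y \<omega> ^ 1) = 0"
    and "expectation (\<lambda>\<omega>. Y \<omega> ^ (n + 2)) = real (n + 1) * v * expectation (\<lambda>\<omega>. Y \<omega> ^ n)"
proof -
  have v: "0 \<le> v" and Y[measurable]: "Y \<in> borel_measurable M" using assms by (auto simp: centered_normal_def)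
  have "integrable M (\<lambda>\<omega>. \<bar>Y \<omega>\<bar> ^ k) \<and> expectation (\<lambda>\<omega>. Y \<omega> ^ 1) = 0 \<and>
    expectation (\<lambda>\<omega>. Y \<omega> ^ (n + 2)) = real (n + 1) * v * expectation (\<lambda>\<omega>. Y \<omega> ^ n)"
  proof (cases "v = 0")
    case True
    then have AE: "AE \<omega> in M. Y \<omega> = 0" using assms by (auto simp: centered_normal_def)
    have "integrable M (\<lambda>\<omega>. \<bar>Y \<omega>\<bar> ^ k) \<longleftrightarrow> integrable M (\<lambda>\<omega>. 0 ^ k :: real)"
      by (rule integrable_cong_AE) (use AE in auto)
    moreover have "expectation (\<lambda>\<omega>. Y \<omega> ^ Suc l) = 0" for l
    proof -
      have "expectation (\<lambda>\<omega>. Y \<omega> ^ Suc l) = expectation (\<lambda>\<omega>. 0)"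
        by (rule integral_cong_AE) (use AE in auto)
      then show ?thesis by simp
    qed
    from this[of 0] this[of "Suc n"] have "expectation (\<lambda>\<omega>. Y \<omega> ^ 1) = 0" "expectation (\<lambda>\<omega>. Y \<omega> ^ (n + 2)) = 0"
      by simp_all
    ultimately show ?thesis using True by simp
  next
    case False
    define s where "s = sqrt v"
    have s: "0 < s" "s\<^sup>2 = v" using v False by (auto simp: s_def)
    have D: "distributed M lborel Y (\<lambda>t. ennreal (normal_density 0 s t))"
      using assms False by (auto simp: centered_normal_def s_def)
    have int: "integrable M (\<lambda>\<omega>. \<bar>Y \<omega>\<bar> ^ k)"
      using distributed_integrable[OF D, of "\<lambda>t. \<bar>t\<bar> ^ k"] integrable_normal_moment_abs[OF s(1), of 0 k] by simp
    have mom: "expectation (\<lambda>\<omega>. Y \<omega> ^ l) = (\<integral>t. normal_density 0 s t * t ^ l \<partial>lborel)" for l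
      using distributed_integral[OF D, of "\<lambda>t. t ^ l"] by simp
    have even: "expectation (\<lambda>\<omega>. Y \<omega> ^ (2 * l)) = fact (2 * l) / ((2 / s\<^sup>2) ^ l * fact l)" for l
      using integral_normal_moment_even[OF s(1), of 0 l] by (simp add: mom)
    have odd: "expectation (\<lambda>\<omega>. Y \<omega> ^ (2 * l + 1)) = 0" for l
      unfolding mom using integral_normal_moment_odd[OF s(1), of 0 l] by simp
    have "expectation (\<lambda>\<omega>. Y \<omega> ^ (n + 2)) = real (n + 1) * v * expectation (\<lambda>\<omega>. Y \<omega> ^ n)"
    proof (cases "even n")
      case True
      then obtain l where l: "n = 2 * l" by blast
      have "expectation (\<lambda>\<omega>. Y \<omega> ^ (n + 2)) = fact (2 * Suc l) / ((2 / v) ^ Suc l * fact (Suc l))"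
        using even[of "Suc l"] l s(2) by simp
      also have "\<dots> = (2 * real l + 2) * (2 * real l + 1) * fact (2 * l) / ((2 / v) * (2 / v) ^ l * ((real l + 1) * fact l))"
        by (simp add: algebra_simps)
      also have "\<dots> = real (n + 1) * v * (fact (2 * l) / ((2 / v) ^ l * fact l))"
      proof -
        have "(2 * c + 2) * (2 * c + 1) * A / ((2 / v) * B * ((c + 1) * C)) = (2 * c + 1) * v * (A / (B * C))"
          if "B \<noteq> 0" "C \<noteq> 0" "c \<ge> 0" for A B C c :: real
          using that False by (simp add: divide_simps)
        from this[of "(2 / v) ^ l" "fact l" "real l"] False show ?thesis using l by simp
      qed
      finally show ?thesis using even[of l] l s(2) by simp
    next
      case False
      then obtain l where l: "n = 2 * l + 1" by (rule oddE)
      have "n + 2 = 2 * Suc l + 1" using l by simp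
      then show ?thesis using odd[of "Suc l"] odd[of l] l by simp
    qed
    then show ?thesis using int odd[of 0] by simp
  qed
  then show "integrable M (\<lambda>\<omega>. \<bar>Y \<omega>\<bar> ^ k)" "expectation (\<lambda>\<omega>. Y \<omega> ^ 1) = 0"
    "expectation (\<lambda>\<omega>. Y \<omega> ^ (n + 2)) = real (n + 1) * v * expectation (\<lambda>\<omega>. Y \<omega> ^ n)"
    by blast+
qed

context prob_space
begin

context
  fixes N :: nat and \<beta> :: "nat \<Rightarrow> real" and x :: "nat \<Rightarrow> nat \<Rightarrow> 'a \<Rightarrow> complex"
  assumes wig: "wigner_entries M N \<beta> x"
begin

lemma wigner_cnj: "i \<in> {1..N} \<Longrightarrow> j \<in> {1..N} \<Longrightarrow> \<omega> \<in> space M \<Longrightarrow> x i j \<omega> = cnj (x j i \<omega>)"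
  using wig unfolding wigner_entries_def by blast

lemma wigner_measurable: "i \<in> {1..N} \<Longrightarrow> j \<in> {1..N} \<Longrightarrow> x i j \<in> borel_measurable M"
  using wig unfolding wigner_entries_def by blast

lemma wigner_diag_real:
  assumes "i \<in> {1..N}" "\<omega> \<in> space M"
  shows "x i i \<omega> = complex_of_real (Re (x i i \<omega>))"
proof -
  have "x i i \<omega> = cnj (x i i \<omega>)" using wigner_cnj assms by blast
  then have "Im (x i i \<omega>) = 0" by (simp add: complex_eq_iff)
  then show ?thesis by (simp add: complex_eq_iff)
qed

lemma wigner_moment_integrable:
  assumes "i \<in> {1..N}" "j \<in> {1..N}" "i \<le> j"
  shows "integrable M (\<lambda>\<omega>. norm (x i j \<omega>) ^ k)"
proof (cases "i = j")
  case True
  have "centered_normal M (\<lambda>\<omega>. Re (x i i \<omega>)) (\<beta> 2)"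
    using wig assms unfolding wigner_entries_def by blast
  then have "integrable M (\<lambda>\<omega>. \<bar>Re (x i i \<omega>)\<bar> ^ k)" by (rule centered_normal_moments)
  moreover have "\<bar>Re (x i i \<omega>)\<bar> ^ k = norm (x i j \<omega>) ^ k" if "\<omega> \<in> space M" for \<omega>
    using wigner_diag_real[OF assms(1) that] True norm_of_real by metis
  ultimately show ?thesis
    by (rule Bochner_Integration.integrable_cong[THEN iffD1, OF refl, rotated]) simp
next
  case False
  then have "R_diagonal M (x i j)" using wig assms unfolding wigner_entries_def by auto
  then show ?thesis unfolding R_diagonal_def by blast
qed

context
  fixes D :: "'i set" and a b :: "'i \<Rightarrow> nat"
  assumes fin: "finite D" and ab: "\<And>j. j \<in> D \<Longrightarrow> a j \<in> {1..N} \<and> b j \<in> {1..N}"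
begin

text \<open>Each entry is one of the independent variables on or above the diagonal, namely that
  with index \<open>e j\<close>, or its conjugate; \<open>u j\<close> decides which.\<close>

private abbreviation "y j \<equiv> x (a j) (b j)"
private abbreviation "e j \<equiv> (min (a j) (b j), max (a j) (b j))"
private abbreviation "x2 p \<equiv> case p of (i, j) \<Rightarrow> x i j"
private abbreviation "u j z \<equiv> if a j \<le> b j then z else cnj z"

private lemma e_range: "j \<in> D \<Longrightarrow> e j \<in> {(i, j). 1 \<le> i \<and> i \<le> j \<and> j \<le> N}"
  using ab by (auto simp: min_def max_def)

private lemma y_eq: "j \<in> D \<Longrightarrow> \<omega> \<in> space M \<Longrightarrow> y j \<omega> = u j (x2 (e j) \<omega>)"
  using wigner_cnj[of "a j" "b j" \<omega>] ab[of j] by (auto simp: min_def max_def)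

text \<open>Factors with the same \<open>e j\<close> are collected into a measurable function
  \<open>h p\<close> of one independent variable, whose norm is a power of the norm of that variable
  and hence integrable. The product runs over all of \<open>e\<close> on \<open>D\<close>, so that
  it has the same index set for every \<open>J\<close>; empty groups contribute 1.\<close>

lemma wigner_joint_moment_factor:
  assumes J: "J \<subseteq> D"
  shows "joint_moment M J y = (\<Prod>p\<in>e ` D. joint_moment M {j \<in> J. e j = p} y)"
proof -
  have finJ: "finite J" using J fin finite_subset by blast
  define h where "h p z = (\<Prod>j | j \<in> J \<and> e j = p. u j z)" for p z
  have cnj: "cnj \<in> borel_measurable borel"
    by (intro borel_measurable_continuous_onI continuous_intros)
  have "u j \<in> borel_measurable borel" for j
    by (cases "a j \<le> b j") (use cnj in auto)
  then have meas: "h p \<in> borel_measurable borel" for p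
    unfolding h_def by (rule borel_measurable_prod)
  have grp: "(\<Prod>j | j \<in> J \<and> e j = p. y j \<omega>) = h p (x2 p \<omega>)" if "\<omega> \<in> space M" for p \<omega>
    unfolding h_def by (rule prod.cong[OF refl]) (use y_eq that J in auto)
  have "prob_space.indep_vars M (\<lambda>_. borel) (\<lambda>(i, j). x i j) {(i, j). 1 \<le> i \<and> i \<le> j \<and> j \<le> N}"
    using wig unfolding wigner_entries_def by blast
  then have "indep_vars (\<lambda>_. borel) (\<lambda>(i, j). x i j) (e ` D)"
    by (rule indep_vars_subset) (use e_range in blast)
  then have indep: "indep_vars (\<lambda>_. borel) (\<lambda>p \<omega>. h p (x2 p \<omega>)) (e ` D)"
    by (rule indep_vars_compose2) (rule meas)
  have int: "integrable M (\<lambda>\<omega>. h p (x2 p \<omega>))" if p: "p \<in> e ` D" for p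
  proof -
    have "p \<in> {(i, j). 1 \<le> i \<and> i \<le> j \<and> j \<le> N}" using p e_range by blast
    then obtain i j where ij: "p = (i, j)" "i \<in> {1..N}" "j \<in> {1..N}" "i \<le> j" by auto
    have nrm: "norm (h p z) = norm z ^ card {j \<in> J. e j = p}" for z
    proof -
      have "norm (h p z) = (\<Prod>j | j \<in> J \<and> e j = p. norm z)"
        unfolding h_def prod_norm[symmetric] by (rule prod.cong) auto
      then show ?thesis by simp
    qed
    show ?thesis
    proof (rule Bochner_Integration.integrable_bound)
      show "integrable M (\<lambda>\<omega>. norm (x i j \<omega>) ^ card {j \<in> J. e j = p})"
        using wigner_moment_integrable ij by blast
      show "(\<lambda>\<omega>. h p (x2 p \<omega>)) \<in> borel_measurable M"
        using measurable_compose[OF wigner_measurable[OF ij(2,3)] meas] ij(1) by simp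
    qed (use nrm ij(1) in auto)
  qed
  have "joint_moment M J y = integral\<^sup>L M (\<lambda>\<omega>. \<Prod>p\<in>e ` D. h p (x2 p \<omega>))"
    unfolding joint_moment_def
  proof (rule Bochner_Integration.integral_cong[OF refl])
    fix \<omega> assume \<omega>: "\<omega> \<in> space M"
    have "(\<Prod>j\<in>J. y j \<omega>) = (\<Prod>p\<in>e ` D. \<Prod>j | j \<in> J \<and> e j = p. y j \<omega>)"
      by (rule prod.group[symmetric]) (use finJ fin J in auto)
    also have "\<dots> = (\<Prod>p\<in>e ` D. h p (x2 p \<omega>))" using grp[OF \<omega>] by simp
    finally show "(\<Prod>j\<in>J. y j \<omega>) = (\<Prod>p\<in>e ` D. h p (x2 p \<omega>))" .
  qed
  also have "\<dots> = (\<Prod>p\<in>e ` D. integral\<^sup>L M (\<lambda>\<omega>. h p (x2 p \<omega>)))"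
    by (rule indep_vars_lebesgue_integral) (use fin indep int in auto)
  also have "\<dots> = (\<Prod>p\<in>e ` D. joint_moment M {j \<in> J. e j = p} y)"
    unfolding joint_moment_def
    by (intro prod.cong refl Bochner_Integration.integral_cong) (simp add: grp)
  finally show ?thesis .
qed

text \<open>Otherwise the positions using the same variable as \<open>i\<close> form a nonempty
  proper part of \<open>D\<close> along which every joint moment factors, and the mixed cumulant
  vanishes.\<close>

lemma wigner_cumulant_parallel:
  assumes nz: "cumulant M D y \<noteq> 0" and ij: "i \<in> D" "j \<in> D"
  shows "e i = e j"
proof (rule ccontr)
  assume ne: "e i \<noteq> e j"
  define D' where "D' = {k \<in> D. e k = e i}"
  have "cumulant M D y = 0"
  proof (rule cumulant_factor_eq_0[OF fin])
    have "i \<in> D'" using ij by (simp add: D'_def)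
    moreover have "j \<notin> D'" using ne by (metis (mono_tags, lifting) D'_def mem_Collect_eq)
    ultimately show "D' \<subseteq> D" "D' \<noteq> {}" "D' \<noteq> D" using ij by (auto simp: D'_def)
    fix J assume J: "J \<subseteq> D"
    let ?m = "\<lambda>J p. joint_moment M {k \<in> J. e k = p} y"
    have 1: "?m (J \<inter> D') p = (if p = e i then ?m J (e i) else 1)" for p
    proof (cases "p = e i")
      case True
      then have "{k \<in> J \<inter> D'. e k = p} = {k \<in> J. e k = e i}" using J by (auto simp: D'_def)
      then show ?thesis using True by simp
    next
      case False
      then have "{k \<in> J \<inter> D'. e k = p} = {}" by (auto simp: D'_def)
      then show ?thesis using False by (simp only: joint_moment_empty if_False simp_thms)
    qed
    have 2: "?m (J - D') p = (if p = e i then 1 else ?m J p)" for p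
    proof (cases "p = e i")
      case True
      then have "{k \<in> J - D'. e k = p} = {}" using J by (auto simp: D'_def)
      then show ?thesis using True by (simp only: joint_moment_empty if_True simp_thms)
    next
      case False
      then have "{k \<in> J - D'. e k = p} = {k \<in> J. e k = p}" by (auto simp: D'_def)
      then show ?thesis using False by simp
    qed
    have sub: "J \<inter> D' \<subseteq> D" "J - D' \<subseteq> D" using J by auto
    have "joint_moment M (J \<inter> D') y * joint_moment M (J - D') y
      = (\<Prod>p\<in>e ` D. ?m (J \<inter> D') p * ?m (J - D') p)"
      unfolding wigner_joint_moment_factor[OF sub(1)] wigner_joint_moment_factor[OF sub(2)]
      by (rule prod.distrib[symmetric])
    also have "\<dots> = (\<Prod>p\<in>e ` D. ?m J p)" unfolding 1 2 by (rule prod.cong) auto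
    finally show "joint_moment M J y = joint_moment M (J \<inter> D') y * joint_moment M (J - D') y"
      using wigner_joint_moment_factor[OF J] by simp
  qed
  with nz show False by simp
qed

text \<open>One diagonal index forces all of \<open>D\<close> to carry the same diagonal entry. It
  is real, so a joint moment depends only on the number of factors and satisfies the Gaussian
  recursion.\<close>

lemma wigner_cumulant_loop:
  assumes nz: "cumulant M D y \<noteq> 0" and i: "i \<in> D" "a i = b i"
  shows "card D = 2"
proof (rule ccontr)
  assume ne: "card D \<noteq> 2"
  define p where "p = a i"
  have p: "p \<in> {1..N}" using ab i by (simp add: p_def)
  have ap: "a j = p \<and> b j = p" if "j \<in> D" for j
    using wigner_cumulant_parallel[OF nz i(1) that] i(2)
    by (auto simp: p_def min_def max_def split: if_splits)
  have cn: "centered_normal M (\<lambda>\<omega>. Re (x p p \<omega>)) (\<beta> 2)"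
    using wig p unfolding wigner_entries_def by blast
  define \<mu> where "\<mu> n = complex_of_real (expectation (\<lambda>\<omega>. Re (x p p \<omega>) ^ n))" for n
  have "cumulant M D y = 0"
  proof (rule cumulant_gaussian_eq_0[where \<mu> = \<mu> and v = "complex_of_real (\<beta> 2)", OF fin _ _ _ _ _ ne])
    show "joint_moment M J y = \<mu> (card J)" if "J \<subseteq> D" for J
    proof -
      have "joint_moment M J y = integral\<^sup>L M (\<lambda>\<omega>. complex_of_real (Re (x p p \<omega>) ^ card J))"
        unfolding joint_moment_def
      proof (rule Bochner_Integration.integral_cong[OF refl])
        fix \<omega> assume \<omega>: "\<omega> \<in> space M"
        have "(\<Prod>j\<in>J. y j \<omega>) = (\<Prod>j\<in>J. x p p \<omega>)" using ap that by (intro prod.cong) auto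
        then show "(\<Prod>j\<in>J. y j \<omega>) = complex_of_real (Re (x p p \<omega>) ^ card J)"
          using wigner_diag_real[OF p \<omega>] by (metis of_real_power prod_constant)
      qed
      then show ?thesis by (simp only: \<mu>_def integral_complex_of_real)
    qed
    show "\<mu> 0 = 1" by (simp add: \<mu>_def prob_space)
    show "\<mu> 1 = 0" using centered_normal_moments(2)[OF cn] by (simp only: \<mu>_def of_real_0)
    show "\<mu> (n + 2) = of_nat (n + 1) * complex_of_real (\<beta> 2) * \<mu> n" for n
      using centered_normal_moments(3)[OF cn, of n] by (simp only: \<mu>_def of_real_mult of_real_of_nat_eq)
  qed (use i in auto)
  with nz show False by simp
qed

text \<open>For \<open>p < q\<close>, either no position uses the variable \<open>x p q\<close> and
  both counts are 0, or all do and the cumulant is that of a word in \<open>x p q\<close> and its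
  conjugate. The case \<open>p > q\<close> follows by exchanging the two sides.\<close>

lemma wigner_cumulant_balanced:
  assumes nz: "cumulant M D y \<noteq> 0" and ne: "D \<noteq> {}"
  shows "card {j \<in> D. a j = p \<and> b j = q} = card {j \<in> D. a j = q \<and> b j = p}"
proof (cases "p = q")
  case False
  have *: "card {j \<in> D. a j = p \<and> b j = q} = card {j \<in> D. a j = q \<and> b j = p}" if pq: "p < q" for p q
  proof (cases "\<exists>i\<in>D. e i = (p, q)")
    case True
    then obtain i where i: "i \<in> D" "e i = (p, q)" by blast
    have eD: "e j = (p, q)" if "j \<in> D" for j using wigner_cumulant_parallel[OF nz i(1) that] i(2) by simp
    have pN: "1 \<le> p" "q \<le> N" using e_range[OF i(1)] i(2) by auto
    have rd: "R_diagonal M (x p q)" using wig pN pq unfolding wigner_entries_def by auto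
    then have R: "\<forall>n\<ge>1. \<forall>\<epsilon>. card {i \<in> {1..n}. \<epsilon> i} \<noteq> card {i \<in> {1..n}. \<not> \<epsilon> i} \<longrightarrow>
        cumulant M {1..n} (conj_word (x p q) \<epsilon>) = 0"
      unfolding R_diagonal_def by (elim conjE)
    define \<epsilon> where "\<epsilon> j \<longleftrightarrow> a j \<le> b j" for j
    have \<epsilon>: "\<epsilon> j \<longleftrightarrow> a j = p \<and> b j = q" "\<not> \<epsilon> j \<longleftrightarrow> a j = q \<and> b j = p" if "j \<in> D" for j
      using eD[OF that] pq by (auto simp: \<epsilon>_def min_def max_def split: if_splits)
    obtain h where h: "bij_betw h {1..card D} D" using ex_bij_betw_nat_finite_1[OF fin] by blast
    have "cumulant M D y = cumulant M {1..card D} (\<lambda>k. y (h k))" by (rule cumulant_reindex[OF h])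
    also have "\<dots> = cumulant M {1..card D} (conj_word (x p q) (\<lambda>k. \<epsilon> (h k)))"
    proof (rule cumulant_cong)
      fix k \<omega> assume k: "k \<in> {1..card D}" and \<omega>: "\<omega> \<in> space M"
      have "h k \<in> D" using h k by (auto simp: bij_betw_def)
      then show "y (h k) \<omega> = conj_word (x p q) (\<lambda>k. \<epsilon> (h k)) k \<omega>"
        using y_eq[of "h k" \<omega>] \<omega> eD[of "h k"] by (simp add: conj_word_def \<epsilon>_def)
    qed
    finally have "cumulant M {1..card D} (conj_word (x p q) (\<lambda>k. \<epsilon> (h k))) \<noteq> 0" using nz by simp
    moreover have "card D \<ge> 1" using fin ne by (simp add: Suc_le_eq card_gt_0_iff)
    ultimately have c: "card {k \<in> {1..card D}. \<epsilon> (h k)} = card {k \<in> {1..card D}. \<not> \<epsilon> (h k)}"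
      using R[rule_format, of "card D" "\<lambda>k. \<epsilon> (h k)"] by metis
    have bij: "card {k \<in> {1..card D}. P (h k)} = card {j \<in> D. P j}" for P
    proof (rule bij_betw_same_card[of h])
      have "inj_on h {k \<in> {1..card D}. P (h k)}"
        by (rule inj_on_subset[OF bij_betw_imp_inj_on[OF h]]) blast
      moreover have "h ` {k \<in> {1..card D}. P (h k)} = {j \<in> h ` {1..card D}. P j}" by blast
      ultimately show "bij_betw h {k \<in> {1..card D}. P (h k)} {j \<in> D. P j}"
        unfolding bij_betw_imp_surj_on[OF h] by (rule bij_betw_imageI)
    qed
    have "card {j \<in> D. \<epsilon> j} = card {j \<in> D. \<not> \<epsilon> j}" using c bij[of \<epsilon>] bij[of "\<lambda>j. \<not> \<epsilon> j"] by simp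
    moreover have "{j \<in> D. \<epsilon> j} = {j \<in> D. a j = p \<and> b j = q}" using \<epsilon> by blast
    moreover have "{j \<in> D. \<not> \<epsilon> j} = {j \<in> D. a j = q \<and> b j = p}" using \<epsilon> by blast
    ultimately show ?thesis by simp
  next
    case False
    then have "{j \<in> D. a j = p \<and> b j = q} = {}" "{j \<in> D. a j = q \<and> b j = p} = {}"
      using pq by (auto simp: min_def max_def)
    then show ?thesis by metis
  qed
  show ?thesis using *[of p q] *[of q p] False by (metis nat_neq_iff)
qed simp

end
end
end

section \<open>Forests\<close>

lemma ugraph_cycle_mono: "ugraph_cycle H vs \<Longrightarrow> uedges H \<subseteq> uedges H' \<Longrightarrow> ugraph_cycle H' vs"
  unfolding ugraph_cycle_def by blast

text \<open>Take an end of a longest path. Its neighbours lie on the path, and a neighbour other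
  than the next vertex would close a cycle. The edge \<open>g\<close> bounds the degree by one; it
  need not exist in the graph.\<close>

lemma forest_low_degree_vertex:
  assumes fin: "finite V" and ne: "V \<noteq> {}"
    and edges: "\<And>f. f \<in> uedges H \<Longrightarrow> \<exists>u\<in>V. \<exists>v\<in>V. f = {u, v}"
    and acyclic: "\<nexists>vs. ugraph_cycle H vs"
  shows "\<exists>v\<in>V. \<exists>g. {f \<in> uedges H. v \<in> f} \<subseteq> {g}"
proof -
  let ?F = "uedges H"
  have noloop: "{v} \<notin> ?F" for v
  proof
    assume "{v} \<in> ?F"
    then have "ugraph_cycle H [v]" by (simp add: ugraph_cycle_def)
    with acyclic show False by blast
  qed
  define path where "path vs \<longleftrightarrow> vs \<noteq> [] \<and> distinct vs \<and> set vs \<subseteq> V \<and>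
    (\<forall>i. Suc i < length vs \<longrightarrow> {vs ! i, vs ! Suc i} \<in> ?F)" for vs
  obtain v where "v \<in> V" using ne by blast
  then have "path [v]" by (simp add: path_def)
  moreover have "length vs \<le> card V" if "path vs" for vs
    using that fin card_mono[of V "set vs"] by (auto simp: path_def distinct_card)
  then have "\<forall>vs. path vs \<longrightarrow> length vs < Suc (card V)" by (simp add: less_Suc_eq_le)
  ultimately obtain vs where vs: "path vs" and max: "\<And>ws. path ws \<Longrightarrow> length ws \<le> length vs"
    using ex_has_greatest_nat[of path "[v]" length "Suc (card V)"] by blast
  have "f = {vs ! 0, vs ! 1}" if f: "f \<in> ?F" "vs ! 0 \<in> f" for f
  proof -
    obtain w where w: "f = {vs ! 0, w}" "w \<in> V" using edges[OF f(1)] f(2) by blast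
    have "w \<noteq> vs ! 0" using w(1) f(1) noloop[of w] by auto
    have "w \<in> set vs"
    proof (rule ccontr)
      assume "w \<notin> set vs"
      moreover have "{(w # vs) ! i, (w # vs) ! Suc i} \<in> ?F" if "Suc i < length (w # vs)" for i
        using that vs w f(1) by (cases i) (auto simp: path_def insert_commute)
      ultimately have "path (w # vs)" using vs w(2) by (auto simp: path_def)
      from max[OF this] show False by simp
    qed
    then obtain i where i: "i < length vs" "vs ! i = w" by (auto simp: in_set_conv_nth)
    have "i \<noteq> 0" using i \<open>w \<noteq> vs ! 0\<close> by metis
    \<comment> \<open>A neighbour at position \<open>i\<close> closes a cycle with
      \<open>Suc i\<close> vertices, and \<open>i \<ge> 2\<close> gives the length 3 that
      \<open>ugraph_cycle\<close> requires.\<close>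
    have "\<not> 2 \<le> i"
    proof
      assume "2 \<le> i"
      have "{vs ! j, vs ! (Suc j mod Suc i)} \<in> ?F" if "j < Suc i" for j
      proof (cases "j = i")
        case True
        then show ?thesis using i(2) w(1) f(1) by (simp add: insert_commute)
      next
        case False
        then show ?thesis using vs that i(1) by (simp add: path_def)
      qed
      moreover have "length (take (Suc i) vs) = Suc i" using i(1) by simp
      moreover have "distinct (take (Suc i) vs)" using vs by (simp add: path_def)
      ultimately have "ugraph_cycle H (take (Suc i) vs)"
        using \<open>2 \<le> i\<close> by (simp add: ugraph_cycle_def)
      with acyclic show False by blast
    qed
    with \<open>i \<noteq> 0\<close> have "i = 1" by linarith
    then show ?thesis using i w by simp
  qed
  then have "{f \<in> ?F. vs ! 0 \<in> f} \<subseteq> {{vs ! 0, vs ! 1}}" by blast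
  moreover have "vs ! 0 \<in> V" using vs by (cases vs) (auto simp: path_def)
  ultimately show ?thesis by blast
qed

text \<open>Removing a vertex of degree at most one removes at most one edge.\<close>

lemma forest_card_edges_less:
  fixes H :: "'v ugraph"
  assumes "finite V" "V \<noteq> {}"
    and "\<And>f. f \<in> uedges H \<Longrightarrow> \<exists>u\<in>V. \<exists>v\<in>V. f = {u, v}"
    and "\<nexists>vs. ugraph_cycle H vs"
  shows "card (uedges H) < card V"
  using assms
proof (induction "card V" arbitrary: V H)
  case 0
  then show ?case by simp
next
  case (Suc n)
  obtain v g where v: "v \<in> V" "{f \<in> uedges H. v \<in> f} \<subseteq> {g}"
    using forest_low_degree_vertex[OF Suc.prems] by blast
  define H' :: "'v ugraph" where "H' = \<lparr>uverts = {}, uedges = {f \<in> uedges H. v \<notin> f}\<rparr>"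
  have finF: "finite (uedges H)"
  proof (rule finite_subset)
    show "uedges H \<subseteq> Pow V" using Suc.prems(3) by blast
  qed (use Suc.prems(1) in simp)
  have edges': "\<exists>a\<in>V - {v}. \<exists>b\<in>V - {v}. f = {a, b}" if "f \<in> uedges H'" for f
  proof -
    have "f \<in> uedges H" "v \<notin> f" using that by (auto simp: H'_def)
    then show ?thesis using Suc.prems(3)[of f] by blast
  qed
  have acyclic': "\<nexists>vs. ugraph_cycle H' vs"
    using Suc.prems(4) ugraph_cycle_mono[of H' _ H] by (auto simp: H'_def)
  have "uedges H = uedges H' \<union> {f \<in> uedges H. v \<in> f}" by (auto simp: H'_def)
  then have "card (uedges H) \<le> card (uedges H') + card {f \<in> uedges H. v \<in> f}"
    by (metis card_Un_le)
  also have "card {f \<in> uedges H. v \<in> f} \<le> 1" using card_mono[OF _ v(2)] by simp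
  finally have le: "card (uedges H) \<le> card (uedges H') + 1" by simp
  show ?case
  proof (cases "V - {v} = {}")
    \<comment> \<open>With a single vertex an edge could only be a loop, which counts as a
      cycle.\<close>
    case True
    then have "uedges H' = {}" using edges' by auto
    have "uedges H = {}"
    proof (rule ccontr)
      assume "uedges H \<noteq> {}"
      then obtain f where "f \<in> uedges H" by blast
      moreover obtain a b where "a \<in> V" "b \<in> V" "f = {a, b}"
        using Suc.prems(3)[OF \<open>f \<in> uedges H\<close>] by blast
      moreover have "a = v" "b = v" using True \<open>a \<in> V\<close> \<open>b \<in> V\<close> by auto
      ultimately have "{v} \<in> uedges H" by simp
      then have "ugraph_cycle H [v]" by (simp add: ugraph_cycle_def)
      with Suc.prems(4) show False by blast
    qed
    then show ?thesis using Suc.hyps(2) by simp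
  next
    case False
    have "n = card (V - {v})" using Suc.hyps(2) v(1) Suc.prems(1) by simp
    from Suc.hyps(1)[OF this _ False edges' acyclic'] Suc.prems(1)
    have "card (uedges H') < card (V - {v})" by simp
    then show ?thesis using le \<open>n = card (V - {v})\<close> Suc.hyps(2) by simp
  qed
qed

section \<open>Gluing finite sets along pairs\<close>

text \<open>Each \<open>V W\<close> is the vertex set of one connected component, and the objects \<open>b\<close> with
  \<open>adj W b\<close> are the edges occurring in it; an edge shared by two components has two end points.\<close>

locale edge_sharing =
  fixes Ws :: "'w set" and adj :: "'w \<Rightarrow> 'b \<Rightarrow> bool" and ends :: "'b \<Rightarrow> 'v set" and V :: "'w \<Rightarrow> 'v set"
  assumes fin: "finite Ws" and nonempty: "Ws \<noteq> {}"
    and finV: "W \<in> Ws \<Longrightarrow> finite (V W)"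
    and ends_subset: "W \<in> Ws \<Longrightarrow> adj W b \<Longrightarrow> ends b \<subseteq> V W"
    and ends_two: "W \<in> Ws \<Longrightarrow> W' \<in> Ws \<Longrightarrow> W \<noteq> W' \<Longrightarrow> adj W b \<Longrightarrow> adj W' b \<Longrightarrow> card (ends b) = 2"
    and ends_inj: "W \<in> Ws \<Longrightarrow> adj W b \<Longrightarrow> adj W b' \<Longrightarrow> card (ends b) = 2 \<Longrightarrow> card (ends b') = 2 \<Longrightarrow>
      ends b = ends b' \<Longrightarrow> b = b'"
    and link: "S \<subset> Ws \<Longrightarrow> S \<noteq> {} \<Longrightarrow> \<exists>W\<in>S. \<exists>W'\<in>Ws - S. \<exists>b. adj W b \<and> adj W' b"
begin

text \<open>If the sets in \<open>S\<close> were glued one after another with exactly two vertices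
  identified at each gluing, the union would have as many elements as the sum minus
  \<open>2 * (card S - 1)\<close>. The defect is the excess of identifications over this; it can be
  negative when \<open>S\<close> is not connected by shared edges.\<close>

definition defect :: "'w set \<Rightarrow> int" where
  "defect S = (\<Sum>W\<in>S. int (card (V W))) - 2 * (int (card S) - 1) - int (card (\<Union>(V ` S)))"

lemma defect_singleton [simp]: "defect {W} = 0"
  by (simp add: defect_def)

lemma defect_insert:
  assumes "S \<subseteq> Ws" "W \<in> Ws - S"
  shows "defect (insert W S) = defect S + int (card (V W \<inter> \<Union>(V ` S))) - 2"
proof -
  have finS: "finite S" using assms(1) fin finite_subset by blast
  have "finite (V W)" "finite (\<Union>(V ` S))" using assms finS finV by auto
  from card_Un_Int[OF this] show ?thesis using assms finS by (simp add: defect_def)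
qed

lemma shared_edge:
  assumes "S \<subseteq> Ws" "W \<in> Ws - S" "W' \<in> S" "adj W b" "adj W' b"
  shows "ends b \<subseteq> V W \<inter> \<Union>(V ` S)" "card (ends b) = 2"
  using assms ends_subset[of W b] ends_subset[of W' b] ends_two[of W W' b] by auto

lemma finite_overlap: "S \<subseteq> Ws \<Longrightarrow> W \<in> Ws \<Longrightarrow> finite (V W \<inter> \<Union>(V ` S))"
  using finV by blast

lemma defect_insert_ge:
  assumes "S \<subseteq> Ws" "W \<in> Ws - S" "W' \<in> S" "adj W b" "adj W' b"
  shows "defect S \<le> defect (insert W S)"
proof -
  have "card (ends b) \<le> card (V W \<inter> \<Union>(V ` S))"
    by (rule card_mono[OF finite_overlap[OF assms(1)] shared_edge(1)[OF assms]]) (use assms in auto)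
  then show ?thesis using defect_insert[OF assms(1,2)] shared_edge(2)[OF assms] by simp
qed

text \<open>By \<open>link\<close>, any nonempty \<open>S\<close> can be enlarged along a shared
  edge until it is everything. The freedom in the starting set is what allows comparing the defect
  of any \<open>S\<close>, even a disconnected one, with that of \<open>Ws\<close>.\<close>

lemma grow_induct [consumes 2, case_names base step]:
  assumes "S \<subseteq> Ws" "S \<noteq> {}" "P S"
    and "\<And>S W W' b. S \<subseteq> Ws \<Longrightarrow> W \<in> Ws - S \<Longrightarrow> W' \<in> S \<Longrightarrow> adj W b \<Longrightarrow> adj W' b \<Longrightarrow> P S \<Longrightarrow> P (insert W S)"
  shows "P Ws"
  using assms(1-3)
proof (induction "card (Ws - S)" arbitrary: S rule: less_induct)
  case less
  show ?case
  proof (cases "S = Ws")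
    case False
    then obtain W W' b where W: "W' \<in> S" "W \<in> Ws - S" "adj W' b" "adj W b"
      using link[of S] less.prems by blast
    have "card (Ws - insert W S) < card (Ws - S)"
      using W fin by (intro psubset_card_mono) auto
    moreover have "P (insert W S)" using assms(4) W less.prems by blast
    ultimately show ?thesis using less.hyps[of "insert W S"] less.prems W by auto
  qed (use less.prems in simp)
qed

lemma defect_mono: "S \<subseteq> Ws \<Longrightarrow> S \<noteq> {} \<Longrightarrow> defect S \<le> defect Ws"
proof (induction rule: grow_induct[where P = "\<lambda>T. defect S \<le> defect T"])
  case (step T W W' b)
  then show ?case using defect_insert_ge[of T W W' b] by simp
qed auto

lemma defect_nonneg: "0 \<le> defect Ws"
proof -
  obtain W where "W \<in> Ws" using nonempty by blast
  then show ?thesis using defect_mono[of "{W}"] by simp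
qed

text \<open>A singleton has defect 0, the defect never decreases along the growth, and it ends at 0.
  So it is 0 throughout, and each overlap is no larger than the shared edge.\<close>

lemma tight_induct:
  assumes tight: "defect Ws = 0" and base: "\<And>W. W \<in> Ws \<Longrightarrow> P {W}"
    and step: "\<And>S W W' b. S \<subseteq> Ws \<Longrightarrow> W \<in> Ws - S \<Longrightarrow> W' \<in> S \<Longrightarrow> adj W b \<Longrightarrow> adj W' b \<Longrightarrow>
      card (ends b) = 2 \<Longrightarrow> V W \<inter> \<Union>(V ` S) = ends b \<Longrightarrow> P S \<Longrightarrow> P (insert W S)"
  shows "P Ws"
proof -
  obtain W0 where W0: "W0 \<in> Ws" using nonempty by blast
  have "defect Ws = 0 \<and> P Ws"
  proof (rule grow_induct[of "{W0}" "\<lambda>S. defect S = 0 \<and> P S"])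
    fix S W W' b assume S: "S \<subseteq> Ws" "W \<in> Ws - S" "W' \<in> S" "adj W b" "adj W' b" "defect S = 0 \<and> P S"
    have "defect (insert W S) \<le> 0" using defect_mono[of "insert W S"] S tight by auto
    moreover have "0 \<le> defect (insert W S)" using defect_insert_ge[OF S(1-5)] S(6) by simp
    ultimately have d: "defect (insert W S) = 0" by simp
    then have "card (V W \<inter> \<Union>(V ` S)) = card (ends b)"
      using defect_insert[OF S(1,2)] S(6) shared_edge(2)[OF S(1-5)] by simp
    then have "V W \<inter> \<Union>(V ` S) = ends b"
      using card_subset_eq[OF finite_overlap shared_edge(1)[OF S(1-5)]] S by auto
    then show "defect (insert W S) = 0 \<and> P (insert W S)"
      using d step[OF S(1-5) shared_edge(2)[OF S(1-5)]] S(6) by blast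
  qed (use W0 base in auto)
  then show ?thesis by blast
qed

text \<open>Two edges of a component \<open>W0\<close> cannot be linked through the other components: adding \<open>W0\<close>
  last would identify at least three vertices at once.\<close>

lemma tight_no_detour:
  assumes tight: "defect Ws = 0" and W0: "W0 \<in> Ws" "adj W0 b1" "adj W0 b2" and ne: "b1 \<noteq> b2"
    and R: "R = {(p, q). \<exists>W\<in>Ws - {W0}. \<exists>b. adj W b \<and> (p = Inl W \<and> q = Inr b \<or> p = Inr b \<and> q = Inl W)}"
  shows "(Inr b1, Inr b2) \<notin> R\<^sup>*"
proof
  assume "(Inr b1, Inr b2) \<in> R\<^sup>*"
  \<comment> \<open>\<open>S\<close> collects the components traversed so far. It starts as one
    component containing \<open>b1\<close> and grows along shared edges, so its defect stays
    nonnegative. At the black vertex \<open>b1\<close> itself no component has been visited yet,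
    hence the alternative \<open>y = Inr b1\<close> below.\<close>
  define good where "good y \<longleftrightarrow> (\<exists>S. S \<subseteq> Ws - {W0} \<and> 0 \<le> defect S \<and> (\<exists>W\<in>S. adj W b1) \<and>
    (case y of Inl W \<Rightarrow> W \<in> S | Inr b \<Rightarrow> \<exists>W\<in>S. adj W b))" for y
  have "y = Inr b1 \<or> good y" if "(Inr b1, y) \<in> R\<^sup>*" for y
    using that
  proof induction
    case base
    then show ?case by simp
  next
    case (step y z)
    from step.hyps(2) obtain W b where W: "W \<in> Ws - {W0}" "adj W b"
      and yz: "y = Inl W \<and> z = Inr b \<or> y = Inr b \<and> z = Inl W" unfolding R by blast
    show ?case
    proof (cases "good y")
      case False
      then have "y = Inr b1" using step.IH by blast
      then have "good z" using W yz unfolding good_def by (intro exI[of _ "{W}"]) auto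
      then show ?thesis ..
    next
      case True
      then obtain S where S: "S \<subseteq> Ws - {W0}" "0 \<le> defect S" "\<exists>W\<in>S. adj W b1"
        "case y of Inl W \<Rightarrow> W \<in> S | Inr b \<Rightarrow> \<exists>W\<in>S. adj W b" unfolding good_def by blast
      from yz have "good z"
      proof
        assume "y = Inl W \<and> z = Inr b"
        then show ?thesis using S W unfolding good_def by (intro exI[of _ S]) auto
      next
        assume yz: "y = Inr b \<and> z = Inl W"
        then obtain W' where W': "W' \<in> S" "adj W' b" using S(4) by auto
        show ?thesis
        proof (cases "W \<in> S")
          case True
          then show ?thesis using S yz unfolding good_def by (intro exI[of _ S]) auto
        next
          case False
          have "defect S \<le> defect (insert W S)"
            by (rule defect_insert_ge[of _ _ W' b]) (use S W W' False in auto)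
          then show ?thesis
            using S W yz unfolding good_def by (intro exI[of _ "insert W S"]) auto
        qed
      qed
      then show ?thesis ..
    qed
  qed
  from this[OF \<open>(Inr b1, Inr b2) \<in> R\<^sup>*\<close>] have "good (Inr b2)" using ne by auto
  then obtain S W1 W2 where S: "S \<subseteq> Ws - {W0}" "0 \<le> defect S"
    and W12: "W1 \<in> S" "adj W1 b1" "W2 \<in> S" "adj W2 b2" unfolding good_def by auto
  have S': "S \<subseteq> Ws" "W0 \<in> Ws - S" using S(1) W0(1) by auto
  note e1 = shared_edge[OF S' W12(1) W0(2) W12(2)] and e2 = shared_edge[OF S' W12(3) W0(3) W12(4)]
  \<comment> \<open>Two different edges of \<open>W0\<close> with two end points each have different
    end points, so \<open>W0\<close> meets the union over \<open>S\<close> in at least three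
    vertices and adding it raises the defect.\<close>
  have "ends b1 \<noteq> ends b2" using ends_inj[OF W0] e1(2) e2(2) ne by blast
  then have "ends b1 \<subset> ends b1 \<union> ends b2"
    using e1(2) e2(2) card_subset_eq[of "ends b1" "ends b2"]
    by (metis Un_upper1 card.infinite psubsetI sup.orderI sup_commute zero_neq_numeral)
  moreover have "finite (ends b1 \<union> ends b2)" using e1(2) e2(2) by (metis card.infinite finite_Un zero_neq_numeral)
  ultimately have "card (ends b1) < card (ends b1 \<union> ends b2)" by (metis psubset_card_mono)
  also have "\<dots> \<le> card (V W0 \<inter> \<Union>(V ` S))"
    by (rule card_mono[OF finite_overlap]) (use S' e1(1) e2(1) in auto)
  finally have "1 \<le> defect (insert W0 S)" using defect_insert[OF S'] e1(2) S(2) by simp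
  then show False using defect_mono[of "insert W0 S"] S' W0(1) tight by auto
qed

end

section \<open>The graph of a word and its pairings\<close>

lemma T_quot_simps [simp]:
  "arcs (T_quot ms \<pi>) = {1..sum_list ms}"
  "verts (T_quot ms \<pi>) = block_of \<pi> ` {1..sum_list ms}"
  "tail (T_quot ms \<pi>) j = block_of \<pi> (interval_perm ms j)"
  "head (T_quot ms \<pi>) j = block_of \<pi> j"
  by (simp_all add: T_quot_def identify_verts_def T_graph_def)

lemma endpoints_T_quot: "endpoints (T_quot ms \<pi>) j = {block_of \<pi> (interval_perm ms j), block_of \<pi> j}"
  by (simp add: endpoints_def)

lemma is_loop_T_quot: "is_loop (T_quot ms \<pi>) j \<longleftrightarrow> block_of \<pi> (interval_perm ms j) = block_of \<pi> j"
  by (simp add: is_loop_def)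

lemma card_endpoints_eq_2_iff: "card (endpoints G e) = 2 \<longleftrightarrow> \<not> is_loop G e"
  by (auto simp: endpoints_def is_loop_def card_insert_if)

lemma is_loop_cong: "endpoints G e = endpoints G f \<Longrightarrow> is_loop G e \<longleftrightarrow> is_loop G f"
  by (metis card_endpoints_eq_2_iff)

text \<open>The index counts a lower set in the order of blocks by minima. Such sets are nested, so
  equal counts mean equal sets, hence equal minima; and two blocks with a common element
  coincide.\<close>

lemma index_of_block:
  assumes part: "partition_on A \<pi>" and fin: "finite A" and i: "i \<in> A"
  shows "1 \<le> index_of_block \<pi> i" "index_of_block \<pi> i \<le> card \<pi>"
    and "j \<in> A \<Longrightarrow> index_of_block \<pi> i = index_of_block \<pi> j \<longleftrightarrow> block_of \<pi> i = block_of \<pi> j"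
proof -
  have fin\<pi>: "finite \<pi>" using finite_elements[OF fin part] .
  have "{B \<in> \<pi>. Min B \<le> Min (block_of \<pi> i)} \<noteq> {}" using block_of(1)[OF part i] by blast
  then show "1 \<le> index_of_block \<pi> i"
    using fin\<pi> by (simp add: index_of_block_def Suc_le_eq card_gt_0_iff)
  show "index_of_block \<pi> i \<le> card \<pi>"
    unfolding index_of_block_def by (rule card_mono[OF fin\<pi>]) blast
  assume j: "j \<in> A"
  show "index_of_block \<pi> i = index_of_block \<pi> j \<longleftrightarrow> block_of \<pi> i = block_of \<pi> j"
  proof
    assume eq: "index_of_block \<pi> i = index_of_block \<pi> j"
    let ?L = "\<lambda>i. {B \<in> \<pi>. Min B \<le> Min (block_of \<pi> i)}"
    have "?L i \<subseteq> ?L j \<or> ?L j \<subseteq> ?L i" by auto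
    then have "?L i = ?L j"
      using eq card_subset_eq[of "?L j" "?L i"] card_subset_eq[of "?L i" "?L j"] fin\<pi>
      by (auto simp: index_of_block_def)
    moreover have "block_of \<pi> i \<in> ?L i" "block_of \<pi> j \<in> ?L j" using block_of(1)[OF part] i j by auto
    ultimately have "block_of \<pi> i \<in> ?L j" "block_of \<pi> j \<in> ?L i" by simp_all
    then have min: "Min (block_of \<pi> i) = Min (block_of \<pi> j)" by simp
    have "finite (block_of \<pi> k) \<and> block_of \<pi> k \<noteq> {}" if "k \<in> A" for k
      using block_of[OF part that] partition_on_subset[OF part] fin finite_subset by blast
    then have "Min (block_of \<pi> i) \<in> block_of \<pi> i" "Min (block_of \<pi> i) \<in> block_of \<pi> j"
      using i j min Min_in by metis+
    then show "block_of \<pi> i = block_of \<pi> j"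
      using block_of_eqI[OF part] block_of(1)[OF part] i j by metis
  qed (simp add: index_of_block_def)
qed

text \<open>Translates the facts about entries into facts about edges: indices of blocks agree
  exactly when the blocks do, so the index pair of an entry determines the end points of its edge.
  This is the last use of the random matrix.\<close>

lemma (in prob_space) wigner_trace_blocks:
  fixes ms :: "nat list"
  defines "A \<equiv> {1..sum_list ms}" and "\<gamma> \<equiv> interval_perm ms"
  assumes perm: "\<gamma> permutes A" and \<pi>: "partition_on A \<pi>" and \<tau>: "partition_on A \<tau>"
    and wig: "wigner_entries M N \<beta> x" and N: "card \<pi> \<le> N"
    and nz: "partition_cumulant M \<tau> (\<lambda>j. x (index_of_block \<pi> j) (index_of_block \<pi> (\<gamma> j))) \<noteq> 0"
    and D: "D \<in> \<tau>"
  shows "\<And>i j. i \<in> D \<Longrightarrow> j \<in> D \<Longrightarrow> endpoints (T_quot ms \<pi>) i = endpoints (T_quot ms \<pi>) j"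
    and "\<And>j. j \<in> D \<Longrightarrow> is_loop (T_quot ms \<pi>) j \<Longrightarrow> card D = 2"
    and "balanced_edges (T_quot ms \<pi>) D"
proof -
  let ?a = "\<lambda>j. index_of_block \<pi> j" and ?b = "\<lambda>j. index_of_block \<pi> (\<gamma> j)"
  have finA: "finite A" by (simp add: A_def)
  have DA: "D \<subseteq> A" using partition_on_subset[OF \<tau> D] .
  have finD: "finite D" using DA finA finite_subset by blast
  have neD: "D \<noteq> {}" using \<tau> D by (auto simp: partition_on_def)
  have g: "\<gamma> j \<in> A" if "j \<in> A" for j using permutes_in_image[OF perm] that by simp
  have ab: "?a j \<in> {1..N} \<and> ?b j \<in> {1..N}" if "j \<in> D" for j
  proof -
    have "j \<in> A" using that DA by blast
    from index_of_block(1,2)[OF \<pi> finA this] index_of_block(1,2)[OF \<pi> finA g[OF this]] show ?thesis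
      using N by auto
  qed
  have idx: "index_of_block \<pi> i = index_of_block \<pi> j \<longleftrightarrow> block_of \<pi> i = block_of \<pi> j" if "i \<in> A" "j \<in> A" for i j
    using index_of_block(3)[OF \<pi> finA] that by blast
  have nzD: "cumulant M D (\<lambda>j. x (?a j) (?b j)) \<noteq> 0"
    using nz D finite_elements[OF finA \<tau>] unfolding partition_cumulant_def by (simp add: prod_zero_iff)
  show "endpoints (T_quot ms \<pi>) i = endpoints (T_quot ms \<pi>) j" if ij: "i \<in> D" "j \<in> D" for i j
  proof -
    have ijA: "i \<in> A" "j \<in> A" using ij DA by auto
    have "(min (?a i) (?b i), max (?a i) (?b i)) = (min (?a j) (?b j), max (?a j) (?b j))"
      by (rule wigner_cumulant_parallel[where a = ?a and b = ?b, OF wig finD ab nzD ij])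
    then have "?a i = ?a j \<and> ?b i = ?b j \<or> ?a i = ?b j \<and> ?b i = ?a j"
      by (auto simp: min_def max_def split: if_splits)
    then have "block_of \<pi> i = block_of \<pi> j \<and> block_of \<pi> (\<gamma> i) = block_of \<pi> (\<gamma> j) \<or>
        block_of \<pi> i = block_of \<pi> (\<gamma> j) \<and> block_of \<pi> (\<gamma> i) = block_of \<pi> j"
      using idx ijA g by simp
    then show ?thesis unfolding endpoints_T_quot \<gamma>_def by auto
  qed
  show "card D = 2" if "j \<in> D" "is_loop (T_quot ms \<pi>) j" for j
  proof (rule wigner_cumulant_loop[where a = ?a and b = ?b, OF wig finD ab nzD that(1)])
    show "?a j = ?b j" using that DA idx[of j "\<gamma> j"] g by (auto simp: is_loop_T_quot \<gamma>_def)
  qed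
  show "balanced_edges (T_quot ms \<pi>) D"
    unfolding balanced_edges_def arc_to_ends_def
  proof (intro allI)
    fix p q
    let ?G = "T_quot ms \<pi>"
    show "card {e \<in> D. (tail ?G e, head ?G e) = (p, q)} = card {e \<in> D. (tail ?G e, head ?G e) = (q, p)}"
    \<comment> \<open>If \<open>p\<close> or \<open>q\<close> is not a vertex, no edge is counted on
      either side.\<close>
    proof (cases "\<exists>i\<in>A. \<exists>j\<in>A. p = block_of \<pi> i \<and> q = block_of \<pi> j")
      case True
      then obtain i j where ij: "i \<in> A" "j \<in> A" "p = block_of \<pi> i" "q = block_of \<pi> j" by blast
      \<comment> \<open>The row index of the entry belongs to the head and the column index to the
        tail, hence the exchange of \<open>i\<close> and \<open>j\<close>.\<close>
      have "{e \<in> D. (tail ?G e, head ?G e) = (p, q)}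
          = {e \<in> D. ?a e = index_of_block \<pi> j \<and> ?b e = index_of_block \<pi> i}"
        using ij DA g idx by (auto simp: \<gamma>_def)
      moreover have "{e \<in> D. (tail ?G e, head ?G e) = (q, p)}
          = {e \<in> D. ?a e = index_of_block \<pi> i \<and> ?b e = index_of_block \<pi> j}"
        using ij DA g idx by (auto simp: \<gamma>_def)
      ultimately show ?thesis
        using wigner_cumulant_balanced[where a = ?a and b = ?b, OF wig finD ab nzD neD] by simp
    next
      case False
      then have "{e \<in> D. (tail ?G e, head ?G e) = (p, q)} = {}"
        "{e \<in> D. (tail ?G e, head ?G e) = (q, p)} = {}"
        using DA g unfolding \<gamma>_def by fastforce+
      then show ?thesis by metis
    qed
  qed
qed

lemma balanced_parallel_split:
  assumes "finite D" "balanced_edges G D" "d \<in> D" "\<not> is_loop G d"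
    and "\<And>i j. i \<in> D \<Longrightarrow> j \<in> D \<Longrightarrow> endpoints G i = endpoints G j"
  obtains P Q where "D = P \<union> Q" "P \<inter> Q = {}" "card P = card Q"
    "\<And>u v. u \<in> P \<Longrightarrow> v \<in> Q \<Longrightarrow> opposite_orientation G u v"
proof -
  define P where "P = {e \<in> D. arc_to_ends G e = (tail G d, head G d)}"
  define Q where "Q = {e \<in> D. arc_to_ends G e = (head G d, tail G d)}"
  have "arc_to_ends G e = (tail G d, head G d) \<or> arc_to_ends G e = (head G d, tail G d)" if "e \<in> D" for e
    using assms(5)[OF that assms(3)] by (auto simp: endpoints_def arc_to_ends_def doubleton_eq_iff)
  then have "D = P \<union> Q" by (auto simp: P_def Q_def)
  moreover have "P \<inter> Q = {}" using assms(4) by (auto simp: P_def Q_def is_loop_def)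
  moreover have "card P = card Q" using assms(2) by (simp add: balanced_edges_def P_def Q_def)
  moreover have "opposite_orientation G u v" if "u \<in> P" "v \<in> Q" for u v
    using that by (auto simp: P_def Q_def arc_to_ends_def opposite_orientation_def)
  ultimately show thesis by (rule that)
qed

lemma balanced_parallel_even:
  assumes "finite D" "balanced_edges G D"
    and "\<And>i j. i \<in> D \<Longrightarrow> j \<in> D \<Longrightarrow> endpoints G i = endpoints G j"
    and "\<And>j. j \<in> D \<Longrightarrow> is_loop G j \<Longrightarrow> card D = 2"
  shows "even (card D)"
proof (cases "\<exists>d\<in>D. \<not> is_loop G d")
  case True
  then obtain d where "d \<in> D" "\<not> is_loop G d" by blast
  then obtain P Q where "D = P \<union> Q" "P \<inter> Q = {}" "card P = card Q"
    using balanced_parallel_split[OF assms(1,2) _ _ assms(3)] by metis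
  moreover from this have "card D = card P + card Q" using assms(1) by (simp add: card_Un_disjoint)
  ultimately show ?thesis by simp
next
  case False
  then show ?thesis using assms(4) by (cases "D = {}") auto
qed

text \<open>For non-loops, a bijection between the two orientation classes gives the pairs. A block
  of loops has size two and is itself the pair, loops at the same vertex being opposite to each
  other.\<close>

lemma balanced_parallel_pairing:
  assumes "finite D" "D \<noteq> {}" "balanced_edges G D"
    and par: "\<And>i j. i \<in> D \<Longrightarrow> j \<in> D \<Longrightarrow> endpoints G i = endpoints G j"
    and loop: "\<And>j. j \<in> D \<Longrightarrow> is_loop G j \<Longrightarrow> card D = 2"
  shows "\<exists>\<sigma>. partition_on D \<sigma> \<and> (\<forall>B\<in>\<sigma>. card B = 2) \<and>
    (\<forall>u v. u \<noteq> v \<and> {u, v} \<in> \<sigma> \<longrightarrow> opposite_orientation G u v)"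
proof (cases "\<exists>d\<in>D. \<not> is_loop G d")
  case False
  have "opposite_orientation G u v" if "{u, v} = D" for u v
  proof -
    have "u \<in> D" "v \<in> D" using that by auto
    then show ?thesis using False par[of u v] by (auto simp: is_loop_def endpoints_def opposite_orientation_def)
  qed
  then show ?thesis
    using False assms(2) loop partition_on_space[OF assms(2)] by (intro exI[of _ "{D}"]) auto
next
  case True
  then obtain d where "d \<in> D" "\<not> is_loop G d" by blast
  then obtain P Q where PQ: "D = P \<union> Q" "P \<inter> Q = {}" "card P = card Q"
    and opp: "\<And>u v. u \<in> P \<Longrightarrow> v \<in> Q \<Longrightarrow> opposite_orientation G u v"
    using balanced_parallel_split[OF assms(1,3) _ _ par] by metis
  have "finite P" "finite Q" using assms(1) PQ(1) by auto
  then obtain h where h: "bij_betw h P Q" using finite_same_card_bij PQ(3) by blast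
  define \<sigma> where "\<sigma> = (\<lambda>u. {u, h u}) ` P"
  have hQ: "h u \<in> Q" if "u \<in> P" for u using h that by (auto simp: bij_betw_def)
  have hinj: "u = v" if "u \<in> P" "v \<in> P" "h u = h v" for u v
    using h that by (auto simp: bij_betw_def dest: inj_onD)
  have "\<Union>\<sigma> = P \<union> h ` P" by (auto simp: \<sigma>_def)
  then have "\<Union>\<sigma> = D" using h PQ(1) by (simp add: bij_betw_def)
  moreover have "disjnt p q" if pq: "p \<in> \<sigma>" "q \<in> \<sigma>" "p \<noteq> q" for p q
  proof -
    obtain u where "u \<in> P" "p = {u, h u}" using pq(1) unfolding \<sigma>_def by blast
    moreover obtain v where "v \<in> P" "q = {v, h v}" using pq(2) unfolding \<sigma>_def by blast
    ultimately have uv: "u \<in> P" "v \<in> P" "p = {u, h u}" "q = {v, h v}" by auto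
    then have "u \<noteq> v" using pq(3) by blast
    moreover have "h u \<noteq> h v" using hinj uv \<open>u \<noteq> v\<close> by blast
    moreover have "u \<noteq> h v" "h u \<noteq> v" using uv hQ PQ(2) by blast+
    ultimately show ?thesis using uv by (simp add: disjnt_def)
  qed
  ultimately have "partition_on D \<sigma>" by (intro partition_onI) (auto simp: \<sigma>_def)
  moreover have "card B = 2" if "B \<in> \<sigma>" for B
  proof -
    obtain u where u: "u \<in> P" "B = {u, h u}" using \<open>B \<in> \<sigma>\<close> by (auto simp: \<sigma>_def)
    from u(1) have "h u \<in> Q" by (rule hQ)
    then have "u \<noteq> h u" using PQ(2) u(1) by auto
    then show ?thesis using u(2) by simp
  qed
  moreover have "opposite_orientation G u v" if uv: "u \<noteq> v" "{u, v} \<in> \<sigma>" for u v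
  proof -
    obtain w where w: "w \<in> P" "{u, v} = {w, h w}" using uv(2) unfolding \<sigma>_def by blast
    from w(1) have "opposite_orientation G w (h w)" by (rule opp[OF _ hQ]) (rule w(1))
    then have "opposite_orientation G (h w) w" by (simp add: opposite_orientation_def)
    then show ?thesis using w(2) \<open>opposite_orientation G w (h w)\<close> by (auto simp: doubleton_eq_iff)
  qed
  ultimately show ?thesis by blast
qed

lemma opposite_orientation_endpoints: "opposite_orientation G u v \<Longrightarrow> endpoints G u = endpoints G v"
  by (auto simp: opposite_orientation_def endpoints_def)

lemma partition_on_Union_blocks:
  assumes "partition_on A P" "\<And>D. D \<in> P \<Longrightarrow> partition_on D (f D)"
  shows "partition_on A (\<Union>(f ` P))"
proof (rule partition_onI)
  have U: "\<Union>(f D) = D" if "D \<in> P" for D using assms(2)[OF that] by (simp add: partition_on_def)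
  have "\<Union>(\<Union>(f ` P)) = (\<Union>D\<in>P. \<Union>(f D))" by blast
  also have "\<dots> = \<Union>P" using U by simp
  finally show "\<Union>(\<Union>(f ` P)) = A" using assms(1) by (simp add: partition_on_def)
  show "{} \<notin> \<Union>(f ` P)" using assms(2) by (auto simp: partition_on_def)
  fix p q assume "p \<in> \<Union>(f ` P)" "q \<in> \<Union>(f ` P)" "p \<noteq> q"
  then obtain D E where DE: "D \<in> P" "p \<in> f D" "E \<in> P" "q \<in> f E" by blast
  show "disjnt p q"
  proof (cases "D = E")
    case True
    then show ?thesis
      using DE assms(2)[OF DE(1)] \<open>p \<noteq> q\<close> by (auto simp: partition_on_def pairwise_def)
  next
    case False
    then have "disjnt D E" using DE assms(1) by (auto simp: partition_on_def pairwise_def)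
    moreover have "p \<subseteq> D" "q \<subseteq> E" using DE U by blast+
    ultimately show ?thesis by (meson disjnt_subset1 disjnt_subset2)
  qed
qed

lemma exists_opposite_pairing:
  assumes \<tau>: "partition_on {1..sum_list ms} \<tau>"
    and par: "\<And>D i j. D \<in> \<tau> \<Longrightarrow> i \<in> D \<Longrightarrow> j \<in> D \<Longrightarrow> endpoints (T_quot ms \<pi>) i = endpoints (T_quot ms \<pi>) j"
    and loop: "\<And>D j. D \<in> \<tau> \<Longrightarrow> j \<in> D \<Longrightarrow> is_loop (T_quot ms \<pi>) j \<Longrightarrow> card D = 2"
    and bal: "\<And>D. D \<in> \<tau> \<Longrightarrow> balanced_edges (T_quot ms \<pi>) D"
  shows "\<exists>\<sigma>. opposite_pairing ms \<pi> \<tau> \<sigma>"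
proof -
  let ?G = "T_quot ms \<pi>"
  have "\<exists>\<sigma>. partition_on D \<sigma> \<and> (\<forall>B\<in>\<sigma>. card B = 2) \<and>
    (\<forall>u v. u \<noteq> v \<and> {u, v} \<in> \<sigma> \<longrightarrow> opposite_orientation ?G u v)" if D: "D \<in> \<tau>" for D
  proof (rule balanced_parallel_pairing)
    show "finite D" using partition_on_subset[OF \<tau> D] by (rule finite_subset) simp
    show "D \<noteq> {}" using \<tau> D by (auto simp: partition_on_def)
  qed (use par loop bal D in blast)+
  then obtain f where f: "\<And>D. D \<in> \<tau> \<Longrightarrow> partition_on D (f D)"
    "\<And>D B. D \<in> \<tau> \<Longrightarrow> B \<in> f D \<Longrightarrow> card B = 2"
    "\<And>D u v. D \<in> \<tau> \<Longrightarrow> u \<noteq> v \<Longrightarrow> {u, v} \<in> f D \<Longrightarrow> opposite_orientation ?G u v"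
    by metis
  let ?\<sigma> = "\<Union>(f ` \<tau>)"
  have part: "partition_on {1..sum_list ms} ?\<sigma>" by (rule partition_on_Union_blocks[OF \<tau> f(1)])
  have "refines {1..sum_list ms} ?\<sigma> \<tau>"
    unfolding refines_def
  proof (intro conjI ballI part \<tau>)
    fix B assume "B \<in> ?\<sigma>"
    then obtain D where "D \<in> \<tau>" "B \<in> f D" by blast
    then show "\<exists>D\<in>\<tau>. B \<subseteq> D" using partition_on_subset[OF f(1)] by blast
  qed
  moreover have "?\<sigma> \<in> pairings (sum_list ms)" using part f(2) by (auto simp: pairings_def)
  moreover have opp: "opposite_orientation ?G u v" if "u \<noteq> v" "{u, v} \<in> ?\<sigma>" for u v
    using that f(3) by blast
  ultimately have "opposite_pairing ms \<pi> \<tau> ?\<sigma>"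
    unfolding opposite_pairing_def using opposite_orientation_endpoints[of ?G] by simp
  then show ?thesis ..
qed

section \<open>Opposite pairings\<close>

lemma perm_cycles_cong:
  assumes "\<And>i. i \<in> W \<Longrightarrow> p i \<in> W" "\<And>i. i \<in> W \<Longrightarrow> p i = q i"
  shows "perm_cycles W p = orbit q ` W"
  unfolding perm_cycles_def using assms by (intro image_cong orbit_cong0[of _ W]) auto

lemma card_image_eq_iff_inj_on: "finite S \<Longrightarrow> card (f ` S) = card S \<longleftrightarrow> inj_on f S"
  using card_image eq_card_imp_inj_on by blast

text \<open>Purely combinatorial: of the nonvanishing cumulant only \<open>parallel\<close> and
  \<open>loop_card\<close> remain, while the balance of orientations has been absorbed into the
  existence of \<sigma>.\<close>

locale opposite_setting =
  fixes ms :: "nat list" and \<pi> \<tau> \<sigma> :: "nat set set" and A :: "nat set" and \<gamma> :: "nat \<Rightarrow> nat"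
  assumes A: "A = {1..sum_list ms}" and \<gamma>: "\<gamma> = interval_perm ms"
    and ms_pos: "\<forall>k\<in>set ms. k \<ge> 1" and ms_ne: "ms \<noteq> []"
    and \<pi>: "partition_on A \<pi>" and \<tau>: "partition_on A \<tau>"
    and connected: "partition_join A \<tau> (perm_cycles A \<gamma>) = {A}"
    and parallel: "\<And>D i j. D \<in> \<tau> \<Longrightarrow> i \<in> D \<Longrightarrow> j \<in> D \<Longrightarrow>
      endpoints (T_quot ms \<pi>) i = endpoints (T_quot ms \<pi>) j"
    and loop_card: "\<And>D j. D \<in> \<tau> \<Longrightarrow> j \<in> D \<Longrightarrow> is_loop (T_quot ms \<pi>) j \<Longrightarrow> card D = 2"
    and opposite: "opposite_pairing ms \<pi> \<tau> \<sigma>"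
begin

abbreviation s :: "nat \<Rightarrow> nat" where "s \<equiv> pairing_perm \<sigma>"
abbreviation p :: "nat \<Rightarrow> nat" where "p \<equiv> \<gamma> \<circ> s"
abbreviation \<kappa> :: "nat set set" where "\<kappa> \<equiv> gamma_sigma ms \<sigma>"
abbreviation G :: "(nat set, nat) pre_digraph" where "G \<equiv> T_quot ms \<pi>"
abbreviation K :: "(nat set, nat) pre_digraph" where "K \<equiv> T_quot ms \<kappa>"
abbreviation Ws :: "nat set set" where "Ws \<equiv> partition_join A \<sigma> (perm_cycles A \<gamma>)"

lemma finA: "finite A" by (simp add: A)

lemma \<gamma>_perm: "\<gamma> permutes A"
  unfolding A \<gamma> by (rule interval_perm_permutes[OF ms_pos])

lemma \<sigma>_part: "partition_on A \<sigma>" and \<sigma>_two: "\<forall>B\<in>\<sigma>. card B = 2" and \<sigma>_\<tau>: "refines A \<sigma> \<tau>"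
  using opposite by (auto simp: opposite_pairing_def pairings_def A)

lemmas s_block = pairing_perm_block[OF finA \<sigma>_part \<sigma>_two]
lemmas s_perm = pairing_perm_permutes[OF finA \<sigma>_part \<sigma>_two]
lemmas s_s = pairing_perm_involution[OF finA \<sigma>_part \<sigma>_two]

lemma \<gamma>_in: "i \<in> A \<Longrightarrow> \<gamma> i \<in> A" using permutes_in_image[OF \<gamma>_perm] by simp

lemma p_perm: "p permutes A" by (rule permutes_compose[OF s_perm \<gamma>_perm])

lemma \<kappa>_eq: "\<kappa> = perm_cycles A p" by (simp add: gamma_sigma_def A \<gamma>)

lemma \<kappa>_part: "partition_on A \<kappa>" unfolding \<kappa>_eq by (rule orbit_partition[OF finA p_perm])

lemma block_of_\<kappa>: "i \<in> A \<Longrightarrow> block_of \<kappa> i = orbit p i"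
  unfolding \<kappa>_eq by (rule block_of_perm_cycles[OF finA p_perm])

text \<open>\<open>\<gamma> i = p (s i)\<close> because \<open>s\<close> is an involution. Thus the
  edges of \<open>i\<close> and \<open>s i\<close> are opposite already in \<open>K\<close>, which
  is the graph of \<gamma> glued along \<sigma> alone.\<close>

lemma \<kappa>_step: "i \<in> A \<Longrightarrow> block_of \<kappa> (\<gamma> i) = block_of \<kappa> (s i)"
proof -
  assume i: "i \<in> A"
  have "orbit p (p (s i)) = orbit p (s i)" by (rule orbit_apply_eq[OF finA p_perm])
  then have "orbit p (\<gamma> i) = orbit p (s i)" by (simp add: s_s comp_def)
  then show ?thesis using i \<gamma>_in s_block(3) block_of_\<kappa> by simp
qed

lemma endpoints_G: "endpoints G j = {block_of \<pi> (\<gamma> j), block_of \<pi> j}"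
  unfolding endpoints_T_quot \<gamma> ..

lemma endpoints_K: "endpoints K j = {block_of \<kappa> (\<gamma> j), block_of \<kappa> j}"
  unfolding endpoints_T_quot \<gamma> ..

lemma \<pi>_step: "i \<in> A \<Longrightarrow> block_of \<pi> (\<gamma> i) = block_of \<pi> (s i)"
proof -
  assume i: "i \<in> A"
  then have "opposite_orientation G i (s i)"
    using opposite s_block(1,2)[OF i] by (auto simp: opposite_pairing_def)
  then show ?thesis by (simp add: opposite_orientation_def \<gamma>)
qed

text \<open>Applying the hypothesis to \<open>s i\<close> shows that \<open>i\<close> and
  \<open>p i\<close> share a block of \<open>Q\<close>. Both \<pi> and the components
  \<open>Ws\<close> satisfy it.\<close>

lemma refines_\<kappa>:
  assumes Q: "partition_on A Q" and step: "\<And>i. i \<in> A \<Longrightarrow> block_of Q (\<gamma> i) = block_of Q (s i)"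
  shows "refines A \<kappa> Q"
proof (rule refinesI_block_of[OF \<kappa>_part Q])
  have inv: "block_of Q (p i) = block_of Q i" for i
  proof (cases "i \<in> A")
    case True
    then show ?thesis using step[OF s_block(3)[OF True]] by (simp add: s_s)
  next
    case False
    then show ?thesis using permutes_not_in[OF p_perm False] by simp
  qed
  fix i j assume ij: "i \<in> A" "j \<in> A" "block_of \<kappa> i = block_of \<kappa> j"
  then have "i \<in> orbit p j" using block_of(2)[OF \<kappa>_part ij(1)] block_of_\<kappa> by simp
  then show "block_of Q i = block_of Q j" by (rule orbit_invariant[of "block_of Q" p, OF inv])
qed

lemma \<kappa>_\<pi>: "refines A \<kappa> \<pi>" by (rule refines_\<kappa>[OF \<pi> \<pi>_step])

lemmas Ws_part = partition_on_join[OF \<sigma>_part orbit_partition[OF finA \<gamma>_perm]]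

lemma Ws_s: "i \<in> A \<Longrightarrow> block_of Ws (s i) = block_of Ws i"
proof (rule refines_block_of[OF refines_join1[OF \<sigma>_part orbit_partition[OF finA \<gamma>_perm]]])
  assume i: "i \<in> A"
  then show "s i \<in> A" "i \<in> A" using s_block(3) by auto
  then show "block_of \<sigma> (s i) = block_of \<sigma> i"
    using s_block(5)[of i] s_block(5)[of "s i"] s_s[of i] by auto
qed

lemma Ws_\<gamma>: "i \<in> A \<Longrightarrow> block_of Ws (\<gamma> i) = block_of Ws i"
proof (rule refines_block_of[OF refines_join2[OF \<sigma>_part orbit_partition[OF finA \<gamma>_perm]]])
  assume i: "i \<in> A"
  then show "\<gamma> i \<in> A" "i \<in> A" using \<gamma>_in by auto
  then show "block_of (perm_cycles A \<gamma>) (\<gamma> i) = block_of (perm_cycles A \<gamma>) i"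
    using block_of_perm_cycles[OF finA \<gamma>_perm] orbit_apply_eq[OF finA \<gamma>_perm] by simp
qed

lemma \<kappa>_Ws: "refines A \<kappa> Ws" by (rule refines_\<kappa>[OF Ws_part]) (simp add: Ws_s Ws_\<gamma>)

lemma finite_Ws: "finite Ws" by (rule finite_elements[OF finA Ws_part])

lemma W_sub: "W \<in> Ws \<Longrightarrow> W \<subseteq> A" by (rule partition_on_subset[OF Ws_part])

lemma W_fin: "W \<in> Ws \<Longrightarrow> finite W" using W_sub finA finite_subset by blast

lemma W_block: "W \<in> Ws \<Longrightarrow> i \<in> W \<Longrightarrow> block_of Ws i = W" by (rule block_of_eqI[OF Ws_part])

lemma in_W_iff: "W \<in> Ws \<Longrightarrow> i \<in> A \<Longrightarrow> i \<in> W \<longleftrightarrow> block_of Ws i = W"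
  using W_block block_of(2)[OF Ws_part] by blast

lemma W_\<gamma>: "W \<in> Ws \<Longrightarrow> i \<in> W \<Longrightarrow> \<gamma> i \<in> W"
  using in_W_iff[of W "\<gamma> i"] Ws_\<gamma>[of i] \<gamma>_in[of i] W_sub[of W] W_block[of W i] by auto

lemma W_s: "W \<in> Ws \<Longrightarrow> i \<in> W \<Longrightarrow> s i \<in> W"
  using in_W_iff[of W "s i"] Ws_s[of i] s_block(3)[of i] W_sub[of W] W_block[of W i] by auto

lemma W_\<kappa>: "W \<in> Ws \<Longrightarrow> i \<in> W \<Longrightarrow> block_of \<kappa> i \<subseteq> W"
  using refines_block_subset[OF \<kappa>_Ws, of i] W_block[of W i] W_sub[of W] by auto

text \<open>The vertices of \<open>K\<close> lying in \<open>W\<close>; \<open>components_K\<close>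
  shows that these sets are its connected components.\<close>

definition sub :: "nat set \<Rightarrow> nat set set" where "sub W = block_of \<kappa> ` W"

lemma sub_eq: "W \<in> Ws \<Longrightarrow> sub W = {C \<in> \<kappa>. C \<subseteq> W}"
proof (intro equalityI subsetI)
  fix C assume W: "W \<in> Ws" and "C \<in> sub W"
  then obtain i where "i \<in> W" "C = block_of \<kappa> i" by (auto simp: sub_def)
  then show "C \<in> {C \<in> \<kappa>. C \<subseteq> W}" using W_\<kappa>[OF W] W_sub[OF W] block_of(1)[OF \<kappa>_part] by blast
next
  fix C assume W: "W \<in> Ws" and C: "C \<in> {C \<in> \<kappa>. C \<subseteq> W}"
  then obtain i where "i \<in> C" "i \<in> A" using partition_on_ex_elem[OF \<kappa>_part] by blast
  then have "C = block_of \<kappa> i" "i \<in> W" using block_of_eqI[OF \<kappa>_part] C by auto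
  then show "C \<in> sub W" by (simp add: sub_def)
qed

lemma Union_sub: "W \<in> Ws \<Longrightarrow> \<Union>(sub W) = W"
proof -
  assume W: "W \<in> Ws"
  have "i \<in> \<Union>(sub W)" if "i \<in> W" for i
    using that W_sub[OF W] block_of(2)[OF \<kappa>_part] by (auto simp: sub_def)
  then show ?thesis using sub_eq[OF W] by blast
qed

lemma sum_card_sub: "(\<Sum>W\<in>Ws. card (sub W)) = card \<kappa>"
proof -
  have "sub W \<inter> sub W' = {}" if W: "W \<in> Ws" "W' \<in> Ws" "W \<noteq> W'" for W W'
  proof (rule ccontr)
    assume "sub W \<inter> sub W' \<noteq> {}"
    then obtain C where C: "C \<in> \<kappa>" "C \<subseteq> W" "C \<subseteq> W'" using sub_eq W by auto
    then obtain i where "i \<in> C" using partition_on_ex_elem[OF \<kappa>_part] by blast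
    then show False using C W W_block by (metis subsetD)
  qed
  then have "card (\<Union>W\<in>Ws. sub W) = (\<Sum>W\<in>Ws. card (sub W))"
    by (intro card_UN_disjoint finite_Ws) (auto simp: sub_def W_fin)
  moreover have "(\<Union>W\<in>Ws. sub W) = block_of \<kappa> ` A"
    unfolding sub_def using Ws_part by (auto simp: partition_on_def)
  ultimately show ?thesis using card_image_block_of[OF \<kappa>_part] by simp
qed

text \<open>The vertex map of the quotient from \<open>K\<close> to \<open>G\<close>. The minimum is
  just a representative, and \<open>\<phi>_block\<close> makes the choice immaterial.\<close>

definition \<phi> :: "nat set \<Rightarrow> nat set" where "\<phi> C = block_of \<pi> (Min C)"

lemma \<phi>_block: "i \<in> A \<Longrightarrow> \<phi> (block_of \<kappa> i) = block_of \<pi> i"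
proof -
  assume i: "i \<in> A"
  let ?C = "block_of \<kappa> i"
  have C: "?C \<in> \<kappa>" "i \<in> ?C" "?C \<subseteq> A"
    using block_of[OF \<kappa>_part i] partition_on_subset[OF \<kappa>_part] by auto
  then have "Min ?C \<in> ?C" using finA finite_subset by (intro Min_in) auto
  then have "block_of \<kappa> (Min ?C) = ?C" "Min ?C \<in> A" using block_of_eqI[OF \<kappa>_part C(1)] C(3) by auto
  then show ?thesis unfolding \<phi>_def by (intro refines_block_of[OF \<kappa>_\<pi> _ i])
qed

lemma \<phi>_endpoints: "j \<in> A \<Longrightarrow> \<phi> ` endpoints K j = endpoints G j"
  by (simp add: endpoints_G endpoints_K \<phi>_block \<gamma>_in)

text \<open>The vertices of \<open>G\<close> met by \<open>W\<close>; there are as many of them as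
  blocks of the restriction of \<pi> to \<open>W\<close>.\<close>

definition VW :: "nat set \<Rightarrow> nat set set" where "VW W = block_of \<pi> ` W"

lemma VW_eq: "W \<in> Ws \<Longrightarrow> VW W = \<phi> ` sub W"
  unfolding VW_def sub_def image_image using W_sub \<phi>_block by (intro image_cong) auto

lemma Union_VW: "\<Union>(VW ` Ws) = \<pi>"
proof -
  have "\<Union>(VW ` Ws) = block_of \<pi> ` A"
    unfolding VW_def using Ws_part by (auto simp: partition_on_def)
  then show ?thesis using partition_eq_image_block_of[OF \<pi>] by simp
qed

definition separated :: bool where
  "separated \<longleftrightarrow> (\<forall>W\<in>Ws. inj_on \<phi> (sub W))"

lemma separatedD: "separated \<Longrightarrow> W \<in> Ws \<Longrightarrow> C \<in> sub W \<Longrightarrow> C' \<in> sub W \<Longrightarrow> \<phi> C = \<phi> C' \<Longrightarrow> C = C'"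
  unfolding separated_def by (blast dest: inj_onD)

lemma finite_sub: "W \<in> Ws \<Longrightarrow> finite (sub W)" by (simp add: sub_def W_fin)

lemma card_VW_le: "W \<in> Ws \<Longrightarrow> card (VW W) \<le> card (sub W)"
  unfolding VW_eq by (rule card_image_le[OF finite_sub])

lemma sum_card_VW_le: "(\<Sum>W\<in>Ws. card (VW W)) \<le> card \<kappa>"
  unfolding sum_card_sub[symmetric] by (rule sum_mono[OF card_VW_le])

lemma sum_card_VW_eq_iff: "(\<Sum>W\<in>Ws. card (VW W)) = card \<kappa> \<longleftrightarrow> separated"
proof -
  have "(\<Sum>W\<in>Ws. card (VW W)) = card \<kappa> \<longleftrightarrow> (\<forall>W\<in>Ws. card (VW W) = card (sub W))"
    unfolding sum_card_sub[symmetric]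
    using sum_mono_inv[OF _ card_VW_le _ finite_Ws] by (auto intro: sum.cong)
  also have "\<dots> \<longleftrightarrow> separated"
    unfolding separated_def by (simp add: VW_eq card_image_eq_iff_inj_on finite_sub)
  finally show ?thesis .
qed

lemma perm_cycles_W:
  assumes W: "W \<in> Ws"
  shows "perm_cycles W (perm_restrict \<gamma> W \<circ> perm_restrict s W) = sub W"
proof -
  have "perm_cycles W (perm_restrict \<gamma> W \<circ> perm_restrict s W) = orbit p ` W"
    by (rule perm_cycles_cong) (simp_all add: perm_restrict_def W_\<gamma>[OF W] W_s[OF W])
  also have "\<dots> = sub W" unfolding sub_def using W_sub[OF W] block_of_\<kappa> by (intro image_cong) auto
  finally show ?thesis .
qed

lemma partition_restrict_W:
  assumes W: "W \<in> Ws"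
  shows "partition_restrict \<pi> W = (\<lambda>i. W \<inter> block_of \<pi> i) ` W"
proof (intro equalityI subsetI)
  fix B assume "B \<in> partition_restrict \<pi> W"
  then obtain P where P: "P \<in> \<pi>" "B = W \<inter> P" "B \<noteq> {}" by (auto simp: partition_restrict_def)
  then obtain i where "i \<in> W" "i \<in> P" by blast
  then show "B \<in> (\<lambda>i. W \<inter> block_of \<pi> i) ` W" using P block_of_eqI[OF \<pi> P(1)] by blast
next
  fix B assume "B \<in> (\<lambda>i. W \<inter> block_of \<pi> i) ` W"
  then obtain i where i: "i \<in> W" "B = W \<inter> block_of \<pi> i" by blast
  then have "i \<in> A" using W_sub[OF W] by blast
  then show "B \<in> partition_restrict \<pi> W"
    using i block_of[OF \<pi>] unfolding partition_restrict_def by blast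
qed

text \<open>If the two partitions of \<open>W\<close> agree, a cycle is recovered from its image as
  \<open>C = W \<inter> \<phi> C\<close>. Conversely, two elements of \<open>W\<close> in one block
  of \<pi> have cycles with the same image, and injectivity makes these cycles equal.\<close>

lemma cond_L2_iff: "cond_L2 ms \<pi> \<sigma> \<longleftrightarrow> separated"
proof -
  have "cond_L2 ms \<pi> \<sigma> \<longleftrightarrow> (\<forall>W\<in>Ws. partition_restrict \<pi> W = sub W)"
    unfolding cond_L2_def A[symmetric] \<gamma>[symmetric] using perm_cycles_W by simp
  also have "\<dots> \<longleftrightarrow> separated"
    unfolding separated_def
  proof (rule ball_cong[OF refl])
    fix W assume W: "W \<in> Ws"
    have WA: "i \<in> A" if "i \<in> W" for i using that W_sub[OF W] by blast
    show "partition_restrict \<pi> W = sub W \<longleftrightarrow> inj_on \<phi> (sub W)"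
    proof
      assume eq: "partition_restrict \<pi> W = sub W"
      have C: "C = W \<inter> \<phi> C" if C: "C \<in> sub W" for C
      proof -
        have "C \<in> (\<lambda>i. W \<inter> block_of \<pi> i) ` W" using C eq partition_restrict_W[OF W] by simp
        then obtain k where k: "k \<in> W" "C = W \<inter> block_of \<pi> k" by blast
        then have "k \<in> C" using block_of(2)[OF \<pi> WA] by blast
        moreover have "C \<in> \<kappa>" using C sub_eq[OF W] by blast
        ultimately have "C = block_of \<kappa> k" using block_of_eqI[OF \<kappa>_part] by blast
        then have "\<phi> C = block_of \<pi> k" using \<phi>_block[OF WA[OF k(1)]] by simp
        then show ?thesis using k(2) by simp
      qed
      show "inj_on \<phi> (sub W)" by (rule inj_onI) (metis C)
    next
      assume inj: "inj_on \<phi> (sub W)"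
      have "W \<inter> block_of \<pi> i = block_of \<kappa> i" if i: "i \<in> W" for i
      proof
        show "W \<inter> block_of \<pi> i \<subseteq> block_of \<kappa> i"
        proof
          fix j assume j: "j \<in> W \<inter> block_of \<pi> i"
          then have "block_of \<pi> j = block_of \<pi> i"
            using block_of_eqI[OF \<pi> block_of(1)[OF \<pi> WA[OF i]]] by blast
          then have "\<phi> (block_of \<kappa> j) = \<phi> (block_of \<kappa> i)" using j by (simp add: \<phi>_block WA i)
          then have "block_of \<kappa> j = block_of \<kappa> i"
            by (rule inj_onD[OF inj]) (use i j in \<open>auto simp: sub_def\<close>)
          then show "j \<in> block_of \<kappa> i" using block_of(2)[OF \<kappa>_part WA] j by blast
        qed
        show "block_of \<kappa> i \<subseteq> W \<inter> block_of \<pi> i"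
          using W_\<kappa>[OF W i] refines_block_subset[OF \<kappa>_\<pi> WA[OF i]] by blast
      qed
      then show "partition_restrict \<pi> W = sub W"
        unfolding partition_restrict_W[OF W] sub_def by (rule image_cong[OF refl])
    qed
  qed
  finally show ?thesis .
qed

lemma card_A: "card A = 2 * card \<sigma>" by (rule card_pairing[OF finA \<sigma>_part \<sigma>_two])

lemma card_cycles_\<gamma>: "card (perm_cycles A \<gamma>) = length ms"
  unfolding A \<gamma> by (rule card_cycles_interval_perm[OF ms_pos])

lemma card_\<kappa>_le: "card \<kappa> + length ms \<le> card \<sigma> + 2 * card Ws"
  using genus_inequality[OF finA \<sigma>_part \<sigma>_two \<gamma>_perm] by (simp add: \<kappa>_eq card_cycles_\<gamma>)

lemma A_ne: "A \<noteq> {}"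
proof -
  obtain k where "k \<in> set ms" using ms_ne by (cases ms) auto
  then have "1 \<le> sum_list ms" using ms_pos member_le_sum_list[of k ms] by fastforce
  then show ?thesis by (simp add: A)
qed

lemma Ws_ne: "Ws \<noteq> {}" using Ws_part A_ne by (auto simp: partition_on_def)

text \<open>\<open>NC2\<close> and \<open>NC2_nc\<close> are the cases of one component and of
  several components of the same equation, which is equality in
  \<open>card_\<kappa>_le\<close>.\<close>

lemma cond_L1_iff: "cond_L1 ms \<sigma> \<longleftrightarrow> card \<kappa> + length ms = card \<sigma> + 2 * card Ws"
proof -
  have inv: "card (perm_cycles A (inv s \<circ> \<gamma>)) = card \<kappa>"
    unfolding \<kappa>_eq by (rule card_cycles_inv_pairing_comp[OF finA \<sigma>_part \<sigma>_two \<gamma>_perm])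
  have cyc: "perm_cycles A s = \<sigma>" by (rule perm_cycles_pairing_perm[OF finA \<sigma>_part \<sigma>_two])
  have m: "sum_list ms = 2 * card \<sigma>" using card_A by (simp add: A)
  have NC2: "s \<in> NC2 ms \<longleftrightarrow> Ws = {A} \<and> card \<sigma> + length ms + card \<kappa> = 2 * card \<sigma> + 2"
    unfolding NC2_def Let_def A[symmetric] \<gamma>[symmetric] mem_Collect_eq
    unfolding cyc inv card_cycles_\<gamma> m
    using s_perm \<sigma>_two by simp
  have NC2_nc: "s \<in> NC2_nc ms \<longleftrightarrow> Ws \<noteq> {A} \<and> card \<sigma> + length ms + card \<kappa> = 2 * card \<sigma> + 2 * card Ws"
    unfolding NC2_nc_def Let_def A[symmetric] \<gamma>[symmetric] mem_Collect_eq
    unfolding cyc inv card_cycles_\<gamma> m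
    using s_perm \<sigma>_two by simp
  show ?thesis
  proof (cases "Ws = {A}")
    case True
    then have "card Ws = 1" by simp
    then show ?thesis unfolding cond_L1_def Un_iff NC2 NC2_nc using True by auto
  next
    case False
    then show ?thesis unfolding cond_L1_def Un_iff NC2 NC2_nc by auto
  qed
qed

section \<open>Merged blocks as the edges shared between components\<close>

abbreviation mb :: "nat set set" where "mb \<equiv> merge_nonloops G \<tau>"

text \<open>The block of \<open>mb\<close> containing \<open>j\<close>, described pointwise: a loop
  keeps its block of \<tau>, a non-loop gets its whole parallel class.\<close>

definition merged :: "nat \<Rightarrow> nat set" where
  "merged j = (if is_loop G j then block_of \<tau> j else {i \<in> A. endpoints G i = endpoints G j})"

lemma \<tau>_endpoints: "j \<in> A \<Longrightarrow> i \<in> block_of \<tau> j \<Longrightarrow> endpoints G i = endpoints G j"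
  using parallel block_of[OF \<tau>] by blast

lemma merged_endpoints: "j \<in> A \<Longrightarrow> i \<in> merged j \<Longrightarrow> i \<in> A \<and> endpoints G i = endpoints G j"
  using \<tau>_endpoints[of j i] partition_on_subset[OF \<tau> block_of(1)[OF \<tau>, of j]]
  by (auto simp: merged_def split: if_splits)

lemma \<tau>_merged: "j \<in> A \<Longrightarrow> block_of \<tau> j \<subseteq> merged j"
  using \<tau>_endpoints[of j] partition_on_subset[OF \<tau> block_of(1)[OF \<tau>, of j]] by (auto simp: merged_def)

lemma self_merged: "j \<in> A \<Longrightarrow> j \<in> merged j"
  using \<tau>_merged[of j] block_of(2)[OF \<tau>, of j] by blast

lemma merged_eq: "j \<in> A \<Longrightarrow> i \<in> merged j \<Longrightarrow> merged i = merged j"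
proof -
  assume j: "j \<in> A" and i: "i \<in> merged j"
  have e: "endpoints G i = endpoints G j" using merged_endpoints[OF j i] by simp
  show ?thesis
  proof (cases "is_loop G j")
    case True
    then have "block_of \<tau> i = block_of \<tau> j"
      using i block_of_eqI[OF \<tau> block_of(1)[OF \<tau> j]] by (simp add: merged_def)
    then show ?thesis using True is_loop_cong[OF e] by (simp add: merged_def)
  next
    case False
    then show ?thesis using is_loop_cong[OF e] e by (simp add: merged_def)
  qed
qed

lemma mb_eq: "mb = merged ` A"
proof -
  let ?U = "\<lambda>D. {D' \<in> \<tau>. D' = D \<or> ((\<exists>B \<in> parallel_classes G. D \<subseteq> B \<and> D' \<subseteq> B) \<and>
      \<not> (\<exists>e\<in>D. is_loop G e) \<and> \<not> (\<exists>e\<in>D'. is_loop G e))}"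
  have *: "\<Union>(?U D) = merged j"
    if D: "D \<in> \<tau>" "j \<in> D" for D j
  proof -
    have jA: "j \<in> A" and Dj: "D = block_of \<tau> j"
      using D partition_on_subset[OF \<tau>] block_of_eqI[OF \<tau>] by auto
    show ?thesis
    proof (cases "is_loop G j")
      case True
      then have "(?U D) = {D}" using D by auto
      then show ?thesis using True Dj by (simp add: merged_def)
    next
      case False
      have noloop: "\<not> is_loop G e" if "endpoints G e = endpoints G j" for e
        using False is_loop_cong[OF that] by simp
      have cls: "{f \<in> A. endpoints G f = endpoints G j} \<in> parallel_classes G"
        unfolding parallel_classes_def using jA by (auto simp: A)
      have "\<Union>(?U D) = {i \<in> A. endpoints G i = endpoints G j}"
      proof (intro equalityI subsetI)
        fix i assume "i \<in> \<Union>(?U D)"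
        then obtain D' where D': "D' \<in> \<tau>" "i \<in> D'" "D' = D \<or> (\<exists>B \<in> parallel_classes G. D \<subseteq> B \<and> D' \<subseteq> B)" by blast
        have "endpoints G i = endpoints G j"
          using D'(3)
        proof
          assume "\<exists>B \<in> parallel_classes G. D \<subseteq> B \<and> D' \<subseteq> B"
          then show ?thesis using D D'(2) by (auto simp: parallel_classes_def)
        qed (use D' D parallel in blast)
        then show "i \<in> {i \<in> A. endpoints G i = endpoints G j}"
          using D' partition_on_subset[OF \<tau>] by blast
      next
        fix i assume i: "i \<in> {i \<in> A. endpoints G i = endpoints G j}"
        let ?D' = "block_of \<tau> i"
        have D': "?D' \<in> \<tau>" "i \<in> ?D'" using block_of[OF \<tau>] i by auto
        have sub: "E \<subseteq> {f \<in> A. endpoints G f = endpoints G j}" "\<not> (\<exists>e\<in>E. is_loop G e)"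
          if "E \<in> \<tau>" "k \<in> E" "endpoints G k = endpoints G j" for E k
        proof -
          have "endpoints G e = endpoints G j" if "e \<in> E" for e
            using parallel[OF \<open>E \<in> \<tau>\<close> that \<open>k \<in> E\<close>] \<open>endpoints G k = endpoints G j\<close> by simp
          then show "E \<subseteq> {f \<in> A. endpoints G f = endpoints G j}" "\<not> (\<exists>e\<in>E. is_loop G e)"
            using partition_on_subset[OF \<tau> \<open>E \<in> \<tau>\<close>] noloop by blast+
        qed
        have "?D' \<in> (?U D)"
          using D'(1) cls sub[OF D refl] sub[OF D'] i by blast
        then show "i \<in> \<Union>(?U D)" using D'(2) by blast
      qed
      then show ?thesis using False by (simp add: merged_def)
    qed
  qed
  show ?thesis
  proof (intro equalityI subsetI)
    fix b assume "b \<in> mb"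
    then obtain D where D: "D \<in> \<tau>" and b: "b = \<Union>(?U D)" unfolding merge_nonloops_def by blast
    obtain j where "j \<in> D" "j \<in> A" using partition_on_ex_elem[OF \<tau> D] by blast
    then show "b \<in> merged ` A" using *[OF D] b by blast
  next
    fix b assume "b \<in> merged ` A"
    then obtain j where j: "j \<in> A" "b = merged j" by blast
    show "b \<in> mb"
      unfolding merge_nonloops_def j(2) *[OF block_of[OF \<tau> j(1)], symmetric]
      by (rule imageI) (rule block_of(1)[OF \<tau> j(1)])
  qed
qed

lemma mb_part: "partition_on A mb"
  unfolding mb_eq
proof (rule partition_onI)
  show "\<Union>(merged ` A) = A" using merged_endpoints self_merged by blast
  show "{} \<notin> merged ` A" using self_merged by blast
  fix b b' assume b: "b \<in> merged ` A" "b' \<in> merged ` A" "b \<noteq> b'"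
  then obtain i j where ij: "i \<in> A" "j \<in> A" "b = merged i" "b' = merged j" by blast
  show "disjnt b b'"
  proof (rule ccontr)
    assume "\<not> disjnt b b'"
    then obtain k where "k \<in> merged i" "k \<in> merged j" using ij by (auto simp: disjnt_def)
    then have "b = b'" using merged_eq ij by metis
    with b show False by simp
  qed
qed

lemma block_of_mb: "j \<in> A \<Longrightarrow> block_of mb j = merged j"
  using block_of_eqI[OF mb_part] self_merged mb_eq by blast

text \<open>All edges of a merged block have the same end points, so the union is this common
  set.\<close>

definition ends :: "nat set \<Rightarrow> nat set set" where "ends b = (\<Union>j\<in>b. endpoints G j)"

lemma ends_merged: "j \<in> A \<Longrightarrow> ends (merged j) = endpoints G j"
  using merged_endpoints self_merged unfolding ends_def by blast

lemma s_merged: "j \<in> A \<Longrightarrow> merged (s j) = merged j"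
proof -
  assume j: "j \<in> A"
  have "block_of \<sigma> (s j) = block_of \<sigma> j" using s_block(5)[OF j] s_block(5)[OF s_block(3)[OF j]] s_s by auto
  then have "block_of \<tau> (s j) = block_of \<tau> j" using refines_block_of[OF \<sigma>_\<tau> s_block(3)[OF j] j] by simp
  then have "s j \<in> merged j" using \<tau>_merged[OF j] block_of(2)[OF \<tau> s_block(3)[OF j]] by auto
  then show ?thesis using merged_eq[OF j] by simp
qed

text \<open>The block of \<tau> has size two and contains \<open>s j\<close> besides
  \<open>j\<close>. Being stable under \<open>s\<close>, it cannot meet two components.\<close>

lemma merged_loop: "j \<in> A \<Longrightarrow> is_loop G j \<Longrightarrow> merged j = {j, s j}"
proof -
  assume j: "j \<in> A" "is_loop G j"
  have m: "merged j = block_of \<tau> j" using j by (simp add: merged_def)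
  have c: "card (block_of \<tau> j) = 2" using loop_card block_of[OF \<tau> j(1)] j(2) by blast
  have "s j \<in> merged j" using s_merged[OF j(1)] self_merged[OF s_block(3)[OF j(1)]] by simp
  then have "{j, s j} \<subseteq> block_of \<tau> j" using self_merged[OF j(1)] m by simp
  moreover have "card {j, s j} = 2" using s_block(2)[OF j(1)] by simp
  moreover have "finite (block_of \<tau> j)" using c by (metis card.infinite zero_neq_numeral)
  ultimately show ?thesis using c m by (metis card_subset_eq)
qed

definition adj :: "nat set \<Rightarrow> nat set \<Rightarrow> bool" where "adj W b \<longleftrightarrow> (\<exists>j\<in>W. b = merged j)"

text \<open>Otherwise membership of the component of \<open>i\<close> in \<open>S\<close> would be
  constant on the blocks of \<tau> and on the cycles of \<gamma>, hence on all of \<open>A\<close>,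
  since these connect \<open>A\<close>.\<close>

lemma link:
  assumes S: "S \<subset> Ws" "S \<noteq> {}"
  shows "\<exists>W\<in>S. \<exists>W'\<in>Ws - S. \<exists>b. adj W b \<and> adj W' b"
proof -
  define f where "f i \<longleftrightarrow> block_of Ws i \<in> S" for i
  obtain W W' where W: "W \<in> S" "W' \<in> Ws - S" using S by blast
  then obtain i j where ij: "i \<in> W" "i \<in> A" "j \<in> W'" "j \<in> A"
    using S partition_on_ex_elem[OF Ws_part] by (metis DiffD1 psubsetD)
  have fij: "f i" "\<not> f j" using ij W S W_block by (auto simp: f_def)
  have "\<exists>B\<in>\<tau>. \<exists>u\<in>B. \<exists>v\<in>B. f u \<noteq> f v"
  proof (rule ccontr)
    assume const: "\<not> ?thesis"
    have "f i = f j"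
    proof (rule join_block_constant[OF \<tau> orbit_partition[OF finA \<gamma>_perm]])
      show "A \<in> partition_join A \<tau> (perm_cycles A \<gamma>)" using connected by simp
      fix B u v assume "B \<in> \<tau> \<union> perm_cycles A \<gamma>" "u \<in> B" "v \<in> B"
      then show "f u = f v"
      proof (elim UnE)
        assume "B \<in> perm_cycles A \<gamma>"
        then obtain k where k: "k \<in> A" "B = orbit \<gamma> k" by (auto simp: perm_cycles_def)
        have "block_of Ws (\<gamma> x) = block_of Ws x" for x
          using Ws_\<gamma> permutes_not_in[OF \<gamma>_perm] by (cases "x \<in> A") auto
        then have "block_of Ws x = block_of Ws k" if "x \<in> B" for x
          using orbit_invariant[of "block_of Ws" \<gamma> x k] that k by simp
        then show ?thesis using \<open>u \<in> B\<close> \<open>v \<in> B\<close> by (simp add: f_def)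
      qed (use const in blast)
    qed (use ij in auto)
    then show False using fij by simp
  qed
  then obtain B u v where B: "B \<in> \<tau>" "u \<in> B" "v \<in> B" "f u" "\<not> f v" by blast
  have uv: "u \<in> A" "v \<in> A" using B partition_on_subset[OF \<tau>] by auto
  have "block_of \<tau> u = B" using block_of_eqI[OF \<tau>] B by blast
  then have "v \<in> merged u" using \<tau>_merged[OF uv(1)] B by blast
  then have "merged v = merged u" using merged_eq[OF uv(1)] by simp
  then have "adj (block_of Ws u) (merged u)" "adj (block_of Ws v) (merged u)"
    using block_of(2)[OF Ws_part] uv unfolding adj_def by metis+
  moreover have "block_of Ws v \<in> Ws - S" using B(5) block_of(1)[OF Ws_part uv(2)] by (simp add: f_def)
  ultimately show ?thesis using B(4) unfolding f_def by blast
qed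

sublocale ES: edge_sharing Ws adj ends VW
proof
  fix W assume W: "W \<in> Ws"
  show "finite (VW W)" using W_fin[OF W] by (simp add: VW_def)
  show sub: "ends b \<subseteq> VW W" if "adj W b" for b
  proof -
    obtain j where j: "j \<in> W" "b = merged j" using \<open>adj W b\<close> by (auto simp: adj_def)
    then have "ends b = endpoints G j" using ends_merged W_sub[OF W] by blast
    then show ?thesis using j(1) W_\<gamma>[OF W j(1)] by (auto simp: endpoints_G VW_def)
  qed
  \<comment> \<open>A loop block is contained in one component, so a merged block seen by two
    components consists of non-loops.\<close>
  show "card (ends b) = 2" if W': "W' \<in> Ws" "W \<noteq> W'" "adj W b" "adj W' b" for W' b
  proof -
    obtain i j where ij: "i \<in> W" "b = merged i" "j \<in> W'" "b = merged j" using W'(3,4) by (auto simp: adj_def)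
    have A': "i \<in> A" "j \<in> A" using ij W_sub[OF W] W_sub[OF W'(1)] by auto
    have "\<not> is_loop G i"
    proof
      assume "is_loop G i"
      then have "b = {i, s i}" using merged_loop[OF A'(1)] ij by simp
      moreover have "j \<in> b" using self_merged[OF A'(2)] ij by simp
      ultimately have "j \<in> W" using ij(1) W_s[OF W] by auto
      then show False using W_block[OF W] W_block[OF W'(1) ij(3)] W'(2) by simp
    qed
    then show ?thesis using ends_merged[OF A'(1)] ij(2) card_endpoints_eq_2_iff by metis
  qed
  \<comment> \<open>Merging turns all parallel non-loops into one block, so such a block is
    determined by its end points.\<close>
  show "b = b'" if b: "adj W b" "adj W b'" "card (ends b) = 2" "card (ends b') = 2" "ends b = ends b'" for b b'
  proof -
    obtain i j where ij: "i \<in> A" "b = merged i" "j \<in> A" "b' = merged j"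
      using b(1,2) W_sub[OF W] unfolding adj_def by blast
    then have "\<not> is_loop G i" "\<not> is_loop G j" "endpoints G i = endpoints G j"
      using b(3-5) ends_merged card_endpoints_eq_2_iff by metis+
    then show ?thesis using ij by (simp add: merged_def)
  qed
qed (use finite_Ws Ws_ne link in auto)

lemma card_\<pi>_eq: "int (card \<pi>) = int (\<Sum>W\<in>Ws. card (VW W)) - 2 * (int (card Ws) - 1) - ES.defect Ws"
  unfolding ES.defect_def Union_VW by simp

lemma card_bounds_int:
  defines "S \<equiv> int (\<Sum>W\<in>Ws. card (VW W))"
  shows "int (card \<pi>) = S - 2 * (int (card Ws) - 1) - ES.defect Ws" "0 \<le> ES.defect Ws"
    "S \<le> int (card \<kappa>)" "int (card \<kappa>) + int (length ms) \<le> int (card \<sigma>) + 2 * int (card Ws)"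
proof -
  have "int (card \<kappa> + length ms) \<le> int (card \<sigma> + 2 * card Ws)" using card_\<kappa>_le by (simp only: of_nat_le_iff)
  then show "int (card \<kappa>) + int (length ms) \<le> int (card \<sigma>) + 2 * int (card Ws)" by simp
  show "S \<le> int (card \<kappa>)" unfolding S_def using sum_card_VW_le by (simp only: of_nat_le_iff)
  show "int (card \<pi>) = S - 2 * (int (card Ws) - 1) - ES.defect Ws" unfolding S_def by (rule card_\<pi>_eq)
qed (rule ES.defect_nonneg)

lemma card_\<pi>_le: "int (card \<pi>) + int (length ms) \<le> int (card \<sigma>) + 2"
proof -
  \<comment> \<open>The quantities are replaced by integer variables: \<open>q\<close> for
    \<open>card \<pi>\<close>, \<open>l\<close> for the number of cycles of \<gamma>,
    \<open>t\<close> for \<open>card \<sigma>\<close>, \<open>S\<close> for the sum over the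
    restrictions, \<open>w\<close> for the number of components, \<open>d\<close> for the defect and
    \<open>k\<close> for \<open>card \<kappa>\<close>.\<close>
  have "q + l \<le> t + 2" if "q = S - 2 * (w - 1) - d" "0 \<le> d" "S \<le> k" "k + l \<le> t + 2 * w"
    for q l t S w d k :: int
    using that by (simp add: algebra_simps)
  from this[OF card_bounds_int] show ?thesis .
qed

lemma card_\<pi>_eq_iff: "int (card \<pi>) + int (length ms) = int (card \<sigma>) + 2 \<longleftrightarrow>
    cond_L1 ms \<sigma> \<and> cond_L2 ms \<pi> \<sigma> \<and> ES.defect Ws = 0"
proof -
  have L1: "cond_L1 ms \<sigma> \<longleftrightarrow> int (card \<kappa>) + int (length ms) = int (card \<sigma>) + 2 * int (card Ws)"
    unfolding cond_L1_iff by linarith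
  have L2: "cond_L2 ms \<pi> \<sigma> \<longleftrightarrow> int (\<Sum>W\<in>Ws. card (VW W)) = int (card \<kappa>)"
    unfolding cond_L2_iff sum_card_VW_eq_iff[symmetric] by (simp only: of_nat_eq_iff)
  have "q + l = t + 2 \<longleftrightarrow> k + l = t + 2 * w \<and> S = k \<and> d = 0"
    if "q = S - 2 * (w - 1) - d" "0 \<le> d" "S \<le> k" "k + l \<le> t + 2 * w" for q l t S w d k :: int
    using that by auto
  from this[OF card_bounds_int] show ?thesis unfolding L1 L2 .
qed

end

section \<open>Condition L4: the bipartite graph\<close>

lemma block_of_fibers:
  "i \<in> A \<Longrightarrow> block_of ((\<lambda>i. {j \<in> A. f j = f i}) ` A) i = {j \<in> A. f j = f i}"
  by (rule block_of_eqI[OF partition_on_fibers]) auto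

text \<open>A cycle passes through some white vertex \<open>W0\<close>, entering and leaving by two
  different black vertices. The rest of the cycle links these without \<open>W0\<close>, which
  \<open>tight_no_detour\<close> forbids. The map \<open>k\<close> renames components as white
  vertices.\<close>

lemma (in edge_sharing) tight_acyclic:
  fixes H :: "('k + 'b) ugraph" and k :: "'w \<Rightarrow> 'k"
  assumes tight: "defect Ws = 0" and inj: "inj_on k Ws"
    and edges: "\<And>f. f \<in> uedges H \<Longrightarrow> \<exists>W\<in>Ws. \<exists>b. adj W b \<and> f = {Inr b, Inl (k W)}"
  shows "\<nexists>vs. ugraph_cycle H vs"
proof
  assume "\<exists>vs. ugraph_cycle H vs"
  then obtain vs where vs: "ugraph_cycle H vs" by blast
  define n where "n = length vs"
  \<comment> \<open>Indexing modulo \<open>n\<close> makes all edges of the cycle, including the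
    closing one, of the form \<open>g i\<close>, \<open>g (Suc i)\<close>.\<close>
  define g where "g i = vs ! (i mod n)" for i
  define d :: "'k + 'b \<Rightarrow> 'w + 'b" where "d = map_sum (inv_into Ws k) id"
  have "n = 1 \<or> 3 \<le> n" using vs by (simp add: ugraph_cycle_def n_def)
  then have n0: "0 < n" by auto
  have edge: "\<exists>W\<in>Ws. \<exists>b. adj W b \<and> (g i = Inr b \<and> g (Suc i) = Inl (k W) \<or> g i = Inl (k W) \<and> g (Suc i) = Inr b)" for i
  proof -
    have "{vs ! (i mod n), vs ! (Suc (i mod n) mod n)} \<in> uedges H"
      using vs n0 by (simp add: ugraph_cycle_def n_def)
    then have "{g i, g (Suc i)} \<in> uedges H" by (simp add: g_def mod_Suc_eq)
    from edges[OF this] show ?thesis by (fastforce simp: doubleton_eq_iff)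
  qed
  have "n \<noteq> 1"
  proof
    assume "n = 1"
    then have "g 0 = g (Suc 0)" by (simp add: g_def)
    then show False using edge[of 0] by auto
  qed
  with \<open>n = 1 \<or> 3 \<le> n\<close> have n: "3 \<le> n" by simp
  have ginj: "i mod n = j mod n" if "g i = g j" for i j
    using that vs n0 nth_eq_iff_index_eq[of vs "i mod n" "j mod n"] by (simp add: g_def ugraph_cycle_def n_def)
  obtain i W0 where W0: "g i = Inl (k W0)" "W0 \<in> Ws" using edge[of 0] by blast
  have kinj: "W = W0" if "W \<in> Ws" "k W = k W0" for W using inj that W0(2) by (auto dest: inj_onD)
  obtain W1 b1 where "W1 \<in> Ws" "adj W1 b1" "k W1 = k W0" and b1: "g (Suc i) = Inr b1"
    using edge[of i] W0(1) by auto
  then have adj1: "adj W0 b1" using kinj by blast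
  \<comment> \<open>\<open>i + (n - 1)\<close> is the cyclic predecessor of
    \<open>i\<close>.\<close>
  have "Suc (i + (n - 1)) = i + n" using n0 by simp
  then have "g (Suc (i + (n - 1))) = g i" by (simp add: g_def)
  then obtain W2 b2 where "W2 \<in> Ws" "adj W2 b2" "k W2 = k W0" and b2: "g (i + (n - 1)) = Inr b2"
    using edge[of "i + (n - 1)"] W0(1) by auto
  then have adj2: "adj W0 b2" using kinj by blast
  have far: "(i + t) mod n \<noteq> i mod n" if "0 < t" "t < n" for t
  proof
    assume "(i + t) mod n = i mod n"
    then have "n dvd t" using mod_eq_dvd_iff_nat[of i "i + t" n] by simp
    then show False using that by (auto dest: dvd_imp_le)
  qed
  have "b1 \<noteq> b2"
  proof
    assume "b1 = b2"
    \<comment> \<open>The positions after and before \<open>i\<close> differ by n - 2, which lies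
      strictly between 0 and \<open>n\<close> because n is at least 3.\<close>
    then have "Suc i mod n = (i + (n - 1)) mod n" using ginj b1 b2 by simp
    then have "n dvd (i + (n - 1)) - Suc i" using mod_eq_dvd_iff_nat[of "Suc i" "i + (n - 1)" n] n by simp
    then have "n dvd n - 2" using n by simp
    then show False using n by (auto dest: dvd_imp_le)
  qed
  define R :: "('w + 'b) rel" where "R = {(p, q). \<exists>W\<in>Ws - {W0}. \<exists>b. adj W b \<and> (p = Inl W \<and> q = Inr b \<or> p = Inr b \<and> q = Inl W)}"
  \<comment> \<open>From the successor of \<open>i\<close> round to its predecessor; by
    \<open>far\<close> the index of \<open>W0\<close> is not visited on the way.\<close>
  have path: "(Inr b1, d (g (Suc i + t))) \<in> R\<^sup>*" if "t \<le> n - 2" for t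
    using that
  proof (induction t)
    case 0
    then show ?case using b1 by (simp add: d_def)
  next
    case (Suc t)
    obtain W b where W: "W \<in> Ws" "adj W b" and gg: "g (Suc i + t) = Inr b \<and> g (Suc (Suc i + t)) = Inl (k W) \<or>
        g (Suc i + t) = Inl (k W) \<and> g (Suc (Suc i + t)) = Inr b" using edge[of "Suc i + t"] by blast
    have "W \<noteq> W0"
    proof
      assume "W = W0"
      then have "g (i + (t + 1)) = g i \<or> g (i + (t + 2)) = g i" using gg W0(1) by auto
      then have "(i + (t + 1)) mod n = i mod n \<or> (i + (t + 2)) mod n = i mod n" using ginj by blast
      then show False using far[of "t + 1"] far[of "t + 2"] Suc.prems n by auto
    qed
    moreover have "d (Inl (k W)) = Inl W" using inv_into_f_f[OF inj W(1)] by (simp add: d_def)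
    ultimately have "(d (g (Suc i + t)), d (g (Suc (Suc i + t)))) \<in> R"
      using gg W unfolding R_def by (auto simp: d_def)
    moreover have "(Inr b1, d (g (Suc i + t))) \<in> R\<^sup>*" using Suc by simp
    ultimately show ?case by (simp add: rtrancl.rtrancl_into_rtrancl)
  qed
  have "Suc i + (n - 2) = i + (n - 1)" using n by simp
  then have "d (g (Suc i + (n - 2))) = Inr b2" using b2 by (simp only: d_def map_sum.simps id_apply)
  then have "(Inr b1, Inr b2) \<in> R\<^sup>*" using path[of "n - 2"] by (simp only: order_refl)
  then show False using tight_no_detour[OF tight W0(2) adj1 adj2 \<open>b1 \<noteq> b2\<close> R_def] by blast
qed

context opposite_setting
begin

lemma W_constant:
  assumes "\<And>i. i \<in> A \<Longrightarrow> f (\<gamma> i) = f i" "\<And>i. i \<in> A \<Longrightarrow> f (s i) = f i"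
    and W: "W \<in> Ws" "i \<in> W" "j \<in> W"
  shows "f i = f j"
proof (rule join_block_constant[OF \<sigma>_part orbit_partition[OF finA \<gamma>_perm] _ W])
  fix B u v assume B: "B \<in> \<sigma> \<union> perm_cycles A \<gamma>" "u \<in> B" "v \<in> B"
  from B(1) show "f u = f v"
  proof
    assume "B \<in> \<sigma>"
    then have "u \<in> A" "B = block_of \<sigma> u"
      using B partition_on_subset[OF \<sigma>_part] block_of_eqI[OF \<sigma>_part] by auto
    then have "v = u \<or> v = s u" using B(3) s_block(5) by simp
    then show ?thesis using assms(2)[OF \<open>u \<in> A\<close>] by auto
  next
    assume "B \<in> perm_cycles A \<gamma>"
    then obtain k where k: "B = orbit \<gamma> k" by (auto simp: perm_cycles_def)
    have inv: "f (\<gamma> x) = f x" for x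
      using assms(1) permutes_not_in[OF \<gamma>_perm] by (cases "x \<in> A") auto
    have "f u = f k" "f v = f k" using B(2,3) k by (auto intro: orbit_invariant[of f \<gamma>, OF inv])
    then show ?thesis by simp
  qed
qed

lemma verts_K: "verts K = \<kappa>"
  using partition_eq_image_block_of[OF \<kappa>_part] by (simp add: A)

text \<open>An edge of \<open>K\<close> never leaves its \<open>W\<close>. Conversely, the set of
  vertices reachable from the cycle of \<open>i\<close> is a label invariant under \<gamma>, because
  \<gamma> runs along edges, and under \<open>s\<close> by \<open>\<kappa>_step\<close>; so it is
  constant on \<open>W\<close>.\<close>

lemma components_K: "components_of K = sub ` Ws"
proof -
  let ?X = "with_proj (mk_symmetric K)"
  define E where "E = (\<Union>j\<in>A. {(block_of \<kappa> (\<gamma> j), block_of \<kappa> j), (block_of \<kappa> j, block_of \<kappa> (\<gamma> j))})"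
  have "arcs_ends ?X = parcs (mk_symmetric K)" by (simp add: arcs_ends_def arc_to_ends_def)
  also have "\<dots> = E" by (simp add: mk_symmetric_def E_def A \<gamma>)
  finally have reach: "reachable ?X C C' \<longleftrightarrow> (C, C') \<in> rtrancl_on \<kappa> E" for C C'
    using verts_K by (simp add: reachable_def mk_symmetric_def)
  have stay: "C' \<in> sub W" if "(C, C') \<in> rtrancl_on \<kappa> E" "W \<in> Ws" "C \<in> sub W" for C C' W
    using that
  proof (induction rule: converse_rtrancl_on_induct)
    case (step C1 C2)
    then obtain j where j: "j \<in> A" "C1 = block_of \<kappa> (\<gamma> j) \<and> C2 = block_of \<kappa> j \<or> C1 = block_of \<kappa> j \<and> C2 = block_of \<kappa> (\<gamma> j)"
      by (auto simp: E_def)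
    have "C1 \<subseteq> W" using step sub_eq[of W] by blast
    then have "j \<in> W \<or> \<gamma> j \<in> W" using j block_of(2)[OF \<kappa>_part] \<gamma>_in by blast
    then have "j \<in> W" "\<gamma> j \<in> W"
      using Ws_\<gamma>[OF j(1)] in_W_iff[OF step.prems(1) j(1)] in_W_iff[OF step.prems(1) \<gamma>_in[OF j(1)]] by auto
    then have "C2 \<in> sub W" using j by (auto simp: sub_def)
    then show ?case by (rule step.IH[OF step.prems(1)])
  qed simp
  have conn: "(C, C') \<in> rtrancl_on \<kappa> E" if CC: "W \<in> Ws" "C \<in> sub W" "C' \<in> sub W" for W C C'
  proof -
    define f where "f i = {C'. (block_of \<kappa> i, C') \<in> rtrancl_on \<kappa> E}" for i
    obtain i j where ij: "i \<in> W" "C = block_of \<kappa> i" "j \<in> W" "C' = block_of \<kappa> j" using CC by (auto simp: sub_def)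
    have \<gamma>: "f (\<gamma> i) = f i" if "i \<in> A" for i
    proof -
      have "(block_of \<kappa> (\<gamma> i), block_of \<kappa> i) \<in> E" "(block_of \<kappa> i, block_of \<kappa> (\<gamma> i)) \<in> E"
        using that by (auto simp: E_def)
      moreover have "block_of \<kappa> i \<in> \<kappa>" "block_of \<kappa> (\<gamma> i) \<in> \<kappa>" using block_of(1)[OF \<kappa>_part] that \<gamma>_in by auto
      ultimately show ?thesis
        unfolding f_def by (auto intro: converse_rtrancl_on_into_rtrancl_on)
    qed
    moreover have "f (s i) = f i" if "i \<in> A" for i
      using \<gamma>[OF that] \<kappa>_step[OF that] by (simp add: f_def)
    ultimately have "f i = f j" using W_constant[of f W i j] CC(1) ij by blast
    moreover have "C' \<in> f j" using ij CC(3) sub_eq[OF CC(1)] by (auto simp: f_def)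
    ultimately have "C' \<in> f i" by simp
    then show ?thesis using ij(2) by (simp add: f_def)
  qed
  have in_sub: "\<exists>W\<in>Ws. C \<in> sub W" if C: "C \<in> \<kappa>" for C
  proof -
    obtain i where i: "i \<in> A" "i \<in> C" using partition_on_ex_elem[OF \<kappa>_part C] by blast
    then have "C = block_of \<kappa> i" using block_of_eqI[OF \<kappa>_part C] by simp
    then show ?thesis using block_of[OF Ws_part i(1)] by (auto simp: sub_def)
  qed
  have ne: "sub W \<noteq> {}" if "W \<in> Ws" for W
    using that Ws_part by (auto simp: sub_def partition_on_def)
  have "{S. S \<noteq> {} \<and> (\<forall>u\<in>S. \<forall>v\<in>S. (u, v) \<in> rtrancl_on \<kappa> E) \<and>
      (\<forall>u\<in>S. \<forall>v. v \<notin> S \<longrightarrow> (u, v) \<notin> rtrancl_on \<kappa> E \<or> (v, u) \<notin> rtrancl_on \<kappa> E)}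
      = sub ` Ws" (is "?L = _")
  proof (intro equalityI subsetI)
    fix S assume "S \<in> ?L"
    then have S: "S \<noteq> {}" "\<And>u v. u \<in> S \<Longrightarrow> v \<in> S \<Longrightarrow> (u, v) \<in> rtrancl_on \<kappa> E"
      "\<And>u v. u \<in> S \<Longrightarrow> (u, v) \<in> rtrancl_on \<kappa> E \<Longrightarrow> (v, u) \<in> rtrancl_on \<kappa> E \<Longrightarrow> v \<in> S" by blast+
    then obtain u where u: "u \<in> S" by blast
    have "u \<in> \<kappa>" using in_rtrancl_on_in_F[OF S(2)[OF u u]] by simp
    then obtain W where W: "W \<in> Ws" "u \<in> sub W" using in_sub by blast
    have "S = sub W"
    proof (intro equalityI subsetI)
      fix v assume "v \<in> S"
      then show "v \<in> sub W" using stay[OF S(2)[OF u] W] by blast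
    next
      fix v assume "v \<in> sub W"
      then show "v \<in> S" using S(3)[OF u] conn[OF W(1)] W(2) by blast
    qed
    then show "S \<in> sub ` Ws" using W(1) by blast
  next
    fix S assume "S \<in> sub ` Ws"
    then obtain W where W: "W \<in> Ws" "S = sub W" by blast
    have "S \<noteq> {}" using W ne by simp
    moreover have "\<forall>u\<in>S. \<forall>v\<in>S. (u, v) \<in> rtrancl_on \<kappa> E" using conn W by blast
    moreover have "\<forall>u\<in>S. \<forall>v. v \<notin> S \<longrightarrow> (u, v) \<notin> rtrancl_on \<kappa> E \<or> (v, u) \<notin> rtrancl_on \<kappa> E"
      using stay W by blast
    ultimately show "S \<in> ?L" by simp
  qed
  then show ?thesis unfolding components_of_def pre_digraph.sccs_verts_def reach .
qed

abbreviation H :: "(nat set set + nat set) ugraph" where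
  "H \<equiv> elementarization (merge_black mb (bipartite_graph ms \<kappa> \<sigma> \<tau>))"

lemma sub_inj: "inj_on sub Ws"
  by (rule inj_onI) (metis Union_sub)

lemma the_merged: "j \<in> A \<Longrightarrow> (THE b. b \<in> mb \<and> block_of \<tau> j \<subseteq> b) = merged j"
proof (rule the_equality)
  assume j: "j \<in> A"
  show "merged j \<in> mb \<and> block_of \<tau> j \<subseteq> merged j" using j mb_eq \<tau>_merged by blast
  fix b assume b: "b \<in> mb \<and> block_of \<tau> j \<subseteq> b"
  then have "j \<in> b" using block_of(2)[OF \<tau> j] by blast
  then have "block_of mb j = b" using block_of_eqI[OF mb_part] b by blast
  then show "b = merged j" using block_of_mb[OF j] by simp
qed

lemma the_component: "j \<in> A \<Longrightarrow> (THE S. S \<in> components_of K \<and> head K j \<in> S) = sub (block_of Ws j)"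
proof (rule the_equality)
  assume j: "j \<in> A"
  show "sub (block_of Ws j) \<in> components_of K \<and> head K j \<in> sub (block_of Ws j)"
    using block_of[OF Ws_part j] by (simp add: components_K sub_def)
  fix S assume S: "S \<in> components_of K \<and> head K j \<in> S"
  then obtain W where W: "W \<in> Ws" "S = sub W" "block_of \<kappa> j \<in> sub W" unfolding components_K by auto
  then have "j \<in> W" using sub_eq[OF W(1)] block_of(2)[OF \<kappa>_part j] by blast
  then show "S = sub (block_of Ws j)" using W_block[OF W(1)] W(2) by simp
qed

lemma uverts_H: "uverts H = Inl ` sub ` Ws \<union> Inr ` mb"
proof -
  have "(\<lambda>D. THE B. B \<in> mb \<and> D \<subseteq> B) ` \<tau> = mb"
  proof -
    have "(\<lambda>D. THE B. B \<in> mb \<and> D \<subseteq> B) ` block_of \<tau> ` A = merged ` A"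
      unfolding image_image by (rule image_cong) (simp_all add: the_merged)
    then show ?thesis using partition_eq_image_block_of[OF \<tau>] mb_eq by simp
  qed
  note * = this
  let ?t = "\<lambda>D. THE B. B \<in> mb \<and> D \<subseteq> B"
  have "uverts H = map_sum id ?t ` (Inl ` components_of K \<union> Inr ` \<tau>)"
    by (simp add: elementarization_def merge_black_def identify_verts_def bipartite_graph_def)
  also have "\<dots> = Inl ` components_of K \<union> Inr ` ?t ` \<tau>"
    by (simp add: image_Un image_image)
  finally show ?thesis unfolding * components_K .
qed

lemma endpoints_H:
  assumes "j \<in> A" "Min B = j"
  shows "endpoints (merge_black mb (bipartite_graph ms \<kappa> \<sigma> \<tau>)) B = {Inr (merged j), Inl (sub (block_of Ws j))}"
  using the_merged[OF assms(1)] the_component[OF assms(1)] assms(2)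
  by (simp add: endpoints_def merge_black_def identify_verts_def bipartite_graph_def)

text \<open>An edge of \<sigma> is represented by its minimum, which may be \<open>j\<close> or
  \<open>s j\<close>; both lie in the same component and in the same merged block. So
  \<open>H\<close> is the incidence graph of \<open>adj\<close>.\<close>

lemma uedges_H: "uedges H = {f. \<exists>W\<in>Ws. \<exists>b. adj W b \<and> f = {Inr b, Inl (sub W)}}"
proof -
  let ?M = "merge_black mb (bipartite_graph ms \<kappa> \<sigma> \<tau>)"
  have "uedges H = endpoints ?M ` \<sigma>"
    by (simp add: elementarization_def merge_black_def identify_verts_def bipartite_graph_def)
  also have "\<dots> = {f. \<exists>W\<in>Ws. \<exists>b. adj W b \<and> f = {Inr b, Inl (sub W)}}"
  proof (intro equalityI subsetI)
    fix f assume "f \<in> endpoints ?M ` \<sigma>"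
    then obtain B where B: "B \<in> \<sigma>" "f = endpoints ?M B" by blast
    have "card B = 2" using \<sigma>_two B(1) by blast
    then have "Min B \<in> B" by (intro Min_in) (auto simp: card_eq_0_iff intro: ccontr)
    then have j: "Min B \<in> A" using partition_on_subset[OF \<sigma>_part B(1)] by blast
    have "adj (block_of Ws (Min B)) (merged (Min B))" using block_of(2)[OF Ws_part j] by (auto simp: adj_def)
    then show "f \<in> {f. \<exists>W\<in>Ws. \<exists>b. adj W b \<and> f = {Inr b, Inl (sub W)}}"
      using endpoints_H[OF j refl] B(2) block_of(1)[OF Ws_part j] by blast
  next
    fix f :: "(nat set set + nat set) set"
    assume "f \<in> {f. \<exists>W\<in>Ws. \<exists>b. adj W b \<and> f = {Inr b, Inl (sub W)}}"
    then obtain W j where W: "W \<in> Ws" "j \<in> W" "f = {Inr (merged j), Inl (sub W)}" by (auto simp: adj_def)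
    have j: "j \<in> A" using W W_sub by blast
    have B: "{j, s j} \<in> \<sigma>" using s_block(1)[OF j] .
    define i where "i = Min {j, s j}"
    have "i = j \<or> i = s j" by (auto simp: i_def min_def)
    then have i: "i \<in> A" "merged i = merged j" "block_of Ws i = W"
      using s_block(3)[OF j] s_merged[OF j] Ws_s[OF j] W_block[OF W(1,2)] j by auto
    have "f = endpoints ?M {j, s j}" using endpoints_H[OF i(1), of "{j, s j}"] i W(3) by (simp add: i_def)
    then show "f \<in> endpoints ?M ` \<sigma>" using B by blast
  qed
  finally show ?thesis .
qed

text \<open>Connectedness is automatic here, inherited from \<open>link\<close> by growing a set of
  components; the content of L4 is therefore acyclicity.\<close>

lemma H_connected: "ugraph_connected H"
proof -
  let ?R = "{(a, b). {a, b} \<in> uedges H}"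
  have sym: "sym (?R\<^sup>*)" by (intro sym_rtrancl) (auto simp: sym_def insert_commute)
  obtain W0 where W0: "W0 \<in> Ws" using Ws_ne by blast
  have step: "(Inl (sub W), Inr b) \<in> ?R" "(Inr b, Inl (sub W)) \<in> ?R" if "W \<in> Ws" "adj W b" for W b
    using that by (auto simp: uedges_H insert_commute)
  have "\<forall>W\<in>Ws. (Inl (sub W0), Inl (sub W)) \<in> ?R\<^sup>*"
  proof (rule ES.grow_induct[of "{W0}" "\<lambda>S. \<forall>W\<in>S. (Inl (sub W0), Inl (sub W)) \<in> ?R\<^sup>*"])
    fix S W W' b
    assume S: "S \<subseteq> Ws" "W \<in> Ws - S" "W' \<in> S" "adj W b" "adj W' b"
      "\<forall>W\<in>S. (Inl (sub W0), Inl (sub W)) \<in> ?R\<^sup>*"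
    have "(Inl (sub W0), Inl (sub W')) \<in> ?R\<^sup>*" using S by blast
    also have "(Inl (sub W'), Inr b) \<in> ?R" using step S by blast
    also have "(Inr b, Inl (sub W)) \<in> ?R" using step S by blast
    finally show "\<forall>W\<in>insert W S. (Inl (sub W0), Inl (sub W)) \<in> ?R\<^sup>*" using S(6) by blast
  qed (use W0 in auto)
  then have white: "(Inl (sub W0), Inl (sub W)) \<in> ?R\<^sup>*" if "W \<in> Ws" for W using that by blast
  have "(Inl (sub W0), v) \<in> ?R\<^sup>*" if v: "v \<in> uverts H" for v
  proof -
    consider W where "W \<in> Ws" "v = Inl (sub W)" | j where "j \<in> A" "v = Inr (merged j)"
      using v[unfolded uverts_H] mb_eq by blast
    then show ?thesis
    proof cases
      case 2
      have "adj (block_of Ws j) (merged j)" using block_of(2)[OF Ws_part 2(1)] by (auto simp: adj_def)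
      then show ?thesis
        using step(1) white[OF block_of(1)[OF Ws_part 2(1)]] block_of(1)[OF Ws_part 2(1)] 2(2)
        by (meson rtrancl.rtrancl_into_rtrancl)
    qed (use white in blast)
  qed
  then show ?thesis
    unfolding ugraph_connected_def
    using W0 uverts_H symD[OF sym] by (blast intro: rtrancl_trans)
qed

lemma tight_cond_L4: "ES.defect Ws = 0 \<Longrightarrow> cond_L4 ms \<pi> \<tau> \<sigma>"
  unfolding cond_L4_def ugraph_tree_def
  using H_connected ES.tight_acyclic[OF _ sub_inj, of H] uedges_H by blast

end

context opposite_setting
begin

section \<open>Condition L3: gluing along edges, and the criterion for equality\<close>

definition edges :: "nat set set set" where "edges = endpoints K ` A"

lemma edges_eq: "uedges (elementarization K) = edges"
  unfolding edges_def by (simp add: elementarization_def A)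

lemma edgeE:
  assumes "e \<in> edges"
  obtains W j where "W \<in> Ws" "j \<in> W" "j \<in> A" "e = endpoints K j" "e \<subseteq> sub W"
proof -
  obtain j where j: "j \<in> A" "e = endpoints K j" using assms by (auto simp: edges_def)
  have W: "block_of Ws j \<in> Ws" "j \<in> block_of Ws j" using block_of[OF Ws_part j(1)] by auto
  have "e \<subseteq> sub (block_of Ws j)" using j(2) W_\<gamma>[OF W] W(2) by (auto simp: endpoints_K sub_def)
  then show thesis using that W j by blast
qed

lemma edge_subset_\<kappa>: "e \<in> edges \<Longrightarrow> e \<subseteq> \<kappa>"
  by (elim edgeE) (use sub_eq in blast)

lemma finite_edges: "finite edges" by (simp add: edges_def finA)

lemma separated_inj_edge: "separated \<Longrightarrow> e \<in> edges \<Longrightarrow> inj_on \<phi> e"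
  unfolding separated_def by (elim edgeE) (blast intro: inj_on_subset)

lemma subset_iff_\<phi>: "C \<in> \<kappa> \<Longrightarrow> P \<in> \<pi> \<Longrightarrow> C \<subseteq> P \<longleftrightarrow> \<phi> C = P"
proof -
  assume C: "C \<in> \<kappa>" and P: "P \<in> \<pi>"
  then obtain i where i: "i \<in> A" "C = block_of \<kappa> i" using partition_eq_image_block_of[OF \<kappa>_part] by blast
  show ?thesis
  proof
    assume "C \<subseteq> P"
    then have "i \<in> P" using i block_of(2)[OF \<kappa>_part i(1)] by blast
    then show "\<phi> C = P" using block_of_eqI[OF \<pi> P] \<phi>_block i by simp
  next
    assume "\<phi> C = P"
    then show "C \<subseteq> P" using refines_block_subset[OF \<kappa>_\<pi> i(1)] \<phi>_block i by simp
  qed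
qed

lemma \<phi>_image: "\<phi> ` \<kappa> = \<pi>"
proof -
  have "\<phi> ` block_of \<kappa> ` A = block_of \<pi> ` A"
    unfolding image_image by (rule image_cong) (simp_all add: \<phi>_block)
  then show ?thesis
    using partition_eq_image_block_of[OF \<pi>] partition_eq_image_block_of[OF \<kappa>_part] by simp
qed

text \<open>A cycle lies in a block of \<pi> exactly when \<phi> sends it there, so \<pi> as a
  partition of the vertices of \<open>K\<close> consists of the fibres of \<phi>.\<close>

lemma partition_of_blocks_eq: "partition_of_blocks \<kappa> \<pi> = (\<lambda>C. {C' \<in> \<kappa>. \<phi> C' = \<phi> C}) ` \<kappa>"
proof -
  have "{C \<in> \<kappa>. C \<subseteq> P} = {C \<in> \<kappa>. \<phi> C = P}" if "P \<in> \<pi>" for P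
    using subset_iff_\<phi> that by blast
  then have "partition_of_blocks \<kappa> \<pi> = (\<lambda>P. {C \<in> \<kappa>. \<phi> C = P}) ` \<phi> ` \<kappa>"
    unfolding partition_of_blocks_def \<phi>_image by simp
  then show ?thesis by (simp add: image_image)
qed

abbreviation \<pi>\<kappa> :: "nat set set set" where "\<pi>\<kappa> \<equiv> partition_of_blocks \<kappa> \<pi>"

lemmas blocks_part = partition_on_fibers[of \<kappa> \<phi>, folded partition_of_blocks_eq]
lemmas block_of_blocks = block_of_fibers[of _ \<kappa> \<phi>, folded partition_of_blocks_eq]

lemma finite_\<kappa>: "finite \<kappa>" by (rule finite_elements[OF finA \<kappa>_part])

lemma card_blocks: "card \<pi>\<kappa> = card \<pi>"
  unfolding partition_of_blocks_eq card_fibers[OF finite_\<kappa>] \<phi>_image ..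

lemma quotient_iff: "cond_L3 ms \<pi> \<sigma> \<longleftrightarrow>
  (\<exists>\<rho> x y. partition_on edges \<rho> \<and> (\<forall>e\<in>edges. card e = 1 \<longrightarrow> {e} \<in> \<rho>) \<and>
     (\<forall>e\<in>edges. e = {x e, y e}) \<and> glues_edges \<rho> x y \<pi>\<kappa> \<and>
     (\<forall>Q. partition_on \<kappa> Q \<and> glues_edges \<rho> x y Q \<longrightarrow> refines \<kappa> \<pi>\<kappa> Q))"
  unfolding cond_L3_def quotient_along_nonloops_def Let_def verts_K edges_eq A[symmetric]
  using \<kappa>_\<pi> blocks_part by simp

text \<open>Edges of \<open>K\<close> are glued when they have the same image in \<open>G\<close>; the functions \<open>c1\<close> and \<open>c2\<close>
  order the end points of each image edge, so that the labellings are compatible.\<close>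

lemma tight_cond_L3:
  assumes sep: separated and tight: "ES.defect Ws = 0"
  shows "cond_L3 ms \<pi> \<sigma>"
proof -
  \<comment> \<open>Two edges are glued iff \<open>g\<close> agrees on them; the tag
    \<open>Inl\<close> keeps each loop in a class of its own, as L3 demands.\<close>
  define g where "g e = (if card e = 1 then Inl e else Inr (\<phi> ` e))" for e :: "nat set set"
  define \<rho> where "\<rho> = (\<lambda>e. {e' \<in> edges. g e' = g e}) ` edges"
  define c1 where "c1 P = (SOME p. \<exists>q. P = {p, q})" for P :: "nat set set"
  define c2 where "c2 P = (SOME q. P = {c1 P, q})" for P :: "nat set set"
  have c: "P = {c1 P, c2 P}" if P: "\<exists>p q. P = {p, q}" for P
  proof -
    have "\<exists>q. P = {c1 P, q}" unfolding c1_def by (rule someI_ex[OF P])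
    then show ?thesis unfolding c2_def by (rule someI_ex)
  qed
  define x where "x e = (SOME C. C \<in> e \<and> \<phi> C = c1 (\<phi> ` e))" for e
  define y where "y e = (SOME C. C \<in> e \<and> \<phi> C = c2 (\<phi> ` e))" for e
  have ce: "\<phi> ` e = {c1 (\<phi> ` e), c2 (\<phi> ` e)}" if "e \<in> edges" for e
    by (rule c) (use that in \<open>auto simp: edges_def endpoints_def\<close>)
  have x: "x e \<in> e \<and> \<phi> (x e) = c1 (\<phi> ` e)" if "e \<in> edges" for e
    unfolding x_def by (rule someI_ex) (use ce[OF that] in \<open>metis imageE insertI1\<close>)
  have y: "y e \<in> e \<and> \<phi> (y e) = c2 (\<phi> ` e)" if "e \<in> edges" for e
    unfolding y_def by (rule someI_ex) (use ce[OF that] in \<open>metis imageE insertI1 insert_commute\<close>)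
  \<comment> \<open>The labels \<open>x e\<close> and \<open>y e\<close> exhaust \<open>e\<close>
    because \<phi> is injective on an edge, which lies in one component.\<close>
  have exy: "e = {x e, y e}" if e: "e \<in> edges" for e
  proof
    show "{x e, y e} \<subseteq> e" using x[OF e] y[OF e] by simp
    show "e \<subseteq> {x e, y e}"
    proof
      fix C assume C: "C \<in> e"
      then have "\<phi> C \<in> \<phi> ` e" by blast
      then have "\<phi> C = \<phi> (x e) \<or> \<phi> C = \<phi> (y e)" using ce[OF e] x[OF e] y[OF e] by (metis insertE singletonD)
      then show "C \<in> {x e, y e}"
        using inj_onD[OF separated_inj_edge[OF sep e]] C x[OF e] y[OF e] by blast
    qed
  qed
  have part: "partition_on edges \<rho>" unfolding \<rho>_def by (rule partition_on_fibers)
  have loops: "{e} \<in> \<rho>" if e: "e \<in> edges" "card e = 1" for e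
  proof -
    have "{e' \<in> edges. g e' = g e} = {e}" using e by (auto simp: g_def)
    moreover have "{e' \<in> edges. g e' = g e} \<in> \<rho>" unfolding \<rho>_def using e(1) by (rule imageI)
    ultimately show ?thesis by simp
  qed
  have same: "\<phi> ` e = \<phi> ` e'" if B: "B \<in> \<rho>" "2 \<le> card B" "e \<in> B" "e' \<in> B" for B e e'
  proof -
    obtain e0 where e0: "e0 \<in> edges" "B = {e' \<in> edges. g e' = g e0}" using B(1) by (auto simp: \<rho>_def)
    have "card e0 \<noteq> 1"
    proof
      assume 1: "card e0 = 1"
      then have "B \<subseteq> {e0}" using e0 by (auto simp: g_def split: if_splits)
      then have "card B \<le> 1" using card_mono[of "{e0}" B] by simp
      then show False using B(2) by simp
    qed
    then show ?thesis using B(3,4) e0 by (auto simp: g_def split: if_splits)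
  qed
  have \<rho>_edges: "e \<in> edges" if "B \<in> \<rho>" "e \<in> B" for B e using that by (auto simp: \<rho>_def)
  have glue: "glues_edges \<rho> x y \<pi>\<kappa>"
    unfolding glues_edges_def
  proof (intro ballI impI)
    fix B assume B: "B \<in> \<rho>" "2 \<le> card B"
    then obtain e where e: "e \<in> B" by (metis card.empty ex_in_conv not_numeral_le_zero)
    have xk: "x e' \<in> \<kappa>" "y e' \<in> \<kappa>" if "e' \<in> B" for e'
      using x y edge_subset_\<kappa> \<rho>_edges[OF B(1) that] by blast+
    have "\<phi> (x e') = \<phi> (x e)" "\<phi> (y e') = \<phi> (y e)" if "e' \<in> B" for e'
      using x[OF \<rho>_edges[OF B(1) e]] x[OF \<rho>_edges[OF B(1) that]]
        y[OF \<rho>_edges[OF B(1) e]] y[OF \<rho>_edges[OF B(1) that]] same[OF B e that] by simp_all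
    then have "x ` B \<subseteq> {C' \<in> \<kappa>. \<phi> C' = \<phi> (x e)}" "y ` B \<subseteq> {C' \<in> \<kappa>. \<phi> C' = \<phi> (y e)}" using xk by auto
    then show "(\<exists>C\<in>\<pi>\<kappa>. x ` B \<subseteq> C) \<and> (\<exists>C\<in>\<pi>\<kappa>. y ` B \<subseteq> C)"
      unfolding partition_of_blocks_eq using xk[OF e] by blast
  qed
  have min: "refines \<kappa> \<pi>\<kappa> Q" if Q: "partition_on \<kappa> Q" "glues_edges \<rho> x y Q" for Q
  proof (rule refinesI_block_of[OF blocks_part Q(1)])
    have glueQ: "block_of Q (x e) = block_of Q (x e') \<and> block_of Q (y e) = block_of Q (y e')"
      if B: "B \<in> \<rho>" "2 \<le> card B" "e \<in> B" "e' \<in> B" for B e e'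
    proof -
      obtain C1 C2 where C: "C1 \<in> Q" "x ` B \<subseteq> C1" "C2 \<in> Q" "y ` B \<subseteq> C2"
        using Q(2) B(1,2) unfolding glues_edges_def by blast
      then have "x e \<in> C1" "x e' \<in> C1" "y e \<in> C2" "y e' \<in> C2" using B by auto
      then show ?thesis using block_of_eqI[OF Q(1)] C by metis
    qed
    \<comment> \<open>On the components added so far, vertices identified by \<pi> are identified by
      \<open>Q\<close>. For all of \<open>Ws\<close> this is the minimality of \<pi>.\<close>
    let ?P = "\<lambda>S. \<forall>C\<in>\<Union>(sub ` S). \<forall>C'\<in>\<Union>(sub ` S). \<phi> C = \<phi> C' \<longrightarrow> block_of Q C = block_of Q C'"
    have "?P Ws"
    proof (rule ES.tight_induct[OF tight, of ?P])
      show "?P {W}"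
        if "W \<in> Ws" for W
        using separatedD[OF sep that] by auto
    next
      fix S W W' b
      assume S: "S \<subseteq> Ws" "W \<in> Ws - S" "W' \<in> S" "adj W b" "adj W' b" "card (ends b) = 2"
        and inter: "VW W \<inter> \<Union>(VW ` S) = ends b"
        and IH: "?P S"
      have W: "W \<in> Ws" "W' \<in> Ws" using S by auto
      obtain j j' where j: "j \<in> W" "b = merged j" "j' \<in> W'" "b = merged j'" using S(4,5) unfolding adj_def by blast
      have jA: "j \<in> A" "j' \<in> A" using j W_sub[OF W(1)] W_sub[OF W(2)] by auto
      define e where "e = endpoints K j"
      define e' where "e' = endpoints K j'"
      have ee: "e \<in> edges" "e' \<in> edges" using jA by (auto simp: e_def e'_def edges_def)
      have im: "\<phi> ` e = ends b" "\<phi> ` e' = ends b"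
        unfolding e_def e'_def \<phi>_endpoints[OF jA(1)] \<phi>_endpoints[OF jA(2)]
        using ends_merged[OF jA(1)] ends_merged[OF jA(2)] j(2,4) by metis+
      have sub: "e \<subseteq> sub W" "e' \<subseteq> sub W'"
        using j W_\<gamma>[OF W(1) j(1)] W_\<gamma>[OF W(2) j(3)] by (auto simp: e_def e'_def endpoints_K sub_def)
      have "card e = 2" "card e' = 2"
        using card_image[OF separated_inj_edge[OF sep ee(1)]] card_image[OF separated_inj_edge[OF sep ee(2)]]
          im S(6) by simp_all
      then have "g e = g e'" by (simp add: g_def im)
      \<comment> \<open>They lie in different components. This makes their class have at least two
        elements, and only such classes are glued by \<open>Q\<close>.\<close>
      have "e \<noteq> e'"
      proof
        assume "e = e'"
        moreover obtain C where "C \<in> e" using \<open>card e = 2\<close> by fastforce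
        ultimately have "C \<in> sub W" "C \<in> sub W'" using sub by auto
        then have C: "C \<in> \<kappa>" "C \<subseteq> W" "C \<subseteq> W'" using sub_eq W by auto
        obtain i where "i \<in> C" using partition_on_ex_elem[OF \<kappa>_part C(1)] by blast
        then have "i \<in> W" "i \<in> W'" using C by auto
        then have "W = W'" using W_block[OF W(1)] W_block[OF W(2)] by blast
        then show False using S by blast
      qed
      define B where "B = {e' \<in> edges. g e' = g e}"
      have B: "B \<in> \<rho>" "e \<in> B" "e' \<in> B" using ee \<open>g e = g e'\<close> by (auto simp: B_def \<rho>_def)
      have "card {e, e'} \<le> card B"
        by (rule card_mono) (use B finite_edges in \<open>auto simp: B_def\<close>)
      then have B2: "2 \<le> card B" using \<open>e \<noteq> e'\<close> by simp
      note xy = glueQ[OF B(1) B2 B(2,3)]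
      \<comment> \<open>By tightness \<open>W\<close> meets the earlier components only in the two
        end points of the shared edge. Hence \<open>C\<close> is an end of \<open>e\<close>, which
        \<open>Q\<close> glues to the matching end of \<open>e'\<close>, and the induction
        hypothesis leads on to \<open>C'\<close>.\<close>
      have cross: "block_of Q C = block_of Q C'"
        if C: "C \<in> sub W" "C' \<in> \<Union>(sub ` S)" "\<phi> C = \<phi> C'" for C C'
      proof -
        have "\<phi> C \<in> VW W" using C(1) VW_eq[OF W(1)] by blast
        moreover have "\<phi> C \<in> \<Union>(VW ` S)"
        proof -
          obtain U where U: "U \<in> S" "C' \<in> sub U" using C(2) by blast
          then have "\<phi> C' \<in> VW U" using VW_eq[of U] S(1) by blast
          then show ?thesis using U(1) C(3) by auto
        qed
        ultimately have "\<phi> C \<in> {c1 (\<phi> ` e), c2 (\<phi> ` e)}" using inter im(1) ce[OF ee(1)] by blast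
        then have cases: "\<phi> C = \<phi> (x e) \<and> \<phi> C = \<phi> (x e') \<or> \<phi> C = \<phi> (y e) \<and> \<phi> C = \<phi> (y e')"
          using x[OF ee(1)] x[OF ee(2)] y[OF ee(1)] y[OF ee(2)] im by auto
        have inS: "x e' \<in> \<Union>(sub ` S)" "y e' \<in> \<Union>(sub ` S)" using x[OF ee(2)] y[OF ee(2)] sub(2) S(3) by blast+
        have inW: "x e \<in> sub W" "y e \<in> sub W" using x[OF ee(1)] y[OF ee(1)] sub(1) by blast+
        from cases show ?thesis
        proof
          assume *: "\<phi> C = \<phi> (x e) \<and> \<phi> C = \<phi> (x e')"
          then have "C = x e" using separatedD[OF sep W(1) C(1) inW(1)] by blast
          moreover have "block_of Q (x e') = block_of Q C'" using IH inS(1) C(2,3) * by metis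
          ultimately show ?thesis using xy by simp
        next
          assume *: "\<phi> C = \<phi> (y e) \<and> \<phi> C = \<phi> (y e')"
          then have "C = y e" using separatedD[OF sep W(1) C(1) inW(2)] by blast
          moreover have "block_of Q (y e') = block_of Q C'" using IH inS(2) C(2,3) * by metis
          ultimately show ?thesis using xy by simp
        qed
      qed
      show "?P (insert W S)"
      proof (intro ballI impI)
        fix C C' assume C: "C \<in> \<Union>(sub ` insert W S)" "C' \<in> \<Union>(sub ` insert W S)" "\<phi> C = \<phi> C'"
        then consider "C \<in> sub W" "C' \<in> sub W" | "C \<in> sub W" "C' \<in> \<Union>(sub ` S)"
          | "C' \<in> sub W" "C \<in> \<Union>(sub ` S)" | "C \<in> \<Union>(sub ` S)" "C' \<in> \<Union>(sub ` S)" by blast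
        then show "block_of Q C = block_of Q C'"
        proof cases
          case 1
          then show ?thesis using separatedD[OF sep W(1) 1 C(3)] by simp
        next
          case 2
          then show ?thesis using cross C(3) by blast
        next
          case 3
          then show ?thesis using cross[OF 3 C(3)[symmetric]] by simp
        next
          case 4
          then show ?thesis using IH C(3) by blast
        qed
      qed
    qed
    moreover have U: "\<Union>(sub ` Ws) = \<kappa>"
    proof -
      have "\<Union>(sub ` Ws) = block_of \<kappa> ` \<Union>Ws" by (auto simp: sub_def)
      then show ?thesis
        using partition_onD1[OF Ws_part] partition_eq_image_block_of[OF \<kappa>_part] by simp
    qed
    ultimately have all: "\<forall>C\<in>\<kappa>. \<forall>C'\<in>\<kappa>. \<phi> C = \<phi> C' \<longrightarrow> block_of Q C = block_of Q C'"
      unfolding U by blast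
    fix C C' assume C: "C \<in> \<kappa>" "C' \<in> \<kappa>" "block_of \<pi>\<kappa> C = block_of \<pi>\<kappa> C'"
    then have "C \<in> {C'' \<in> \<kappa>. \<phi> C'' = \<phi> C'}" using block_of_blocks by blast
    then show "block_of Q C = block_of Q C'" using all C by blast
  qed
  show ?thesis
    unfolding quotient_iff using part loops exy glue min by blast
qed

text \<open>Gluing the blocks of \<open>\<rho>\<close> costs at most two vertices per identification of edges, and the
  forest property bounds the number of these identifications by the number of components.\<close>

lemma defect_le_0:
  assumes sep: separated and L3: "cond_L3 ms \<pi> \<sigma>" and acyclic: "\<nexists>vs. ugraph_cycle H vs"
  shows "ES.defect Ws \<le> 0"
proof -
  obtain \<rho> x y where part: "partition_on edges \<rho>"
    and loops': "\<forall>e\<in>edges. card e = 1 \<longrightarrow> {e} \<in> \<rho>" and exy': "\<forall>e\<in>edges. e = {x e, y e}"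
    and glue: "glues_edges \<rho> x y \<pi>\<kappa>"
    and min': "\<forall>Q. partition_on \<kappa> Q \<and> glues_edges \<rho> x y Q \<longrightarrow> refines \<kappa> \<pi>\<kappa> Q"
    using L3 unfolding quotient_iff by (elim exE conjE) (rule that)
  note loops = loops'[rule_format] and exy = bspec[OF exy'] and min = min'[rule_format, OF conjI]
  define \<rho>2 where "\<rho>2 = {B \<in> \<rho>. 2 \<le> card B}"
  define r where "r B = (SOME e. e \<in> B)" for B :: "nat set set set"
  have fin\<rho>: "finite \<rho>" by (rule finite_elements[OF finite_edges part])
  then have fin\<rho>2: "finite \<rho>2" by (simp add: \<rho>2_def)
  have Bsub: "B \<subseteq> edges" if "B \<in> \<rho>2" for B using that partition_on_subset[OF part] by (simp add: \<rho>2_def)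
  have Bfin: "finite B" if "B \<in> \<rho>2" for B using finite_subset[OF Bsub[OF that] finite_edges] .
  have r: "r B \<in> B" if "B \<in> \<rho>2" for B
  proof -
    have "B \<noteq> {}" using that by (auto simp: \<rho>2_def)
    then show ?thesis unfolding r_def by (simp add: some_in_eq)
  qed
  \<comment> \<open>A class with k edges is glued by k - 1 identifications with its representative
    \<open>r B\<close>, each contributing one pair of \<open>x\<close>-ends and one pair of
    \<open>y\<close>-ends to \<open>Rel\<close>. Hence the bound 2 N.\<close>
  define N where "N = (\<Sum>B\<in>\<rho>2. card B - 1)"
  define Rel where "Rel = (\<Union>B\<in>\<rho>2. (\<lambda>e. (x (r B), x e)) ` (B - {r B}) \<union> (\<lambda>e. (y (r B), y e)) ` (B - {r B}))"
  have finRel: "finite Rel" unfolding Rel_def using fin\<rho>2 Bfin by simp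
  have "card Rel \<le> (\<Sum>B\<in>\<rho>2. card ((\<lambda>e. (x (r B), x e)) ` (B - {r B}) \<union> (\<lambda>e. (y (r B), y e)) ` (B - {r B})))"
    unfolding Rel_def by (rule card_UN_le[OF fin\<rho>2])
  also have "\<dots> \<le> (\<Sum>B\<in>\<rho>2. 2 * (card B - 1))"
  proof (rule sum_mono)
    fix B assume B: "B \<in> \<rho>2"
    have c: "card (B - {r B}) = card B - 1" using r[OF B] by simp
    have "card (h ` (B - {r B})) \<le> card B - 1" for h :: "nat set set \<Rightarrow> nat set \<times> nat set"
      using card_image_le[of "B - {r B}" h] Bfin[OF B] c by simp
    from this[of "\<lambda>e. (x (r B), x e)"] this[of "\<lambda>e. (y (r B), y e)"]
    show "card ((\<lambda>e. (x (r B), x e)) ` (B - {r B}) \<union> (\<lambda>e. (y (r B), y e)) ` (B - {r B})) \<le> 2 * (card B - 1)"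
      using card_Un_le[of "(\<lambda>e. (x (r B), x e)) ` (B - {r B})" "(\<lambda>e. (y (r B), y e)) ` (B - {r B})"] by linarith
  qed
  finally have cardRel: "card Rel \<le> 2 * N" by (simp add: N_def sum_distrib_left)
  obtain f :: "nat set \<Rightarrow> nat set" where f: "\<And>a b. (a, b) \<in> Rel \<Longrightarrow> f a = f b" "card \<kappa> \<le> card (f ` \<kappa>) + card Rel"
    using exists_merging_labels[OF finite_\<kappa> finRel] by blast
  define Q where "Q = (\<lambda>C. {C' \<in> \<kappa>. f C' = f C}) ` \<kappa>"
  have Q: "partition_on \<kappa> Q" unfolding Q_def by (rule partition_on_fibers)
  have xy_in: "x e \<in> \<kappa>" "y e \<in> \<kappa>" if "e \<in> edges" for e using exy[OF that] edge_subset_\<kappa>[OF that] by blast+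
  have "glues_edges \<rho> x y Q"
    unfolding glues_edges_def
  proof (intro ballI impI)
    fix B assume "B \<in> \<rho>" "2 \<le> card B"
    then have B: "B \<in> \<rho>2" by (simp add: \<rho>2_def)
    have "f (x e) = f (x (r B)) \<and> f (y e) = f (y (r B))" if "e \<in> B" for e
    proof (cases "e = r B")
      case False
      then have "(x (r B), x e) \<in> Rel" "(y (r B), y e) \<in> Rel" using that B unfolding Rel_def by blast+
      then show ?thesis using f(1) by metis
    qed simp
    then have "x ` B \<subseteq> {C' \<in> \<kappa>. f C' = f (x (r B))}" "y ` B \<subseteq> {C' \<in> \<kappa>. f C' = f (y (r B))}"
      using xy_in Bsub[OF B] by auto
    moreover have "r B \<in> edges" using r[OF B] Bsub[OF B] by blast
    then have "{C' \<in> \<kappa>. f C' = f (x (r B))} \<in> Q" "{C' \<in> \<kappa>. f C' = f (y (r B))} \<in> Q"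
      unfolding Q_def using imageI[OF xy_in(1)] imageI[OF xy_in(2)] by auto
    ultimately show "(\<exists>C\<in>Q. x ` B \<subseteq> C) \<and> (\<exists>C\<in>Q. y ` B \<subseteq> C)" by blast
  qed
  \<comment> \<open>The partition \<open>Q\<close> into label classes respects the gluing, so by
    minimality \<pi> refines it and has at least as many blocks.\<close>
  from refines_card_le[OF finite_\<kappa> min[OF Q this]] have "card (f ` \<kappa>) \<le> card \<pi>"
    unfolding card_blocks Q_def card_fibers[OF finite_\<kappa>] .
  then have card\<kappa>: "card \<kappa> \<le> card \<pi> + 2 * N" using f(2) cardRel by linarith
  define E2 where "E2 = \<Union>\<rho>2"
  have E2: "e \<in> edges" if "e \<in> E2" for e using that Bsub by (auto simp: E2_def)
  have finE2: "finite E2" using fin\<rho>2 Bfin by (simp add: E2_def)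
  define J where "J e = (SOME j. j \<in> A \<and> endpoints K j = e)" for e
  have J: "J e \<in> A" "endpoints K (J e) = e" if "e \<in> edges" for e
  proof -
    have "\<exists>j. j \<in> A \<and> endpoints K j = e" using that by (auto simp: edges_def)
    from someI_ex[OF this] show "J e \<in> A" "endpoints K (J e) = e" unfolding J_def by blast+
  qed
  have nonloop: "merged (J e) = {i \<in> A. endpoints G i = \<phi> ` e}" if e: "e \<in> E2" for e
  proof -
    obtain B where B: "B \<in> \<rho>2" "e \<in> B" using e by (auto simp: E2_def)
    have "card e \<noteq> 1"
    proof
      assume "card e = 1"
      then have "{e} \<in> \<rho>" using loops E2[OF e] by blast
      moreover have "B \<in> \<rho>" using B by (simp add: \<rho>2_def)
      ultimately have "B = {e}" using block_of_eqI[OF part] B(2) by (metis singletonI)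
      then show False using B(1) by (simp add: \<rho>2_def)
    qed
    moreover have "card {x e, y e} = 1 \<or> card {x e, y e} = 2" by (simp add: card_insert_if)
    ultimately have "card e = 2" using exy[OF E2[OF e]] by metis
    have im: "endpoints G (J e) = \<phi> ` e" using \<phi>_endpoints[OF J(1)] J(2) E2[OF e] by metis
    then have "card (endpoints G (J e)) = 2"
      using card_image[OF separated_inj_edge[OF sep E2[OF e]]] \<open>card e = 2\<close> by simp
    then have "\<not> is_loop G (J e)" by (simp only: card_endpoints_eq_2_iff not_False_eq_True)
    then show ?thesis by (simp add: merged_def im)
  qed
  \<comment> \<open>Glued edges have the same image in \<open>G\<close> and are non-loops there, so
    they give one black vertex of \<open>H\<close>. Hence at most \<open>card \<rho>2\<close> black
    vertices arise.\<close>
  have same_block: "merged (J e) = merged (J e')" if B: "B \<in> \<rho>2" "e \<in> B" "e' \<in> B" for B e e'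
  proof -
    have ee: "e \<in> E2" "e' \<in> E2" using B by (auto simp: E2_def)
    obtain C1 C2 where C: "C1 \<in> \<pi>\<kappa>" "x ` B \<subseteq> C1" "C2 \<in> \<pi>\<kappa>" "y ` B \<subseteq> C2"
      using glue B(1) unfolding glues_edges_def \<rho>2_def by blast
    have con: "\<phi> a = \<phi> b" if "D \<in> \<pi>\<kappa>" "a \<in> D" "b \<in> D" for D a b
      using that by (auto simp: partition_of_blocks_eq)
    have "\<phi> (x e) = \<phi> (x e')" by (rule con[OF C(1)]) (use C B in auto)
    moreover have "\<phi> (y e) = \<phi> (y e')" by (rule con[OF C(3)]) (use C B in auto)
    moreover have "\<phi> ` e = {\<phi> (x e), \<phi> (y e)}" "\<phi> ` e' = {\<phi> (x e'), \<phi> (y e')}"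
      using arg_cong[OF exy[OF E2[OF ee(1)]], of "image \<phi>"] arg_cong[OF exy[OF E2[OF ee(2)]], of "image \<phi>"] by simp_all
    ultimately have "\<phi> ` e = \<phi> ` e'" by simp
    then show ?thesis using nonloop ee by simp
  qed
  define wh where "wh e = block_of Ws (J e)" for e
  have wh: "wh e \<in> Ws" "e \<subseteq> sub (wh e)" "adj (wh e) (merged (J e))" if e: "e \<in> edges" for e
  proof -
    have W: "wh e \<in> Ws" "J e \<in> wh e" using block_of[OF Ws_part J(1)[OF e]] by (auto simp: wh_def)
    then show "wh e \<in> Ws" "adj (wh e) (merged (J e))" by (auto simp: adj_def)
    have "endpoints K (J e) \<subseteq> sub (wh e)" using W W_\<gamma>[OF W] by (auto simp: endpoints_K sub_def)
    then show "e \<subseteq> sub (wh e)" using J(2)[OF e] by simp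
  qed
  \<comment> \<open>The edge of \<open>H\<close> belonging to \<open>e\<close>. It determines
    \<open>e\<close>: the merged block gives the image of \<open>e\<close> under \<phi>, and \<phi>
    is injective on the component.\<close>
  define h where "h e = {Inr (merged (J e)), Inl (sub (wh e))}" for e
  have inj_h: "inj_on h E2"
  proof (rule inj_onI)
    fix e e' assume e: "e \<in> E2" "e' \<in> E2" "h e = h e'"
    then have m: "merged (J e) = merged (J e')" "sub (wh e) = sub (wh e')"
      by (auto simp: h_def doubleton_eq_iff)
    then have "wh e = wh e'" using inj_onD[OF sub_inj] wh(1) E2 e by blast
    have "endpoints G (J e) = endpoints G (J e')" using ends_merged J(1) E2 e m(1) by metis
    then have "\<phi> ` e = \<phi> ` e'" using \<phi>_endpoints J E2 e by metis
    moreover have "inj_on \<phi> (sub (wh e))" using sep wh(1) E2 e by (auto simp: separated_def)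
    ultimately show "e = e'"
      using wh(2) E2 e \<open>wh e = wh e'\<close> by (metis inj_on_image_eq_iff)
  qed
  define V where "V = (Inl ` sub ` Ws \<union> Inr ` (\<lambda>e. merged (J e)) ` E2 :: (nat set set + nat set) set)"
  define H' where "H' = \<lparr>uverts = V, uedges = h ` E2\<rparr>"
  have "card (uedges H') < card V"
  proof (rule forest_card_edges_less)
    show "finite V" using finite_Ws finE2 by (simp add: V_def)
    show "V \<noteq> {}" using Ws_ne by (simp add: V_def)
    show "\<exists>u\<in>V. \<exists>v\<in>V. k = {u, v}" if k: "k \<in> uedges H'" for k
    proof -
      obtain e where e: "e \<in> E2" "k = h e" using k by (auto simp: H'_def)
      have "Inr (merged (J e)) \<in> V" "Inl (sub (wh e)) \<in> V" using e wh(1)[OF E2[OF e(1)]] by (auto simp: V_def)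
      then show ?thesis using e(2) unfolding h_def by blast
    qed
    have "h e \<in> uedges H" if "e \<in> E2" for e
      unfolding uedges_H h_def using wh(1,3)[OF E2[OF that]] by blast
    then have "uedges H' \<subseteq> uedges H" by (auto simp: H'_def)
    then show "\<nexists>vs. ugraph_cycle H' vs" using acyclic ugraph_cycle_mono by blast
  qed
  moreover have "card (uedges H') = card E2" using card_image[OF inj_h] by (simp add: H'_def)
  moreover have "card V \<le> card Ws + card \<rho>2"
  proof -
    have "(\<lambda>e. merged (J e)) ` E2 \<subseteq> (\<lambda>B. merged (J (r B))) ` \<rho>2"
    proof
      fix b assume "b \<in> (\<lambda>e. merged (J e)) ` E2"
      then obtain e B where "e \<in> B" "B \<in> \<rho>2" "b = merged (J e)" by (auto simp: E2_def)
      then show "b \<in> (\<lambda>B. merged (J (r B))) ` \<rho>2" using same_block[of B e "r B"] r by blast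
    qed
    then have "card ((\<lambda>e. merged (J e)) ` E2) \<le> card \<rho>2"
      using fin\<rho>2 by (meson card_image_le card_mono finite_imageI le_trans)
    then have "card (Inr ` (\<lambda>e. merged (J e)) ` E2 :: (nat set set + nat set) set) \<le> card \<rho>2"
      by (simp add: card_image)
    moreover have "card (Inl ` sub ` Ws :: (nat set set + nat set) set) = card Ws"
      by (simp add: card_image sub_inj)
    ultimately show ?thesis
      unfolding V_def using card_Un_le[of "Inl ` sub ` Ws" "Inr ` (\<lambda>e. merged (J e)) ` E2"] by linarith
  qed
  moreover have "card E2 = N + card \<rho>2"
  proof -
    have "disjoint \<rho>2" using partition_onD2[OF part] by (auto simp: \<rho>2_def pairwise_def)
    then have "card E2 = (\<Sum>B\<in>\<rho>2. card B)"
      unfolding E2_def by (rule card_Union_disjoint) (rule Bfin)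
    also have "\<dots> = (\<Sum>B\<in>\<rho>2. (card B - 1) + 1)" by (rule sum.cong) (auto simp: \<rho>2_def)
    also have "\<dots> = N + card \<rho>2" by (simp only: sum.distrib N_def) simp
    finally show ?thesis .
  qed
  \<comment> \<open>The subforest has \<open>N + card \<rho>2\<close> edges, fewer than its at most
    \<open>card Ws + card \<rho>2\<close> vertices. With
    \<open>card \<kappa> \<le> card \<pi> + 2 * N\<close> and separation, the defect is at most
    \<open>2 * N - 2 * (card Ws - 1)\<close>.\<close>
  ultimately have "N + 1 \<le> card Ws" by linarith
  moreover have "(\<Sum>W\<in>Ws. card (VW W)) = card \<kappa>" using sum_card_VW_eq_iff sep by simp
  ultimately show ?thesis using card_\<pi>_eq card\<kappa> by simp
qed

text \<open>The left side depends on \<sigma> only through \<open>card \<sigma>\<close>, which is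
  half of \<open>card A\<close>. So if one opposite pairing satisfies the four conditions, all do,
  and any witness of (4) settles the existential statement.\<close>

lemma equality_iff: "int (card \<pi>) + int (length ms) = int (card \<sigma>) + 2 \<longleftrightarrow>
    cond_L1 ms \<sigma> \<and> cond_L2 ms \<pi> \<sigma> \<and> cond_L3 ms \<pi> \<sigma> \<and> cond_L4 ms \<pi> \<tau> \<sigma>"
proof -
  have "ES.defect Ws = 0" if "cond_L2 ms \<pi> \<sigma>" "cond_L3 ms \<pi> \<sigma>" "cond_L4 ms \<pi> \<tau> \<sigma>"
    using defect_le_0 that ES.defect_nonneg unfolding cond_L2_iff cond_L4_def ugraph_tree_def by force
  moreover have "cond_L3 ms \<pi> \<sigma> \<and> cond_L4 ms \<pi> \<tau> \<sigma>" if "cond_L2 ms \<pi> \<sigma>" "ES.defect Ws = 0"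
    using tight_cond_L3 tight_cond_L4 that unfolding cond_L2_iff by blast
  ultimately show ?thesis unfolding card_\<pi>_eq_iff by blast
qed

end

section \<open>The bound\<close>

theorem lemma4p6:
  fixes r m N :: nat and ms :: "nat list" and \<gamma> :: "nat \<Rightarrow> nat"
    and \<pi> \<tau> :: "nat set set"
    and M :: "'a measure" and \<beta> :: "nat \<Rightarrow> real" and x :: "nat \<Rightarrow> nat \<Rightarrow> 'a \<Rightarrow> complex"
  assumes "r \<ge> 1" and "length ms = r" and "\<forall>k\<in>set ms. k \<ge> 1"
    and "m = sum_list ms" and "\<gamma> = interval_perm ms"
    and "partition_on {1..m} \<pi>" and "partition_on {1..m} \<tau>"
    and "partition_join {1..m} \<tau> (perm_cycles {1..m} \<gamma>) = {{1..m}}"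
    and "prob_space M" and "wigner_entries M N \<beta> x" and "card \<pi> \<le> N"
    and "partition_cumulant M \<tau> (\<lambda>j. x (index_of_block \<pi> j) (index_of_block \<pi> (\<gamma> j))) \<noteq> 0"
  shows "refines {1..m} \<tau> (parallel_classes (T_quot ms \<pi>)) \<and>
    (\<forall>D\<in>\<tau>. even (card D) \<and> balanced_edges (T_quot ms \<pi>) D) \<and>
    (\<forall>D\<in>\<tau>. (\<exists>j\<in>D. is_loop (T_quot ms \<pi>) j) \<longrightarrow> card D = 2) \<and>
    (\<exists>\<sigma>. opposite_pairing ms \<pi> \<tau> \<sigma>) \<and>
    real (card \<pi>) - real m / 2 + real r - 2 \<le> 0 \<and>
    (real (card \<pi>) - real m / 2 + real r - 2 = 0 \<longleftrightarrow>
      (\<exists>\<sigma>. opposite_pairing ms \<pi> \<tau> \<sigma> \<and> cond_L1 ms \<sigma> \<and> cond_L2 ms \<pi> \<sigma> \<and>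
           cond_L3 ms \<pi> \<sigma> \<and> cond_L4 ms \<pi> \<tau> \<sigma>))"
proof -
  interpret prob_space M by fact
  let ?A = "{1..sum_list ms}" and ?G = "T_quot ms \<pi>"
  have \<pi>: "partition_on ?A \<pi>" and \<tau>: "partition_on ?A \<tau>" using assms(4,6,7) by auto
  note blocks = wigner_trace_blocks[OF interval_perm_permutes[OF assms(3)] \<pi> \<tau> assms(10,11) assms(12)[unfolded assms(5)]]
  have 1: "refines ?A \<tau> (parallel_classes ?G)"
    unfolding refines_def
  proof (intro conjI ballI \<tau>)
    show "partition_on ?A (parallel_classes ?G)"
      unfolding parallel_classes_def using partition_on_fibers[of ?A "endpoints ?G"] by simp
    fix D assume D: "D \<in> \<tau>"
    then obtain j where j: "j \<in> D" "j \<in> ?A" using partition_on_ex_elem[OF \<tau>] by blast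
    have "D \<subseteq> {f \<in> ?A. endpoints ?G f = endpoints ?G j}"
      using blocks(1)[OF D _ j(1)] partition_on_subset[OF \<tau> D] by blast
    moreover have "{f \<in> ?A. endpoints ?G f = endpoints ?G j} \<in> parallel_classes ?G"
      unfolding parallel_classes_def T_quot_simps using j(2) by (rule imageI)
    ultimately show "\<exists>B\<in>parallel_classes ?G. D \<subseteq> B" by blast
  qed
  have 2: "even (card D)" if D: "D \<in> \<tau>" for D
  proof (rule balanced_parallel_even)
    show "finite D" using partition_on_subset[OF \<tau> D] by (rule finite_subset) simp
  qed (use blocks[OF D] in auto)
  have 4: "\<exists>\<sigma>. opposite_pairing ms \<pi> \<tau> \<sigma>"
    by (rule exists_opposite_pairing[OF \<tau>]) (use blocks in blast)+
  have ne: "ms \<noteq> []" using assms(1,2) by auto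
  have conn: "partition_join ?A \<tau> (perm_cycles ?A (interval_perm ms)) = {?A}" using assms(4,5,8) by simp
  have setting: "opposite_setting ms \<pi> \<tau> \<sigma> ?A (interval_perm ms)" if "opposite_pairing ms \<pi> \<tau> \<sigma>" for \<sigma>
    by (rule opposite_setting.intro[OF refl refl assms(3) ne \<pi> \<tau> conn _ _ that])
      (erule blocks(1,2); assumption)+
  have card: "real m = 2 * real (card \<sigma>)" if "opposite_pairing ms \<pi> \<tau> \<sigma>" for \<sigma>
  proof -
    interpret opposite_setting ms \<pi> \<tau> \<sigma> ?A "interval_perm ms" by (rule setting[OF that])
    show ?thesis using card_A assms(4) by simp
  qed
  have le: "real (card \<pi>) + real r \<le> real (card \<sigma>) + 2" if "opposite_pairing ms \<pi> \<tau> \<sigma>" for \<sigma>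
  proof -
    interpret opposite_setting ms \<pi> \<tau> \<sigma> ?A "interval_perm ms" by (rule setting[OF that])
    show ?thesis using card_\<pi>_le assms(2) by linarith
  qed
  have eq: "real (card \<pi>) + real r = real (card \<sigma>) + 2 \<longleftrightarrow>
      cond_L1 ms \<sigma> \<and> cond_L2 ms \<pi> \<sigma> \<and> cond_L3 ms \<pi> \<sigma> \<and> cond_L4 ms \<pi> \<tau> \<sigma>" if "opposite_pairing ms \<pi> \<tau> \<sigma>" for \<sigma>
  proof -
    interpret opposite_setting ms \<pi> \<tau> \<sigma> ?A "interval_perm ms" by (rule setting[OF that])
    have "real (card \<pi>) + real r = real (card \<sigma>) + 2 \<longleftrightarrow> int (card \<pi>) + int (length ms) = int (card \<sigma>) + 2"
      using assms(2) by linarith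
    then show ?thesis using equality_iff by simp
  qed
  from 4 obtain \<sigma> where \<sigma>: "opposite_pairing ms \<pi> \<tau> \<sigma>" by blast
  have 5: "real (card \<pi>) - real m / 2 + real r - 2 \<le> 0" using le[OF \<sigma>] card[OF \<sigma>] by simp
  have eq': "real (card \<pi>) - real m / 2 + real r - 2 = 0 \<longleftrightarrow> real (card \<pi>) + real r = real (card \<sigma>') + 2"
    if "opposite_pairing ms \<pi> \<tau> \<sigma>'" for \<sigma>' using card[OF that] by auto
  have 6: "real (card \<pi>) - real m / 2 + real r - 2 = 0 \<longleftrightarrow>
      (\<exists>\<sigma>. opposite_pairing ms \<pi> \<tau> \<sigma> \<and> cond_L1 ms \<sigma> \<and> cond_L2 ms \<pi> \<sigma> \<and>
           cond_L3 ms \<pi> \<sigma> \<and> cond_L4 ms \<pi> \<tau> \<sigma>)"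
    using \<sigma> eq eq' by metis
  show ?thesis
    using 1 2 blocks(2,3) 4 5 6 assms(4) by blast
qed

end
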